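(* Let $A$ be a stably finite unital C*-algebra with $0<\operatorname{rc}(A)<\infty$. Then there is no action of any nontrivial finite group on $A$ which both has the Rokhlin property and is strictly approximately inner.
   Context: $\operatorname{U}(A)$ is the unitary group of $A$. Rokhlin property: an action $\alpha\colon G\to\operatorname{Aut}(A)$ of a finite group on a unital C*-algebra has the Rokhlin property if for every finite set $F\subset A$ and every $\varepsilon>0$ there are mutually orthogonal projections $e_g\in A$ for $g\in G$ with $\|\alpha_g(e_h)-e_{gh}\|<\varepsilon$ for all $g,h\in G$, $\|e_ga-ae_g\|<\varepsilon$ for all $g\in G$ and $a\in F$, and $\sum_{g\in G}e_g=1$. Strictly approximately inner: an action $\alpha\colon G\to\operatorname{Aut}(A)$ of a finite group on a unital C*-algebra is strictly approximately inner if for every finite set $F\subset A$ and every $\varepsilon>0$ there are $z_g\in \operatorname{U}(A)$ for $g\in G$ such that (i) $\|\alpha_g(a)-z_g a z_g^*\|<\varepsilon$ for all $g\in G$, $a\in F$; (ii) $\|z_g z_h-z_{gh}\|<\varepsilon$ for all $g,h\in G$. Cuntz subequivalence: for $a,b\in M_\infty(A)_+$ (where $M_\infty(A)=\bigcup_n M_n(A)$), $a\precsim_A b$ means there is a sequence $(c_n)$ in $M_\infty(A)$ with $\lim_n c_nbc_n^*=a$. Quasitraces: a quasitrace on a unital C*-algebra $A$ is a function $\rho\colon A\to\mathbb{C}$ such that $\rho(a^*a)=\rho(aa^* )\ge0$ for all $a\in A$; $\rho(b+ic)=\rho(b)+i\rho(c)$ for $b,c$ self-adjoint; $\rho$ is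 linear on every commutative C*-subalgebra; and there is $\rho_2\colon M_2(A)\to\mathbb{C}$ with the same three properties on $M_2(A)$ and $\rho(a)=\rho_2(a\otimes e_{1,1})$ for all $a\in A$. $\operatorname{QT}(A)$ is the set of quasitraces with $\rho(1)=1$; each $\rho\in\operatorname{QT}(A)$ is extended (unnormalized) to $M_\infty(A)$ in the standard way. Radius of comparison: let $A$ be a stably finite unital C*-algebra. For $\rho\in\operatorname{QT}(A)$ and $a\in M_\infty(A)_+$ put $d_\rho(a)=\lim_{n\to\infty}\rho(a^{1/n})$. For $r\in[0,\infty)$, $A$ has $r$-comparison if whenever $a,b\in M_\infty(A)_+$ satisfy $d_\rho(a)+r<d_\rho(b)$ for all $\rho\in\operatorname{QT}(A)$, then $a\precsim_A b$. $\operatorname{rc}(A)=\inf\{r\in[0,\infty): A\text{ has }r\text{-comparison}\}$ (and $\infty$ if there is no such $r$). *)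

theory Defs
  imports "HOL-Analysis.Analysis" "HOL-Algebra.Group_Action" "HOL-Library.Nonpos_Ints"
begin

section \<open>Unital C*-algebras\<close>

class scaleC =
  fixes scaleC :: "complex \<Rightarrow> 'a \<Rightarrow> 'a"  (infixr \<open>*\<^sub>C\<close> 75)

class star =
  fixes star :: "'a \<Rightarrow> 'a"  (\<open>(_\<^sup>\<star>)\<close> [1000] 1000)

text \<open>The superclass \<^class>\<open>real_normed_algebra_1\<close> imposes \<open>1 \<noteq> 0\<close>. This excludes only the zero
  algebra, whose radius of comparison is \<open>0\<close>.\<close>

class unital_cstar_algebra = real_normed_algebra_1 + banach + scaleC + star +
  assumes scaleC_add_right: "c *\<^sub>C (x + y) = c *\<^sub>C x + c *\<^sub>C y"
    and scaleC_add_left: "(c + d) *\<^sub>C x = c *\<^sub>C x + d *\<^sub>C x"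
    and scaleC_scaleC: "c *\<^sub>C d *\<^sub>C x = (c * d) *\<^sub>C x"
    and scaleR_scaleC: "r *\<^sub>R x = complex_of_real r *\<^sub>C x"
    and mult_scaleC_left: "(c *\<^sub>C x) * y = c *\<^sub>C (x * y)"
    and mult_scaleC_right: "x * (c *\<^sub>C y) = c *\<^sub>C (x * y)"
    and norm_scaleC: "norm (c *\<^sub>C x) = cmod c * norm x"
    and star_star: "x\<^sup>\<star>\<^sup>\<star> = x"
    and star_add: "(x + y)\<^sup>\<star> = x\<^sup>\<star> + y\<^sup>\<star>"
    and star_mult: "(x * y)\<^sup>\<star> = y\<^sup>\<star> * x\<^sup>\<star>"
    and star_scaleC: "(c *\<^sub>C x)\<^sup>\<star> = cnj c *\<^sub>C x\<^sup>\<star>"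
    and norm_star_mult_self: "norm (x\<^sup>\<star> * x) = (norm x)\<^sup>2"

lemma scaleC_zero_right: "c *\<^sub>C (0 :: 'a::unital_cstar_algebra) = 0"
  using scaleC_add_right[of c "0::'a" 0] by simp

lemma star_zero: "(0 :: 'a::unital_cstar_algebra)\<^sup>\<star> = 0"
  using star_add[of "0::'a" 0] by simp

definition is_projection :: "'a::unital_cstar_algebra \<Rightarrow> bool" where
  "is_projection p \<longleftrightarrow> p\<^sup>\<star> = p \<and> p * p = p"

definition unitary_group :: "'a::unital_cstar_algebra set" where
  "unitary_group = {u. u\<^sup>\<star> * u = 1 \<and> u * u\<^sup>\<star> = 1}"

section \<open>Finite matrices over a C*-algebra\<close>

text \<open>Elements of \<open>M\<^sub>\<infinity>(A)\<close> are the infinite matrices vanishing outside some upper left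
  \<open>n \<times> n\<close> corner; indices start at \<open>0\<close>.\<close>

typedef (overloaded) 'a minf =
  "{x :: nat \<Rightarrow> nat \<Rightarrow> 'a::zero. \<exists>n. \<forall>i j. n \<le> i \<or> n \<le> j \<longrightarrow> x i j = 0}"
  morphisms entry Abs_minf
  by (rule exI[of _ "\<lambda>_ _. 0"]) simp

setup_lifting type_definition_minf

lemma minf_eqI: "(\<And>i j. entry x i j = entry y i j) \<Longrightarrow> x = y"
  by (metis entry_inject ext)

instantiation minf :: (unital_cstar_algebra) "{ring, scaleC, star}"
begin

lift_definition zero_minf :: "'a minf" is "\<lambda>_ _. 0"
  by simp

lift_definition plus_minf :: "'a minf \<Rightarrow> 'a minf \<Rightarrow> 'a minf" is "\<lambda>x y i j. x i j + y i j"
  by (elim exE, rename_tac m n, rule_tac x="max m n" in exI) auto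

lift_definition uminus_minf :: "'a minf \<Rightarrow> 'a minf" is "\<lambda>x i j. - x i j"
  by auto

lift_definition minus_minf :: "'a minf \<Rightarrow> 'a minf \<Rightarrow> 'a minf" is "\<lambda>x y i j. x i j - y i j"
  by (elim exE, rename_tac m n, rule_tac x="max m n" in exI) auto

lift_definition times_minf :: "'a minf \<Rightarrow> 'a minf \<Rightarrow> 'a minf"
  is "\<lambda>x y i j. \<Sum>k | x i k \<noteq> 0. x i k * y k j"
  by (elim exE, rename_tac m n, rule_tac x="max m n" in exI) (auto intro!: sum.neutral)

lift_definition scaleC_minf :: "complex \<Rightarrow> 'a minf \<Rightarrow> 'a minf" is "\<lambda>c x i j. c *\<^sub>C x i j"
  by (elim exE, rule_tac x=n in exI) (simp add: scaleC_zero_right)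

lift_definition star_minf :: "'a minf \<Rightarrow> 'a minf" is "\<lambda>x i j. (x j i)\<^sup>\<star>"
  by (elim exE, rule_tac x=n in exI) (simp add: star_zero)

lemma entry_times:
  fixes x y :: "'a minf"
  assumes "\<And>i j. N \<le> i \<or> N \<le> j \<Longrightarrow> entry x i j = 0"
  shows "entry (x * y) i j = (\<Sum>k<N. entry x i k * entry y k j)"
proof -
  have "{k. entry x i k \<noteq> 0} \<subseteq> {..<N}"
    using assms by (metis (mono_tags, lifting) lessThan_iff mem_Collect_eq not_le subsetI)
  then have "(\<Sum>k | entry x i k \<noteq> 0. entry x i k * entry y k j)
      = (\<Sum>k<N. entry x i k * entry y k j)"
    by (intro sum.mono_neutral_left) auto
  then show ?thesis by (simp add: times_minf.rep_eq)
qed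

lemma entry_bound:
  obtains N where "\<And>i j. N \<le> i \<or> N \<le> j \<Longrightarrow> entry (x :: 'a minf) i j = 0"
  using entry[of x] by auto

instance
proof
  fix x y z :: "'a minf"
  obtain N1 where N1: "\<And>i j. N1 \<le> i \<or> N1 \<le> j \<Longrightarrow> entry x i j = 0" by (rule entry_bound) blast
  obtain N2 where N2: "\<And>i j. N2 \<le> i \<or> N2 \<le> j \<Longrightarrow> entry y i j = 0" by (rule entry_bound) blast
  obtain N3 where N3: "\<And>i j. N3 \<le> i \<or> N3 \<le> j \<Longrightarrow> entry (x * y) i j = 0" by (rule entry_bound) blast
  define N where "N = max N1 (max N2 N3)"
  have Nx: "\<And>i j. N \<le> i \<or> N \<le> j \<Longrightarrow> entry x i j = 0"
    and Ny: "\<And>i j. N \<le> i \<or> N \<le> j \<Longrightarrow> entry y i j = 0"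
    and Nxy: "\<And>i j. N \<le> i \<or> N \<le> j \<Longrightarrow> entry (x * y) i j = 0"
    using N1 N2 N3 by (auto simp: N_def)
  have Ns: "\<And>i j. N \<le> i \<or> N \<le> j \<Longrightarrow> entry (x + y) i j = 0"
    using Nx Ny by (auto simp: plus_minf.rep_eq)
  show "x * y * z = x * (y * z)"
  proof (rule minf_eqI)
    fix i j
    have "entry (x * y * z) i j = (\<Sum>k<N. \<Sum>l<N. entry x i l * entry y l k * entry z k j)"
      by (simp add: entry_times[OF Nxy] entry_times[OF Nx] sum_distrib_right)
    also have "\<dots> = (\<Sum>l<N. \<Sum>k<N. entry x i l * entry y l k * entry z k j)"
      by (rule sum.swap)
    also have "\<dots> = entry (x * (y * z)) i j"
      by (simp add: entry_times[OF Nx] entry_times[OF Ny] sum_distrib_left mult.assoc)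
    finally show "entry (x * y * z) i j = entry (x * (y * z)) i j" .
  qed
  show "(x + y) * z = x * z + y * z"
    by (rule minf_eqI)
      (simp add: entry_times[OF Ns] entry_times[OF Nx] entry_times[OF Ny] plus_minf.rep_eq
        distrib_right sum.distrib)
  show "x * (y + z) = x * y + x * z"
    by (rule minf_eqI)
      (simp add: entry_times[OF Nx] plus_minf.rep_eq distrib_left sum.distrib)
qed (transfer; auto simp: fun_eq_iff)+

end

definition Mn :: "nat \<Rightarrow> 'a::unital_cstar_algebra minf set" where
  "Mn n = {x. \<forall>i j. n \<le> i \<or> n \<le> j \<longrightarrow> entry x i j = 0}"

text \<open>The unit of \<open>M\<^sub>n(A)\<close>.\<close>

lift_definition mone :: "nat \<Rightarrow> 'a::unital_cstar_algebra minf"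
  is "\<lambda>n i j. if i = j \<and> i < n then 1 else 0"
  by (rename_tac n, rule_tac x=n in exI) auto

text \<open>The matrix \<open>a \<otimes> e\<^sub>1\<^sub>,\<^sub>1\<close>.\<close>

lift_definition corner :: "'a::unital_cstar_algebra \<Rightarrow> 'a minf"
  is "\<lambda>a i j. if i = 0 \<and> j = 0 then a else 0"
  by (auto intro!: exI[of _ 1])

text \<open>The C*-norm of \<open>M\<^sub>n(A)\<close> is the operator norm for its action by left multiplication on the
  Hilbert \<open>A\<close>-module \<open>A\<^sup>n\<close>, whose norm is \<open>\<parallel>\<Sum>\<^sub>i v\<^sub>i\<^sup>\<star> v\<^sub>i\<parallel>\<^sup>1\<^sup>/\<^sup>2\<close>. These norms are compatible with the
  inclusions \<open>M\<^sub>n(A) \<subseteq> M\<^sub>n\<^sub>+\<^sub>1(A)\<close>, so that finitely supported columns of any length may be used.\<close>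

definition column_norm :: "(nat \<Rightarrow> 'a::unital_cstar_algebra) \<Rightarrow> real" where
  "column_norm v = sqrt (norm (\<Sum>i | v i \<noteq> 0. (v i)\<^sup>\<star> * v i))"

definition apply_column ::
    "'a::unital_cstar_algebra minf \<Rightarrow> (nat \<Rightarrow> 'a) \<Rightarrow> nat \<Rightarrow> 'a" where
  "apply_column x v i = (\<Sum>j | entry x i j \<noteq> 0. entry x i j * v j)"

definition minf_norm :: "'a::unital_cstar_algebra minf \<Rightarrow> real" where
  "minf_norm x =
    (SUP v \<in> {v. finite {i. v i \<noteq> 0} \<and> column_norm v \<le> 1}. column_norm (apply_column x v))"

definition stably_finite :: "'a::unital_cstar_algebra itself \<Rightarrow> bool" where
  "stably_finite _ \<longleftrightarrow>
    (\<forall>n. \<forall>v \<in> (Mn n :: 'a minf set). v\<^sup>\<star> * v = mone n \<longrightarrow> v * v\<^sup>\<star> = mone n)"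

definition minf_positive :: "'a::unital_cstar_algebra minf set" where
  "minf_positive = {x\<^sup>\<star> * x | x. True}"

text \<open>For \<open>n \<ge> 1\<close> this is \<open>a\<^sup>1\<^sup>/\<^sup>n\<close>. As \<open>M\<^sub>\<infinity>(A)\<close> has no unit, the power \<open>b\<^sup>n\<close> is written as the
  \<open>(n - 1)\<close>-fold left multiplication by \<open>b\<close> applied to \<open>b\<close>.\<close>

definition positive_root :: "nat \<Rightarrow> 'a::unital_cstar_algebra minf \<Rightarrow> 'a minf" where
  "positive_root n a = (THE b. b \<in> minf_positive \<and> (((*) b) ^^ (n - 1)) b = a)"

definition cuntz_subequivalent ::
    "'a::unital_cstar_algebra minf \<Rightarrow> 'a minf \<Rightarrow> bool"  (infix \<open>\<precsim>\<close> 50) where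
  "a \<precsim> b \<longleftrightarrow> (\<exists>c :: nat \<Rightarrow> 'a minf. (\<lambda>n. minf_norm (c n * b * (c n)\<^sup>\<star> - a)) \<longlonglongrightarrow> 0)"

section \<open>Quasitraces\<close>

text \<open>The next two definitions are applied both to \<open>A\<close> itself and to \<open>M\<^sub>n(A)\<close>. Here \<open>S\<close> is the
  underlying set and \<open>nrm\<close> the norm of the C*-algebra in question. Subalgebras need not contain
  its unit.\<close>

definition commutative_cstar_subalgebra ::
    "('b::{ring,scaleC,star} \<Rightarrow> real) \<Rightarrow> 'b set \<Rightarrow> 'b set \<Rightarrow> bool" where
  "commutative_cstar_subalgebra nrm S B \<longleftrightarrow>
     B \<subseteq> S \<and> 0 \<in> B \<and>
     (\<forall>x\<in>B. \<forall>y\<in>B. x + y \<in> B \<and> x * y \<in> B) \<and>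
     (\<forall>c. \<forall>x\<in>B. c *\<^sub>C x \<in> B) \<and>
     (\<forall>x\<in>B. x\<^sup>\<star> \<in> B) \<and>
     (\<forall>u x. (\<forall>n. u n \<in> B) \<and> x \<in> S \<and> (\<lambda>n. nrm (u n - x)) \<longlonglongrightarrow> 0 \<longrightarrow> x \<in> B) \<and>
     (\<forall>x\<in>B. \<forall>y\<in>B. x * y = y * x)"

definition quasitrace_conditions ::
    "('b::{ring,scaleC,star} \<Rightarrow> real) \<Rightarrow> 'b set \<Rightarrow> ('b \<Rightarrow> complex) \<Rightarrow> bool" where
  "quasitrace_conditions nrm S \<rho> \<longleftrightarrow>
     (\<forall>a\<in>S. \<rho> (a\<^sup>\<star> * a) = \<rho> (a * a\<^sup>\<star>) \<and> \<rho> (a\<^sup>\<star> * a) \<in> \<real>\<^sub>\<ge>\<^sub>0) \<and>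
     (\<forall>b\<in>S. \<forall>c\<in>S. b\<^sup>\<star> = b \<and> c\<^sup>\<star> = c \<longrightarrow> \<rho> (b + \<i> *\<^sub>C c) = \<rho> b + \<i> * \<rho> c) \<and>
     (\<forall>B. commutative_cstar_subalgebra nrm S B \<longrightarrow>
        (\<forall>x\<in>B. \<forall>y\<in>B. \<rho> (x + y) = \<rho> x + \<rho> y) \<and> (\<forall>c. \<forall>x\<in>B. \<rho> (c *\<^sub>C x) = c * \<rho> x))"

definition quasitrace :: "('a::unital_cstar_algebra \<Rightarrow> complex) \<Rightarrow> bool" where
  "quasitrace \<rho> \<longleftrightarrow> quasitrace_conditions norm UNIV \<rho> \<and>
     (\<exists>\<rho>2. quasitrace_conditions minf_norm (Mn 2) \<rho>2 \<and> (\<forall>a. \<rho> a = \<rho>2 (corner a)))"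

definition QT :: "('a::unital_cstar_algebra \<Rightarrow> complex) set" where
  "QT = {\<rho>. quasitrace \<rho> \<and> \<rho> 1 = 1}"

text \<open>Every quasitrace \<open>\<rho>\<close> on \<open>A\<close> has exactly one extension \<open>\<tau>\<close> to \<open>M\<^sub>\<infinity>(A)\<close> in the following sense
  (Blackadar--Handelman, Haagerup). It is unnormalized: if \<open>\<rho>(1) = 1\<close>, then \<open>\<tau>(1\<^sub>n) = n\<close>. Rather
  than choosing it by a description operator, the definition of comparison below refers to it
  through this relation.\<close>

definition quasitrace_extension ::
    "('a::unital_cstar_algebra \<Rightarrow> complex) \<Rightarrow> ('a minf \<Rightarrow> complex) \<Rightarrow> bool" where
  "quasitrace_extension \<rho> \<tau> \<longleftrightarrow>
     (\<forall>n. quasitrace_conditions minf_norm (Mn n) \<tau>) \<and> (\<forall>a. \<tau> (corner a) = \<rho> a)"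

section \<open>Radius of comparison\<close>

definition dim_fun :: "('a::unital_cstar_algebra minf \<Rightarrow> complex) \<Rightarrow> 'a minf \<Rightarrow> real" where
  "dim_fun \<tau> a = lim (\<lambda>n. Re (\<tau> (positive_root n a)))"

definition has_comparison :: "'a::unital_cstar_algebra itself \<Rightarrow> real \<Rightarrow> bool" where
  "has_comparison _ r \<longleftrightarrow>
     (\<forall>a \<in> (minf_positive :: 'a minf set). \<forall>b \<in> minf_positive.
        (\<forall>\<rho>\<in>QT. \<forall>\<tau>. quasitrace_extension \<rho> \<tau> \<longrightarrow> dim_fun \<tau> a + r < dim_fun \<tau> b)
        \<longrightarrow> a \<precsim> b)"

definition rc :: "'a::unital_cstar_algebra itself \<Rightarrow> ereal" where
  "rc T = Inf (ereal ` {r. 0 \<le> r \<and> has_comparison T r})"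

section \<open>Actions of finite groups\<close>

definition star_automorphism :: "('a::unital_cstar_algebra \<Rightarrow> 'a) \<Rightarrow> bool" where
  "star_automorphism f \<longleftrightarrow> bij f \<and>
     (\<forall>x y. f (x + y) = f x + f y) \<and> (\<forall>c x. f (c *\<^sub>C x) = c *\<^sub>C f x) \<and>
     (\<forall>x y. f (x * y) = f x * f y) \<and> (\<forall>x. f (x\<^sup>\<star>) = (f x)\<^sup>\<star>)"

definition cstar_action ::
    "('g, 'm) monoid_scheme \<Rightarrow> ('g \<Rightarrow> 'a::unital_cstar_algebra \<Rightarrow> 'a) \<Rightarrow> bool" where
  "cstar_action G \<alpha> \<longleftrightarrow> group_action G UNIV \<alpha> \<and> (\<forall>g \<in> carrier G. star_automorphism (\<alpha> g))"

definition rokhlin_property ::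
    "('g, 'm) monoid_scheme \<Rightarrow> ('g \<Rightarrow> 'a::unital_cstar_algebra \<Rightarrow> 'a) \<Rightarrow> bool" where
  "rokhlin_property G \<alpha> \<longleftrightarrow>
     (\<forall>F \<epsilon>. finite F \<and> 0 < \<epsilon> \<longrightarrow>
        (\<exists>e :: 'g \<Rightarrow> 'a.
           (\<forall>g \<in> carrier G. is_projection (e g)) \<and>
           (\<forall>g \<in> carrier G. \<forall>h \<in> carrier G. g \<noteq> h \<longrightarrow> e g * e h = 0) \<and>
           (\<forall>g \<in> carrier G. \<forall>h \<in> carrier G. norm (\<alpha> g (e h) - e (g \<otimes>\<^bsub>G\<^esub> h)) < \<epsilon>) \<and>
           (\<forall>g \<in> carrier G. \<forall>a \<in> F. norm (e g * a - a * e g) < \<epsilon>) \<and>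
           (\<Sum>g \<in> carrier G. e g) = 1))"

definition strictly_approximately_inner ::
    "('g, 'm) monoid_scheme \<Rightarrow> ('g \<Rightarrow> 'a::unital_cstar_algebra \<Rightarrow> 'a) \<Rightarrow> bool" where
  "strictly_approximately_inner G \<alpha> \<longleftrightarrow>
     (\<forall>F \<epsilon>. finite F \<and> 0 < \<epsilon> \<longrightarrow>
        (\<exists>z :: 'g \<Rightarrow> 'a.
           (\<forall>g \<in> carrier G. z g \<in> unitary_group) \<and>
           (\<forall>g \<in> carrier G. \<forall>a \<in> F. norm (\<alpha> g a - z g * a * (z g)\<^sup>\<star>) < \<epsilon>) \<and>
           (\<forall>g \<in> carrier G. \<forall>h \<in> carrier G. norm (z g * z h - z (g \<otimes>\<^bsub>G\<^esub> h)) < \<epsilon>)))"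

end

theory Submission
  imports Defs
begin

text \<open>
  Suppose that an action of a group with \<open>n \<ge> 2\<close> elements has both properties. Combining the
  projections of the Rokhlin property with two families of unitaries that almost implement the action
  gives approximately central \<open>n \<times> n\<close> matrix units in \<open>A\<close>. With their help a matrix over \<open>M\<^sub>n\<close>
  implementing \<open>a \<otimes> 1\<^sub>n \<precsim> b \<otimes> 1\<^sub>n\<close> is compressed to one implementing \<open>a \<precsim> b\<close>. Since
  \<open>d\<^sub>\<rho>(a \<otimes> 1\<^sub>n) = n d\<^sub>\<rho>(a)\<close>, it follows that \<open>r\<close>-comparison implies \<open>r/n\<close>-comparison. So the radius of
  comparison is at most its \<open>n\<close>-th part, which is impossible if it is positive and finite.

  The identity for \<open>d\<^sub>\<rho>\<close> rests on the existence and uniqueness of roots of positive matrices. Spectra are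
  avoided: positivity is a norm condition, and roots are binomial series.
\<close>

section \<open>Roots by the binomial series\<close>

text \<open>One family of unitaries is not enough: unitaries that carry e_1 to e_g also move the
  given finite set. The other family cancels this motion, and it spares e_1 only if e_1 almost
  commutes with it. This forces the order of choice: the correcting unitaries, then the projections,
  then the unitaries that move the projections. The compression works because the partial isometries
  v_g obtained in this way share the initial projection e_1 and their range projections almost sum
  up to 1. So a is almost the sum of the v_g a v_g^*, which is what a on the diagonal of an n x n
  matrix becomes. Two features of dimension functions shape the rest. A quasitrace is additive only
  on commuting elements, so all roots involved must be kept inside one commutative subalgebra. And
  d_\<rho> is a limit of roots given by a definite description, so roots must be unique and the
  limit must exist before a factor n can be taken out.\<close>

lemma summable_abs_fps_mult:
  fixes f g :: "real fps"
  assumes f: "summable (\<lambda>j. \<bar>fps_nth f j\<bar>)" and g: "summable (\<lambda>j. \<bar>fps_nth g j\<bar>)"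
  shows "summable (\<lambda>j. \<bar>fps_nth (f * g) j\<bar>)"
proof (rule summable_comparison_test')
  show "summable (\<lambda>k. \<Sum>i\<le>k. \<bar>fps_nth f i\<bar> * \<bar>fps_nth g (k - i)\<bar>)"
    using f g by (intro summable_Cauchy_product) auto
  show "norm \<bar>fps_nth (f * g) k\<bar> \<le> (\<Sum>i\<le>k. \<bar>fps_nth f i\<bar> * \<bar>fps_nth g (k - i)\<bar>)"
    if "0 \<le> k" for k
    unfolding fps_mult_nth real_norm_def abs_abs atLeast0AtMost
    by (rule order_trans[OF sum_abs]) (simp add: abs_mult)
qed

text \<open>Absolutely summable coefficients give convergence on the whole closed unit ball. The
  boundary matters: after scaling, the positivity condition used below gives only norm at most
  1.\<close>

definition fps_value :: "real fps \<Rightarrow> 'a::{real_normed_algebra_1,banach} \<Rightarrow> 'a" where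
  "fps_value f x = (\<Sum>j. fps_nth f j *\<^sub>R x ^ j)"

lemma summable_norm_fps_value:
  fixes x :: "'a::{real_normed_algebra_1,banach}"
  assumes "summable (\<lambda>j. \<bar>fps_nth f j\<bar>)" "norm x \<le> 1"
  shows "summable (\<lambda>j. norm (fps_nth f j *\<^sub>R x ^ j))"
proof (rule summable_comparison_test'[OF assms(1)])
  fix j
  have "norm (x ^ j) \<le> 1"
    using norm_power_ineq[of x j] power_le_one[OF norm_ge_zero assms(2)] by (meson order_trans)
  then show "norm (norm (fps_nth f j *\<^sub>R x ^ j)) \<le> \<bar>fps_nth f j\<bar>"
    by (simp add: mult_left_le)
qed

lemma fps_value_mult:
  fixes x :: "'a::{real_normed_algebra_1,banach}"
  assumes "summable (\<lambda>j. \<bar>fps_nth f j\<bar>)" "summable (\<lambda>j. \<bar>fps_nth g j\<bar>)" "norm x \<le> 1"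
  shows "fps_value (f * g) x = fps_value f x * fps_value g x"
proof -
  have eq: "fps_nth (f * g) k *\<^sub>R x ^ k
      = (\<Sum>i\<le>k. (fps_nth f i *\<^sub>R x ^ i) * (fps_nth g (k - i) *\<^sub>R x ^ (k - i)))" for k
    unfolding fps_mult_nth atLeast0AtMost scaleR_sum_left
    by (intro sum.cong refl) (simp add: power_add[symmetric])
  show ?thesis
    unfolding fps_value_def eq
    by (rule Cauchy_product[symmetric]) (rule summable_norm_fps_value; fact)+
qed

lemma fps_value_one: "fps_value 1 x = 1"
proof -
  have "(\<lambda>j. fps_nth 1 j *\<^sub>R x ^ j) = (\<lambda>j. if j = 0 then 1 else 0)"
    by auto
  then show ?thesis
    unfolding fps_value_def using sums_unique[OF sums_single[of 0 "\<lambda>_. 1::'a"]] by simp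
qed

lemma fps_value_power:
  fixes x :: "'a::{real_normed_algebra_1,banach}"
  assumes f: "summable (\<lambda>j. \<bar>fps_nth f j\<bar>)" and x: "norm x \<le> 1"
  shows "summable (\<lambda>j. \<bar>fps_nth (f ^ n) j\<bar>) \<and> fps_value (f ^ n) x = fps_value f x ^ n"
proof (induction n)
  case 0
  have "finite {j. \<bar>fps_nth (1 :: real fps) j\<bar> \<noteq> 0}" by (auto intro: finite_subset[of _ "{0}"])
  then show ?case
    by (auto simp: fps_value_one intro!: summable_finite[of "{0}"])
next
  case (Suc n)
  then show ?case
    using summable_abs_fps_mult[of f "f ^ n"] fps_value_mult[of f "f ^ n" x] f x by simp
qed

lemma fps_value_commute:
  fixes x :: "'a::{real_normed_algebra_1,banach}"
  assumes f: "summable (\<lambda>j. \<bar>fps_nth f j\<bar>)" and x: "norm x \<le> 1" and y: "y * x = x * y"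
  shows "y * fps_value f x = fps_value f x * y"
proof -
  have s: "summable (\<lambda>j. fps_nth f j *\<^sub>R x ^ j)"
    by (rule summable_norm_cancel) (rule summable_norm_fps_value[OF f x])
  have "y * x ^ j = x ^ j * y" for j
    by (induction j) (auto simp: y mult.assoc, metis y mult.assoc)
  then show ?thesis
    unfolding fps_value_def by (simp add: suminf_mult[OF s, symmetric] suminf_mult2[OF s])
qed

text \<open>All binomial coefficients of exponent \<open>1/k\<close> except the first have the sign that makes the
  terms of the series of \<open>(1 - y)\<^sup>1\<^sup>/\<^sup>k\<close> nonpositive; their absolute values sum up to at most
  \<open>1\<close> because \<open>(1 - y)\<^sup>1\<^sup>/\<^sup>k \<ge> 0\<close> for \<open>y < 1\<close>.\<close>

lemma gbinomial_inverse_nat_sign: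
  assumes "1 \<le> k"
  shows "(1 / real k gchoose Suc j) * (-1) ^ Suc j = - \<bar>1 / real k gchoose Suc j\<bar>"
proof -
  have "(1 / real k gchoose Suc j) * (-1) ^ Suc j \<le> 0"
  proof (induction j)
    case 0 then show ?case using assms by simp
  next
    case (Suc j)
    have "(1 / real k gchoose Suc (Suc j)) * (-1) ^ Suc (Suc j)
       = ((1 / real k gchoose Suc j) * (-1) ^ Suc j) * ((real (Suc j) - 1 / real k) / real (Suc (Suc j)))"
    proof -
      have "real (Suc (Suc j)) * (1 / real k gchoose Suc (Suc j))
          = (1 / real k - real (Suc j)) * (1 / real k gchoose Suc j)"
        using gbinomial_absorb_comp[of "1 / real k" "Suc j"] gbinomial_mult_1[of "1 / real k" "Suc j"]
        by (simp add: algebra_simps)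
      then have "(1 / real k gchoose Suc (Suc j))
          = (1 / real k - real (Suc j)) * (1 / real k gchoose Suc j) / real (Suc (Suc j))"
        by (metis nonzero_mult_div_cancel_left of_nat_eq_0_iff nat.distinct(1))
      then show ?thesis by (simp only: power_Suc) (simp add: divide_simps, simp add: algebra_simps)
    qed
    moreover have "0 \<le> real (Suc j) - 1 / real k"
    proof -
      have "1 / real k \<le> 1" using assms by (simp add: divide_le_eq)
      then show ?thesis by simp
    qed
    ultimately show ?case
      using Suc by (metis mult_nonpos_nonneg divide_nonneg_nonneg of_nat_0_le_iff)
  qed
  then have "\<bar>(1 / real k gchoose Suc j) * (-1) ^ Suc j\<bar> = - ((1 / real k gchoose Suc j) * (-1) ^ Suc j)"
    by (rule abs_of_nonpos)
  then show ?thesis by (simp add: abs_mult power_abs)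
qed

lemma sum_abs_gbinomial_inverse_nat:
  assumes k: "1 \<le> k"
  shows "(\<Sum>j<J. \<bar>1 / real k gchoose Suc j\<bar>) \<le> 1"
proof -
  have bound: "(\<Sum>j<J. \<bar>1 / real k gchoose Suc j\<bar> * y ^ Suc j) \<le> 1" if y: "0 < y" "y < 1" for y :: real
  proof -
    let ?t = "\<lambda>j. (1 / real k gchoose j) * (- y) ^ j"
    have S: "?t sums (1 + - y) powr (1 / real k)"
      by (rule gen_binomial_real) (use y in auto)
    have t: "?t (Suc j) = - (\<bar>1 / real k gchoose Suc j\<bar> * y ^ Suc j)" for j
    proof -
      have "?t (Suc j) = ((1 / real k gchoose Suc j) * (-1) ^ Suc j) * y ^ Suc j"
        by (simp add: power_minus[of y])
      then show ?thesis by (simp only: gbinomial_inverse_nat_sign[OF k])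
    qed
    have "(\<lambda>j. ?t (Suc j)) sums ((1 + - y) powr (1 / real k) - ?t 0)"
      using S by (subst sums_Suc_iff) simp
    then have "(\<lambda>j. - ?t (Suc j)) sums (- ((1 + - y) powr (1 / real k) - ?t 0))"
      by (rule sums_minus)
    then have S': "(\<lambda>j. \<bar>1 / real k gchoose Suc j\<bar> * y ^ Suc j) sums (1 - (1 - y) powr (1 / real k))"
      by (simp only: t) simp
    have "(\<Sum>j<J. \<bar>1 / real k gchoose Suc j\<bar> * y ^ Suc j) \<le> (1 - (1 - y) powr (1 / real k))"
      unfolding sums_unique[OF S']
      by (rule sum_le_suminf) (use S' y in \<open>auto simp: sums_iff\<close>)
    then show ?thesis by (smt (verit) powr_ge_zero)
  qed
  \<comment> \<open>A partial sum is a polynomial in y, so the bound for y < 1 survives the limit as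
    y tends to 1 from the left.\<close>
  have "((\<lambda>y. \<Sum>j<J. \<bar>1 / real k gchoose Suc j\<bar> * y ^ Suc j)
      \<longlongrightarrow> (\<Sum>j<J. \<bar>1 / real k gchoose Suc j\<bar> * 1 ^ Suc j)) (at_left (1::real))"
    by (intro tendsto_intros)
  moreover have "eventually (\<lambda>y. (\<Sum>j<J. \<bar>1 / real k gchoose Suc j\<bar> * y ^ Suc j) \<le> 1) (at_left (1::real))"
    by (rule eventually_mono[OF eventually_at_left_real[of 0]]) (use bound in auto)
  ultimately have "(\<Sum>j<J. \<bar>1 / real k gchoose Suc j\<bar> * 1 ^ Suc j) \<le> 1"
    by (rule tendsto_upperbound) (simp add: trivial_limit_at_left_real)
  then show ?thesis by simp
qed

lemma summable_gbinomial_inverse_nat: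
  assumes "1 \<le> k"
  shows "summable (\<lambda>j. \<bar>1 / real k gchoose j\<bar>)"
    and "(\<Sum>j. \<bar>1 / real k gchoose Suc j\<bar>) \<le> 1"
proof -
  have s: "summable (\<lambda>j. \<bar>1 / real k gchoose Suc j\<bar>)"
    by (rule bounded_imp_summable[of _ 1])
      (use sum_abs_gbinomial_inverse_nat[OF assms, of "Suc n" for n] in \<open>auto simp: lessThan_Suc_atMost\<close>)
  then show "summable (\<lambda>j. \<bar>1 / real k gchoose j\<bar>)"
    using summable_Suc_iff[of "\<lambda>j. \<bar>1 / real k gchoose j\<bar>"] by blast
  show "(\<Sum>j. \<bar>1 / real k gchoose Suc j\<bar>) \<le> 1"
    by (rule suminf_le_const[OF s]) (rule sum_abs_gbinomial_inverse_nat[OF assms])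
qed

text \<open>The k-th power of the binomial series of exponent 1/k is the one of exponent 1, that is
  1 + x. The bound on 1 - h is the sum of the absolute coefficients without the first; it makes a
  selfadjoint root satisfy \<open>nonneg_elem\<close> below with t = 1.\<close>

lemma binomial_series_root:
  fixes x :: "'a::{real_normed_algebra_1,banach}"
  assumes k: "1 \<le> k" and x: "norm x \<le> 1"
  defines "h \<equiv> fps_value (fps_binomial (1 / real k)) x"
  shows "h ^ k = 1 + x" "norm (1 - h) \<le> 1" "y * x = x * y \<Longrightarrow> y * h = h * y"
proof -
  let ?f = "fps_binomial (1 / real k)"
  have s: "summable (\<lambda>j. \<bar>fps_nth ?f j\<bar>)"
    using summable_gbinomial_inverse_nat[OF k] by simp
  have "h ^ k = fps_value (?f ^ k) x"
    using fps_value_power[OF s x, of k] by (simp add: h_def)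
  also have "?f ^ k = fps_binomial 1"
    using k by (simp add: fps_binomial_power)
  also have "fps_value (fps_binomial 1) x = 1 + x"
  proof -
    have "fps_nth (fps_binomial (1::real)) j = 0" if "2 \<le> j" for j
      using that by (simp add: binomial_gbinomial[of 1 j, simplified, symmetric] binomial_eq_0)
    then have "fps_value (fps_binomial 1) x = (\<Sum>j<2. fps_nth (fps_binomial 1) j *\<^sub>R x ^ j)"
      unfolding fps_value_def by (intro suminf_finite) auto
    then show ?thesis by (simp add: eval_nat_numeral)
  qed
  finally show "h ^ k = 1 + x" .
  have sn: "summable (\<lambda>j. norm (fps_nth ?f j *\<^sub>R x ^ j))"
    by (rule summable_norm_fps_value[OF s x])
  then have snS: "summable (\<lambda>j. norm (fps_nth ?f (Suc j) *\<^sub>R x ^ Suc j))"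
    using summable_Suc_iff[of "\<lambda>j. norm (fps_nth ?f j *\<^sub>R x ^ j)"] by blast
  have "h = (\<Sum>j. fps_nth ?f (Suc j) *\<^sub>R x ^ Suc j) + 1"
    unfolding h_def fps_value_def using suminf_split_head[OF summable_norm_cancel[OF sn]] by simp
  then have "norm (1 - h) = norm (\<Sum>j. fps_nth ?f (Suc j) *\<^sub>R x ^ Suc j)"
    by simp
  also have "\<dots> \<le> (\<Sum>j. norm (fps_nth ?f (Suc j) *\<^sub>R x ^ Suc j))"
    by (rule summable_norm[OF snS])
  also have "\<dots> \<le> (\<Sum>j. \<bar>1 / real k gchoose Suc j\<bar>)"
  proof (rule suminf_le)
    show "summable (\<lambda>j. norm (fps_nth ?f (Suc j) *\<^sub>R x ^ Suc j))"
      by (rule snS)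
    show "summable (\<lambda>j. \<bar>1 / real k gchoose Suc j\<bar>)"
      using s summable_Suc_iff[of "\<lambda>j. \<bar>1 / real k gchoose j\<bar>"] by simp
    fix j
    have "norm (x ^ Suc j) \<le> 1"
      using norm_power_ineq[of x "Suc j"] power_le_one[OF norm_ge_zero x] by (meson order_trans)
    then show "norm (fps_nth ?f (Suc j) *\<^sub>R x ^ Suc j) \<le> \<bar>1 / real k gchoose Suc j\<bar>"
      by (simp add: mult_left_le del: power_Suc)
  qed
  also have "\<dots> \<le> 1" by (rule summable_gbinomial_inverse_nat[OF k])
  finally show "norm (1 - h) \<le> 1" .
  show "y * x = x * y \<Longrightarrow> y * h = h * y"
    unfolding h_def by (rule fps_value_commute[OF s x])
qed

section \<open>Positive elements\<close>

lemma star_one [simp]: "(1::'a::unital_cstar_algebra)\<^sup>\<star> = 1"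
  by (metis mult.right_neutral star_mult star_star mult_1_left)

lemma star_minus: "(- x ::'a::unital_cstar_algebra)\<^sup>\<star> = - x\<^sup>\<star>"
  by (metis add_eq_0_iff star_add star_zero)

lemma star_diff: "(x - y ::'a::unital_cstar_algebra)\<^sup>\<star> = x\<^sup>\<star> - y\<^sup>\<star>"
  by (metis diff_conv_add_uminus star_add star_minus)

lemma star_scaleR: "(r *\<^sub>R x ::'a::unital_cstar_algebra)\<^sup>\<star> = r *\<^sub>R x\<^sup>\<star>"
  by (simp add: scaleR_scaleC star_scaleC)

lemma star_sum: "(\<Sum>i\<in>I. f i ::'a::unital_cstar_algebra)\<^sup>\<star> = (\<Sum>i\<in>I. (f i)\<^sup>\<star>)"
  by (induction I rule: infinite_finite_induct) (auto simp: star_zero star_add)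

lemma star_power: "(x ^ n ::'a::unital_cstar_algebra)\<^sup>\<star> = (x\<^sup>\<star>) ^ n"
  by (induction n) (auto simp: star_mult power_commutes)

lemma norm_star [simp]: "norm ((x::'a::unital_cstar_algebra)\<^sup>\<star>) = norm x"
proof -
  have le: "norm y \<le> norm (y\<^sup>\<star>)" for y :: 'a
  proof (cases "y = 0")
    case False
    have "(norm y)\<^sup>2 \<le> norm (y\<^sup>\<star>) * norm y"
      using norm_mult_ineq[of "y\<^sup>\<star>" y] by (simp add: norm_star_mult_self)
    then show ?thesis using False by (simp add: power2_eq_square)
  qed simp
  show ?thesis using le[of x] le[of "x\<^sup>\<star>"] by (simp add: star_star)
qed

lemma star_mult_self_eq_0: "(x::'a::unital_cstar_algebra)\<^sup>\<star> * x = 0 \<longleftrightarrow> x = 0"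
  using norm_star_mult_self[of x] by auto

lemma norm_selfadjoint_square: "(h::'a::unital_cstar_algebra)\<^sup>\<star> = h \<Longrightarrow> norm (h * h) = (norm h)\<^sup>2"
  using norm_star_mult_self[of h] by simp

lemma scaleC_one: "1 *\<^sub>C (x::'a::unital_cstar_algebra) = x"
  using scaleR_scaleC[of 1 x] by simp

lemma scaleC_i_i: "\<i> *\<^sub>C \<i> *\<^sub>C (x::'a::unital_cstar_algebra) = - x"
  using scaleR_scaleC[of "-1" x] by (simp add: scaleC_scaleC)

lemma scaleC_uminus_left: "(- c) *\<^sub>C (x::'a::unital_cstar_algebra) = - (c *\<^sub>C x)"
  using scaleR_scaleC[of "-1" "c *\<^sub>C x"] by (simp add: scaleC_scaleC)

lemma scaleC_uminus_right: "c *\<^sub>C (- x ::'a::unital_cstar_algebra) = - (c *\<^sub>C x)"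
  by (metis add_eq_0_iff scaleC_add_right scaleC_zero_right)

lemma scaleC_diff_right: "c *\<^sub>C (x - y ::'a::unital_cstar_algebra) = c *\<^sub>C x - c *\<^sub>C y"
  by (metis diff_conv_add_uminus scaleC_add_right scaleC_uminus_right)

lemma tendsto_star: "(f \<longlongrightarrow> (x::'a::unital_cstar_algebra)) F \<Longrightarrow> ((\<lambda>n. (f n)\<^sup>\<star>) \<longlongrightarrow> x\<^sup>\<star>) F"
  by (rule bounded_linear.tendsto[of star])
    (auto intro!: bounded_linear_intro[of _ 1] simp: star_add star_scaleR)

lemma fps_value_selfadjoint:
  assumes f: "summable (\<lambda>j. \<bar>fps_nth f j\<bar>)" and x: "norm x \<le> 1" and sa: "(x::'a::unital_cstar_algebra)\<^sup>\<star> = x"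
  shows "(fps_value f x)\<^sup>\<star> = fps_value f x"
proof -
  have s: "summable (\<lambda>j. fps_nth f j *\<^sub>R x ^ j)"
    by (rule summable_norm_cancel) (rule summable_norm_fps_value[OF f x])
  have "(\<lambda>n. (\<Sum>j<n. fps_nth f j *\<^sub>R x ^ j)\<^sup>\<star>) \<longlonglongrightarrow> (fps_value f x)\<^sup>\<star>"
    unfolding fps_value_def using s by (intro tendsto_star summable_LIMSEQ)
  moreover have "(\<lambda>n. (\<Sum>j<n. fps_nth f j *\<^sub>R x ^ j)\<^sup>\<star>) \<longlonglongrightarrow> fps_value f x"
    unfolding fps_value_def star_sum star_scaleR star_power sa using s by (intro summable_LIMSEQ)
  ultimately show ?thesis by (rule LIMSEQ_unique)
qed

text \<open>This norm condition characterizes positivity without reference to the spectrum.\<close>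

definition nonneg_elem :: "'a::unital_cstar_algebra \<Rightarrow> bool" where
  "nonneg_elem a \<longleftrightarrow> a\<^sup>\<star> = a \<and> (\<exists>t\<ge>0. norm (t *\<^sub>R 1 - a) \<le> t)"

lemma nonneg_elem_selfadjoint: "nonneg_elem a \<Longrightarrow> a\<^sup>\<star> = a"
  by (simp add: nonneg_elem_def)

lemma nonneg_elem_zero: "nonneg_elem 0"
  by (auto simp: nonneg_elem_def star_zero intro!: exI[of _ 0])

text \<open>The freedom of t in the definition reduces this to the triangle inequality.\<close>

lemma nonneg_elem_add:
  assumes "nonneg_elem a" "nonneg_elem b"
  shows "nonneg_elem (a + b)"
proof -
  obtain s t where st: "0 \<le> s" "norm (s *\<^sub>R 1 - a) \<le> s" "0 \<le> t" "norm (t *\<^sub>R 1 - b) \<le> t"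
    using assms by (auto simp: nonneg_elem_def)
  have "norm ((s + t) *\<^sub>R 1 - (a + b)) \<le> norm (s *\<^sub>R 1 - a) + norm (t *\<^sub>R 1 - b)"
    by (rule order_trans[OF eq_refl norm_triangle_ineq]) (simp add: algebra_simps)
  then show ?thesis
    using assms st by (auto simp: nonneg_elem_def star_add intro!: exI[of _ "s + t"])
qed

lemma nonneg_elem_scaleR:
  assumes "nonneg_elem a" "0 \<le> r"
  shows "nonneg_elem (r *\<^sub>R a)"
proof -
  obtain t where t: "0 \<le> t" "norm (t *\<^sub>R 1 - a) \<le> t"
    using assms by (auto simp: nonneg_elem_def)
  have "norm ((r * t) *\<^sub>R 1 - r *\<^sub>R a) = r * norm (t *\<^sub>R 1 - a)"
    using assms(2) by (simp add: scaleR_scaleR[symmetric] scaleR_diff_right[symmetric] del: scaleR_scaleR)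
  then show ?thesis
    using assms t by (auto simp: nonneg_elem_def star_scaleR mult_left_mono intro!: exI[of _ "r * t"])
qed

lemma nonneg_elem_sum: "(\<And>i. i \<in> I \<Longrightarrow> nonneg_elem (f i)) \<Longrightarrow> nonneg_elem (\<Sum>i\<in>I. f i)"
  by (induction I rule: infinite_finite_induct) (auto simp: nonneg_elem_zero nonneg_elem_add)

lemma nonneg_elem_norm_minus: "a\<^sup>\<star> = a \<Longrightarrow> nonneg_elem (norm a *\<^sub>R 1 - a)"
  by (auto simp: nonneg_elem_def star_diff star_scaleR intro!: exI[of _ "norm a"])

text \<open>The commutation clause takes the place of functional calculus: it makes roots of
  commuting elements commute and later puts roots of matrices into a bicommutant.\<close>

lemma nonneg_elem_root:
  assumes a: "nonneg_elem a" and k: "1 \<le> k"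
  obtains h where "nonneg_elem h" "h ^ k = a" "\<And>y. y * a = a * y \<Longrightarrow> y * h = h * y"
proof -
  obtain t where t: "0 \<le> t" "norm (t *\<^sub>R 1 - a) \<le> t" and sa: "a\<^sup>\<star> = a"
    using a by (auto simp: nonneg_elem_def)
  show thesis
  proof (cases "t = 0")
    case True
    then show ?thesis using t k by (intro that[of 0]) (auto simp: nonneg_elem_zero power_0_left)
  next
    case False
    \<comment> \<open>So a = t (1 + x) with norm x at most 1: the binomial series applies to x, and
      \<open>root k t\<close> restores the scale.\<close>
    define x where "x = inverse t *\<^sub>R a - 1"
    have "norm x = norm (inverse t *\<^sub>R (t *\<^sub>R 1 - a))"
      using False by (simp add: x_def algebra_simps norm_minus_commute)
    also have "\<dots> = norm (t *\<^sub>R 1 - a) / t"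
      using t by (simp only: norm_scaleR) (simp add: divide_inverse mult.commute)
    also have "\<dots> \<le> 1" using t False by (simp add: divide_le_eq)
    finally have x: "norm x \<le> 1" .
    have xsa: "x\<^sup>\<star> = x" by (simp add: x_def star_diff star_scaleR sa)
    define g where "g = fps_value (fps_binomial (1 / real k)) x"
    note g = binomial_series_root[OF k x, folded g_def]
    have gsa: "g\<^sup>\<star> = g"
      unfolding g_def using summable_gbinomial_inverse_nat[OF k]
      by (intro fps_value_selfadjoint x xsa) simp
    define r where "r = root k t"
    have r: "0 \<le> r" "r ^ k = t" using t k by (auto simp: r_def)
    show ?thesis
    proof (rule that[of "r *\<^sub>R g"])
      have "nonneg_elem g" using g(2) gsa by (auto simp: nonneg_elem_def intro!: exI[of _ 1])
      then show "nonneg_elem (r *\<^sub>R g)" using r by (rule_tac nonneg_elem_scaleR)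
      show "(r *\<^sub>R g) ^ k = a"
        using g(1) r False by (simp add: scaleR_power x_def)
      fix y assume "y * a = a * y"
      then have "y * x = x * y" by (simp add: x_def algebra_simps)
      then show "y * r *\<^sub>R g = r *\<^sub>R g * y" using g(3) by simp
    qed
  qed
qed

lemma nonneg_elem_sqrt:
  assumes a: "nonneg_elem a"
  obtains h where "nonneg_elem h" "h\<^sup>\<star> = h" "h * h = a" "\<And>y. y * a = a * y \<Longrightarrow> y * h = h * y"
proof -
  obtain h where h: "nonneg_elem h" "h ^ 2 = a" and c: "\<And>y. y * a = a * y \<Longrightarrow> y * h = h * y"
    by (rule nonneg_elem_root[OF a, of 2]) auto
  show thesis
    by (rule that[OF h(1) nonneg_elem_selfadjoint[OF h(1)] _ c])
      (use h(2) in \<open>simp_all add: power2_eq_square\<close>)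
qed

text \<open>With \<open>u = h + i k\<close> one has \<open>u\<^sup>\<star>u = h\<^sup>2 + k\<^sup>2\<close> and \<open>2 h = u + u\<^sup>\<star>\<close>.\<close>

lemma norm_square_le_norm_add_squares:
  assumes h: "(h::'a::unital_cstar_algebra)\<^sup>\<star> = h" and k: "k\<^sup>\<star> = k" and c: "h * k = k * h"
  shows "(norm h)\<^sup>2 \<le> norm (h * h + k * k)"
proof -
  define u where "u = h + \<i> *\<^sub>C k"
  have us: "u\<^sup>\<star> = h - \<i> *\<^sub>C k"
    by (simp add: u_def star_add star_scaleC h k scaleC_uminus_left)
  have "u\<^sup>\<star> * u = h * h + k * k"
    unfolding us
    by (simp add: u_def algebra_simps mult_scaleC_left mult_scaleC_right c scaleC_i_i scaleC_add_right scaleC_diff_right)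
  then have nu: "(norm u)\<^sup>2 = norm (h * h + k * k)"
    using norm_star_mult_self[of u] by simp
  have "norm (2 *\<^sub>R h) = norm (u + u\<^sup>\<star>)"
    unfolding us by (simp add: u_def scaleR_2)
  also have "\<dots> \<le> 2 * norm u" using norm_triangle_ineq[of u "u\<^sup>\<star>"] by simp
  finally have "norm h \<le> norm u" by simp
  then show ?thesis using nu by (metis norm_ge_zero power_mono)
qed

text \<open>Let k be the square root of ||h||^2 - h^2, which commutes with h. Then h^2 + k^2 is the
  scalar ||h||^2, and \<open>norm_square_le_norm_add_squares\<close> bounds the norm of k^2.\<close>

lemma norm_minus_square_le:
  assumes h: "(h::'a::unital_cstar_algebra)\<^sup>\<star> = h"
  shows "norm ((norm h)\<^sup>2 *\<^sub>R 1 - h * h) \<le> (norm h)\<^sup>2"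
proof -
  have "nonneg_elem ((norm h)\<^sup>2 *\<^sub>R 1 - h * h)"
    using nonneg_elem_norm_minus[of "h * h"] norm_selfadjoint_square[OF h] by (simp add: star_mult h)
  then obtain k where k: "k\<^sup>\<star> = k" "k * k = (norm h)\<^sup>2 *\<^sub>R 1 - h * h"
    and kc: "\<And>y. y * ((norm h)\<^sup>2 *\<^sub>R 1 - h * h) = ((norm h)\<^sup>2 *\<^sub>R 1 - h * h) * y \<Longrightarrow> y * k = k * y"
    by (rule nonneg_elem_sqrt) blast
  have "h * k = k * h" by (rule kc) (simp add: algebra_simps)
  then have "(norm k)\<^sup>2 \<le> norm (k * k + h * h)"
    by (intro norm_square_le_norm_add_squares k h) simp
  then show ?thesis
    using norm_selfadjoint_square[OF k(1)] by (simp add: k)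
qed

lemma nonneg_elem_square: "(h::'a::unital_cstar_algebra)\<^sup>\<star> = h \<Longrightarrow> nonneg_elem (h * h)"
  using norm_minus_square_le[of h] by (auto simp: nonneg_elem_def star_mult intro!: exI[of _ "(norm h)\<^sup>2"])

text \<open>With commuting square roots h and k, the product is the square of the selfadjoint
  element h k.\<close>

lemma nonneg_elem_mult:
  assumes a: "nonneg_elem a" and b: "nonneg_elem b" and c: "a * b = b * a"
  shows "nonneg_elem (a * b)"
proof -
  obtain h where h: "h\<^sup>\<star> = h" "h * h = a" "\<And>y. y * a = a * y \<Longrightarrow> y * h = h * y"
    by (rule nonneg_elem_sqrt[OF a]) blast
  obtain k where k: "k\<^sup>\<star> = k" "k * k = b" "\<And>y. y * b = b * y \<Longrightarrow> y * k = k * y"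
    by (rule nonneg_elem_sqrt[OF b]) blast
  have hk: "h * k = k * h"
    by (rule k(3)) (rule h(3)[symmetric], simp add: c)
  have "a * b = (h * k) * (h * k)"
    by (simp add: h(2)[symmetric] k(2)[symmetric] mult.assoc) (metis hk mult.assoc)
  then show ?thesis using nonneg_elem_square[of "h * k"] by (simp add: star_mult h(1) k(1) hk)
qed

lemma nonneg_elem_one: "nonneg_elem 1"
  using nonneg_elem_square[of 1] by simp

lemma nonneg_elem_power: "nonneg_elem a \<Longrightarrow> nonneg_elem (a ^ n)"
  by (induction n) (auto simp: nonneg_elem_one power_commutes intro!: nonneg_elem_mult)

text \<open>Writing a = h^2 and s 1 - a = k^2 with commuting h and k gives ||a|| = ||h||^2 <= ||h^2
  + k^2|| = s.\<close>

lemma nonneg_elem_norm_le: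
  assumes a: "nonneg_elem a" and s: "nonneg_elem (s *\<^sub>R 1 - a)" "0 \<le> s"
  shows "norm a \<le> s"
proof -
  obtain h where h: "h\<^sup>\<star> = h" "h * h = a" "\<And>y. y * a = a * y \<Longrightarrow> y * h = h * y"
    by (rule nonneg_elem_sqrt[OF a]) blast
  obtain k where k: "k\<^sup>\<star> = k" "k * k = s *\<^sub>R 1 - a"
    "\<And>y. y * (s *\<^sub>R 1 - a) = (s *\<^sub>R 1 - a) * y \<Longrightarrow> y * k = k * y"
    by (rule nonneg_elem_sqrt[OF s(1)]) blast
  have "h * k = k * h" by (rule k(3)) (simp add: h(2)[symmetric] algebra_simps)
  then have "(norm h)\<^sup>2 \<le> norm (h * h + k * k)"
    by (rule norm_square_le_norm_add_squares[OF h(1) k(1)])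
  then show ?thesis using norm_selfadjoint_square[OF h(1)] s(2) by (simp add: h(1,2) k(1,2))
qed

lemma nonneg_elem_norm_mono:
  assumes a: "nonneg_elem a" and b: "nonneg_elem (b - a)"
  shows "norm a \<le> norm b"
proof (rule nonneg_elem_norm_le[OF a])
  have "nonneg_elem (norm b *\<^sub>R 1 - b)"
    using nonneg_elem_add[OF a b] by (intro nonneg_elem_norm_minus) (simp add: nonneg_elem_def)
  from nonneg_elem_add[OF this b] show "nonneg_elem (norm b *\<^sub>R 1 - a)" by simp
qed simp

lemma nonneg_elem_antisym: "nonneg_elem a \<Longrightarrow> nonneg_elem (- a) \<Longrightarrow> a = 0"
  using nonneg_elem_norm_mono[of a 0] by simp

text \<open>The exponent goes down one at a time. If m = j + 1 with j >= 1, then also b^(2 j) d = 0,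
  and the C*-identity for b^j d gives b^j d = 0.\<close>

lemma selfadjoint_power_mult_eq_0:
  assumes b: "(b::'a::unital_cstar_algebra)\<^sup>\<star> = b"
  shows "1 \<le> m \<Longrightarrow> b ^ m * d = 0 \<Longrightarrow> b * d = 0"
proof (induction m rule: less_induct)
  case (less m)
  show ?case
  proof (cases "m = 1")
    case False
    then obtain j where m: "m = Suc j" "1 \<le> j" using less.prems(1) by (cases m) auto
    have "b ^ (j + j) * d = b ^ (j - 1) * (b ^ m * d)"
      using m by (simp add: mult.assoc[symmetric] power_add[symmetric] flip: power_Suc)
    then have "(b ^ j * d)\<^sup>\<star> * (b ^ j * d) = 0"
      using less.prems(2) by (simp add: star_mult star_power b mult.assoc power_add)
    then show ?thesis using less.IH[of j] m by (simp add: star_mult_self_eq_0)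
  qed (use less.prems in simp)
qed

text \<open>If \<open>b\<close>, \<open>c\<close> commute and \<open>b\<^sup>k = c\<^sup>k\<close>, then \<open>d = b - c\<close> satisfies
  \<open>\<Sum>\<^sub>i d b\<^sup>i c\<^sup>k\<^sup>-\<^sup>1\<^sup>-\<^sup>i d = 0\<close>, a sum of positive elements.\<close>

lemma nonneg_elem_root_unique_commute:
  assumes b: "nonneg_elem b" and c: "nonneg_elem c" and bc: "b * c = c * b"
    and k: "1 \<le> k" and eq: "b ^ k = c ^ k"
  shows "b = c"
proof (cases "k = 1")
  case False
  then obtain m where m: "k = Suc m" "1 \<le> m" using k by (cases k) auto
  define d where "d = b - c"
  have sa: "b\<^sup>\<star> = b" "c\<^sup>\<star> = c" "d\<^sup>\<star> = d"
    using b c by (auto simp: d_def star_diff nonneg_elem_def)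
  have cm: "d * b ^ i = b ^ i * d" "d * c ^ i = c ^ i * d" "b ^ i * c ^ j = c ^ j * b ^ i" for i j
  proof -
    have 1: "b * c ^ j = c ^ j * b" for j by (induction j) (auto simp: bc mult.assoc, metis bc mult.assoc)
    have 2: "c * b ^ j = b ^ j * c" for j by (induction j) (auto simp: bc mult.assoc, metis bc mult.assoc)
    show "d * b ^ i = b ^ i * d" "d * c ^ i = c ^ i * d"
      by (simp_all add: d_def algebra_simps 1 2 power_commutes)
    show "b ^ i * c ^ j = c ^ j * b ^ i"
      by (induction i) (auto simp: mult.assoc, metis 1 mult.assoc)
  qed
  define S where "S = (\<Sum>i<Suc m. b ^ i * c ^ (m - i))"
  have "d * S = b ^ k - c ^ k"
  proof -
    have "d * (\<Sum>i<Suc n. b ^ i * c ^ (n - i)) = b ^ Suc n - c ^ Suc n" for n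
    proof (induction n)
      case (Suc n)
      have "(\<Sum>i<Suc (Suc n). b ^ i * c ^ (Suc n - i))
          = (\<Sum>i<Suc n. b ^ i * c ^ (n - i)) * c + b ^ Suc n"
      proof -
        have "(\<Sum>i<Suc n. b ^ i * c ^ (Suc n - i)) = (\<Sum>i<Suc n. b ^ i * c ^ (n - i)) * c"
          unfolding sum_distrib_right
          by (intro sum.cong refl) (simp add: Suc_diff_le mult.assoc power_commutes)
        then show ?thesis by (subst sum.lessThan_Suc) simp
      qed
      then have "d * (\<Sum>i<Suc (Suc n). b ^ i * c ^ (Suc n - i)) = (b ^ Suc n - c ^ Suc n) * c + d * b ^ Suc n"
        using Suc.IH by (simp add: distrib_left mult.assoc[symmetric])
      also have "\<dots> = b ^ Suc (Suc n) - c ^ Suc (Suc n)"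
      proof -
        have "d * b ^ Suc n = b ^ Suc (Suc n) - b ^ Suc n * c"
          by (simp only: cm) (simp add: d_def right_diff_distrib power_commutes mult.assoc)
        then show ?thesis by (simp add: left_diff_distrib power_commutes mult.assoc)
      qed
      finally show ?case .
    qed (simp add: d_def)
    then show ?thesis by (simp add: S_def m)
  qed
  then have dS: "d * S = 0" by (simp add: eq)
  have pos: "nonneg_elem (d * (b ^ i * c ^ j) * d)" for i j
  proof -
    have "d * (b ^ i * c ^ j) * d = (d * d) * (b ^ i * c ^ j)"
      by (metis cm mult.assoc)
    moreover have "nonneg_elem ((d * d) * (b ^ i * c ^ j))"
      by (rule nonneg_elem_mult[OF nonneg_elem_square[OF sa(3)]
            nonneg_elem_mult[OF nonneg_elem_power[OF b] nonneg_elem_power[OF c] cm(3)]])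
        (metis cm mult.assoc)
    ultimately show ?thesis by simp
  qed
  have sum0: "(\<Sum>i<Suc m. d * (b ^ i * c ^ (m - i)) * d) = 0"
    using dS by (simp add: S_def sum_distrib_left[symmetric] sum_distrib_right[symmetric] del: sum.lessThan_Suc)
  have each: "d * (b ^ i * c ^ (m - i)) * d = 0" if i: "i < Suc m" for i
  proof (rule nonneg_elem_antisym[OF pos])
    have "- (d * (b ^ i * c ^ (m - i)) * d) = (\<Sum>i\<in>{..<Suc m} - {i}. d * (b ^ i * c ^ (m - i)) * d)"
      using sum0 sum.remove[of "{..<Suc m}" i "\<lambda>i. d * (b ^ i * c ^ (m - i)) * d"] i
      by (simp add: minus_unique)
    then show "nonneg_elem (- (d * (b ^ i * c ^ (m - i)) * d))"
      by (simp only:) (intro nonneg_elem_sum pos)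
  qed
  \<comment> \<open>The extreme terms i = m and i = 0 give b^m d^2 = 0 and c^m d^2 = 0; lowering the
    exponents to 1 and subtracting yields d^3 = 0.\<close>
  have "b ^ m * (d * d) = 0" using each[of m] cm by (metis diff_self_eq_0 lessI mult.assoc mult.right_neutral power_0)
  moreover have "c ^ m * (d * d) = 0" using each[of 0] cm by (metis diff_zero zero_less_Suc mult.assoc mult_1_left power_0)
  ultimately have "b * (d * d) = 0" "c * (d * d) = 0"
    using selfadjoint_power_mult_eq_0 sa m by blast+
  then have "d ^ 3 * 1 = 0"
    by (simp add: eval_nat_numeral d_def left_diff_distrib mult.assoc)
  then have "d * 1 = 0"
    using selfadjoint_power_mult_eq_0[OF sa(3), of 3 1] by simp
  then show ?thesis by (simp add: d_def)
qed (use eq in simp)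

text \<open>The series root h of the common power commutes with everything that commutes with that
  power, in particular with b and with c. Hence both equal h, although b and c are not known to
  commute with each other.\<close>

lemma nonneg_elem_root_unique:
  assumes b: "nonneg_elem b" and c: "nonneg_elem c" and k: "1 \<le> k" and eq: "b ^ k = c ^ k"
  shows "b = c"
proof -
  obtain h where h: "nonneg_elem h" "h ^ k = c ^ k" "\<And>y. y * c ^ k = c ^ k * y \<Longrightarrow> y * h = h * y"
    by (rule nonneg_elem_root[OF nonneg_elem_power[OF c, of k] k]) blast
  have "c = h"
    by (rule nonneg_elem_root_unique_commute[OF c h(1) _ k])
      (use h in \<open>auto simp: power_commutes\<close>)
  moreover have "b = h"
    by (rule nonneg_elem_root_unique_commute[OF b h(1) _ k])
      (use h(2) h(3)[of b] in \<open>auto simp: power_commutes eq[symmetric]\<close>)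
  ultimately show ?thesis by simp
qed

text \<open>Fukamiya's theorem. If \<open>y\<^sup>\<star>y = - p\<close> with \<open>p = c\<^sup>2 \<ge> 0\<close>, then \<open>z = y c\<close> satisfies
  \<open>z\<^sup>\<star>z = - p\<^sup>2\<close> and \<open>zz\<^sup>\<star> = - (yy\<^sup>\<star>)\<^sup>2\<close>, whereas \<open>z\<^sup>\<star>z + zz\<^sup>\<star>\<close> is a sum of squares.\<close>

lemma star_mult_self_negative:
  assumes p: "nonneg_elem p" and y: "y\<^sup>\<star> * y = - p"
  shows "p = 0"
proof -
  obtain c where c: "c\<^sup>\<star> = c" "c * c = p" by (rule nonneg_elem_sqrt[OF p]) blast
  define q where "q = y * y\<^sup>\<star>"
  define z where "z = y * c"
  have psa: "p\<^sup>\<star> = p" using p by (simp add: nonneg_elem_def)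
  have qsa: "q\<^sup>\<star> = q" by (simp add: q_def star_mult star_star)
  have "z\<^sup>\<star> * z = c * (y\<^sup>\<star> * y) * c"
    by (simp add: z_def star_mult c mult.assoc)
  then have zz: "z\<^sup>\<star> * z = - (p * p)"
    by (simp add: y c(2)[symmetric] mult.assoc)
  have "z * z\<^sup>\<star> = y * p * y\<^sup>\<star>"
    by (simp add: z_def star_mult c(1) c(2)[symmetric] mult.assoc)
  also have "p = - (y\<^sup>\<star> * y)" by (simp add: y)
  finally have zz': "z * z\<^sup>\<star> = - (q * q)"
    by (simp add: q_def mult.assoc)
  \<comment> \<open>These are 2 Re z and - 2 Im z, so the sum of their squares is twice z^* z + z
    z^*.\<close>
  define h where "h = z + z\<^sup>\<star>"
  define k where "k = \<i> *\<^sub>C (z - z\<^sup>\<star>)"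
  have "h\<^sup>\<star> = h" by (simp add: h_def star_add star_star add.commute)
  moreover have "k\<^sup>\<star> = k"
    by (simp add: k_def star_scaleC star_diff star_star scaleC_uminus_left flip: scaleC_uminus_right)
  ultimately have "nonneg_elem (h * h + k * k)" by (intro nonneg_elem_add nonneg_elem_square)
  moreover have "h * h + k * k = 2 *\<^sub>R (z\<^sup>\<star> * z + z * z\<^sup>\<star>)"
    by (simp add: h_def k_def mult_scaleC_left mult_scaleC_right scaleC_i_i algebra_simps
        scaleC_add_right scaleC_diff_right scaleR_2)
  ultimately have "nonneg_elem ((1/2) *\<^sub>R (2 *\<^sub>R (z\<^sup>\<star> * z + z * z\<^sup>\<star>)))"
    by (intro nonneg_elem_scaleR[of _ "1/2"]) auto
  then have n: "nonneg_elem (- (p * p) - q * q)" by (simp add: zz zz')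
  have "p * p = 0"
  proof (rule nonneg_elem_antisym)
    show "nonneg_elem (p * p)" by (rule nonneg_elem_square[OF psa])
    show "nonneg_elem (- (p * p))"
      using nonneg_elem_add[OF n nonneg_elem_square[OF qsa]] by simp
  qed
  then show ?thesis using star_mult_self_eq_0[of p] by (simp add: psa)
qed

text \<open>Let a = x^* x and b = |a|. Then g = b - a is twice the negative part of a, and y = x g
  satisfies y^* y = g a g = - b g^2, the negative of a positive element. By
  \<open>star_mult_self_negative\<close> it vanishes, which together with g^2 = 2 b g forces g =
  0.\<close>

lemma nonneg_elem_star_mult_self: "nonneg_elem (x\<^sup>\<star> * x)"
proof -
  define a where "a = x\<^sup>\<star> * x"
  have sa: "a\<^sup>\<star> = a" by (simp add: a_def star_mult star_star)
  obtain b where b: "nonneg_elem b" "b\<^sup>\<star> = b" "b * b = a * a"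
    and bc: "\<And>y. y * (a * a) = (a * a) * y \<Longrightarrow> y * b = b * y"
    by (rule nonneg_elem_sqrt[OF nonneg_elem_square[OF sa]]) blast
  have ab: "a * b = b * a" by (rule bc) (simp add: mult.assoc)
  define g where "g = b - a"
  have gsa: "g\<^sup>\<star> = g" by (simp add: g_def star_diff b sa)
  have gc: "g * b = b * g" by (simp add: g_def algebra_simps ab)
  have gg: "g * g = 2 *\<^sub>R (b * g)"
    by (simp add: g_def algebra_simps b ab scaleR_2)
  have ag: "a * g = - (b * g)" by (simp add: g_def algebra_simps b ab)
  have "(x * g)\<^sup>\<star> * (x * g) = g * (a * g)"
    by (simp add: star_mult gsa a_def mult.assoc)
  also have "\<dots> = - (b * (g * g))" using gc by (simp add: ag mult.assoc[symmetric])
  finally have "(x * g)\<^sup>\<star> * (x * g) = - (b * (g * g))" .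
  moreover have "nonneg_elem (b * (g * g))"
    by (rule nonneg_elem_mult[OF b(1) nonneg_elem_square[OF gsa]]) (metis gc mult.assoc)
  ultimately have "b * (g * g) = 0" by (intro star_mult_self_negative)
  then have "b ^ 2 * g = 0" by (simp add: gg power2_eq_square mult.assoc)
  then have "b * g = 0" using selfadjoint_power_mult_eq_0[OF b(2), of 2 g] by simp
  then have "g = 0" using gg star_mult_self_eq_0[of g] by (simp add: gsa)
  then show ?thesis using b(1) by (simp add: g_def a_def)
qed

lemma nonneg_elem_iff: "nonneg_elem a \<longleftrightarrow> (\<exists>x. a = x\<^sup>\<star> * x)"
  by (metis nonneg_elem_sqrt nonneg_elem_star_mult_self)

lemma nonneg_elem_conjugate: "nonneg_elem a \<Longrightarrow> nonneg_elem (x\<^sup>\<star> * a * x)"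
  unfolding nonneg_elem_iff by (metis mult.assoc star_mult)

lemma nonneg_elem_of_norm_le:
  assumes "nonneg_elem a" "0 \<le> s" "norm a \<le> s"
  shows "nonneg_elem (s *\<^sub>R 1 - a)"
proof -
  have "nonneg_elem ((norm a *\<^sub>R 1 - a) + (s - norm a) *\<^sub>R 1)"
    using assms by (intro nonneg_elem_add nonneg_elem_norm_minus nonneg_elem_scaleR nonneg_elem_one)
      (auto simp: nonneg_elem_def)
  then show ?thesis by (simp add: algebra_simps)
qed

text \<open>For n >= 1 the C*-identity gives ||b^n||^2 = ||b^(2 n)|| <= ||b||^(n - 1) ||b^(n + 1)||,
  which carries the equality from n to n + 1. Later this shows that roots of contractions are
  contractions.\<close>

lemma norm_selfadjoint_power:
  assumes b: "(b::'a::unital_cstar_algebra)\<^sup>\<star> = b"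
  shows "norm (b ^ n) = norm b ^ n"
proof (induction n)
  case (Suc n)
  show ?case
  proof (cases "n = 0 \<or> b = 0")
    case False
    then obtain m where m: "n = Suc m" by (cases n) auto
    have "norm b ^ m * norm b ^ Suc n = (norm (b ^ n))\<^sup>2"
      by (simp add: Suc.IH) (simp add: m power2_eq_square ac_simps)
    also have "\<dots> = norm (b ^ m * b ^ Suc n)"
      using norm_selfadjoint_square[of "b ^ n"] by (simp add: star_power b m flip: power_Suc power_add)
    also have "\<dots> \<le> norm (b ^ m) * norm (b ^ Suc n)" by (rule norm_mult_ineq)
    also have "\<dots> \<le> norm b ^ m * norm (b ^ Suc n)"
      by (intro mult_right_mono norm_power_ineq) simp
    finally have "norm b ^ Suc n \<le> norm (b ^ Suc n)" using False by simp
    then show ?thesis using norm_power_ineq[of b "Suc n"] by simp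
  qed auto
qed simp

section \<open>Matrix algebra\<close>

lemmas minf_entry_simps [simp] =
  zero_minf.rep_eq plus_minf.rep_eq uminus_minf.rep_eq minus_minf.rep_eq scaleC_minf.rep_eq
  star_minf.rep_eq

lemma entry_sum [simp]: "entry (\<Sum>i\<in>I. f i :: 'a::unital_cstar_algebra minf) k l = (\<Sum>i\<in>I. entry (f i) k l)"
  by (induction I rule: infinite_finite_induct) auto

section \<open>The finite matrix algebras M_N(A) inside M_infinity(A)\<close>

lemma MnD: "x \<in> Mn N \<Longrightarrow> N \<le> i \<or> N \<le> j \<Longrightarrow> entry x i j = 0"
  by (auto simp: Mn_def)

lemma Mn_mono: "x \<in> Mn M \<Longrightarrow> M \<le> N \<Longrightarrow> x \<in> Mn N"
  by (auto simp: Mn_def)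

lemma in_Mn_obtain:
  obtains N where "x \<in> Mn N" "1 \<le> N"
proof -
  obtain N where "\<And>i j. N \<le> i \<or> N \<le> j \<Longrightarrow> entry x i j = 0" by (rule entry_bound) blast
  then have "x \<in> Mn (max 1 N)" by (auto simp: Mn_def)
  then show thesis using that by auto
qed

lemma in_Mn_obtain2:
  obtains N where "x \<in> Mn N" "y \<in> Mn N" "1 \<le> N"
proof -
  obtain M N where "x \<in> Mn M" "1 \<le> M" "y \<in> Mn N"
    using in_Mn_obtain[of x] in_Mn_obtain[of y] by metis
  then show thesis
    by (intro that[of "max M N"]) (auto intro: Mn_mono)
qed

lemma entry_times_left: "x \<in> Mn N \<Longrightarrow> entry (x * y) i j = (\<Sum>k<N. entry x i k * entry y k j)"
  by (rule entry_times) (rule MnD)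

lemma entry_times_right:
  assumes "y \<in> Mn N"
  shows "entry (x * y) i j = (\<Sum>k<N. entry x i k * entry y k j)"
proof -
  obtain M where M: "x \<in> Mn M" by (rule in_Mn_obtain)
  then have "entry (x * y) i j = (\<Sum>k<max M N. entry x i k * entry y k j)"
    by (intro entry_times_left) (auto intro: Mn_mono)
  also have "\<dots> = (\<Sum>k<N. entry x i k * entry y k j)"
    using MnD[OF assms] by (intro sum.mono_neutral_right) auto
  finally show ?thesis .
qed

lemma Mn_zero: "0 \<in> Mn N" by (simp add: Mn_def)
lemma Mn_add: "x \<in> Mn N \<Longrightarrow> y \<in> Mn N \<Longrightarrow> x + y \<in> Mn N" by (simp add: Mn_def)
lemma Mn_diff: "x \<in> Mn N \<Longrightarrow> y \<in> Mn N \<Longrightarrow> x - y \<in> Mn N" by (simp add: Mn_def)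
lemma Mn_uminus: "x \<in> Mn N \<Longrightarrow> - x \<in> Mn N" by (simp add: Mn_def)
lemma Mn_scaleC: "x \<in> Mn N \<Longrightarrow> c *\<^sub>C x \<in> Mn N" by (simp add: Mn_def scaleC_zero_right)
lemma Mn_star: "x \<in> Mn N \<Longrightarrow> x\<^sup>\<star> \<in> Mn N" by (simp add: Mn_def star_zero)
lemma Mn_mone: "mone N \<in> Mn N" by (auto simp: Mn_def mone.rep_eq)
lemma Mn_mult: "x \<in> Mn N \<Longrightarrow> y \<in> Mn N \<Longrightarrow> x * y \<in> Mn N"
  unfolding Mn_def[of N] mem_Collect_eq
  by (subst entry_times_left[of x N]) (auto simp: Mn_def intro!: sum.neutral)
lemma Mn_sum: "(\<And>i. i \<in> I \<Longrightarrow> f i \<in> Mn N) \<Longrightarrow> (\<Sum>i\<in>I. f i) \<in> Mn N"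
  by (simp add: Mn_def)

lemma mone_mult_left: "x \<in> Mn N \<Longrightarrow> mone N * x = x"
proof (rule minf_eqI)
  fix i j assume x: "x \<in> Mn N"
  have "entry (mone N * x) i j = (\<Sum>k<N. if i = k then entry x k j else 0)"
    unfolding entry_times_left[OF Mn_mone] by (intro sum.cong refl) (simp add: mone.rep_eq)
  then show "entry (mone N * x) i j = entry x i j"
    using MnD[OF x, of i j] by (simp add: sum.delta')
qed

lemma mone_mult_right: "x \<in> Mn N \<Longrightarrow> x * mone N = x"
proof (rule minf_eqI)
  fix i j assume x: "x \<in> Mn N"
  have "entry (x * mone N) i j = (\<Sum>k<N. if k = j then entry x i k else 0)"
    unfolding entry_times_right[OF Mn_mone] by (intro sum.cong refl) (simp add: mone.rep_eq)
  then show "entry (x * mone N) i j = entry x i j"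
    using MnD[OF x, of i j] by (simp add: sum.delta)
qed

lemma mone_star: "(mone N :: 'a::unital_cstar_algebra minf)\<^sup>\<star> = mone N"
  by (rule minf_eqI) (auto simp: mone.rep_eq star_zero)

section \<open>Adjoints and scalars in M_infinity(A)\<close>

lemma minf_star_star: "(x\<^sup>\<star>)\<^sup>\<star> = (x :: 'a::unital_cstar_algebra minf)"
  by (rule minf_eqI) (simp add: star_star)

lemma minf_star_add: "(x + y)\<^sup>\<star> = x\<^sup>\<star> + (y :: 'a::unital_cstar_algebra minf)\<^sup>\<star>"
  by (rule minf_eqI) (simp add: star_add)

lemma minf_star_diff: "(x - y)\<^sup>\<star> = x\<^sup>\<star> - (y :: 'a::unital_cstar_algebra minf)\<^sup>\<star>"
  by (rule minf_eqI) (simp add: star_diff)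

lemma minf_star_zero: "(0 :: 'a::unital_cstar_algebra minf)\<^sup>\<star> = 0"
  by (rule minf_eqI) (simp add: star_zero)

lemma minf_star_sum: "(\<Sum>i\<in>I. f i :: 'a::unital_cstar_algebra minf)\<^sup>\<star> = (\<Sum>i\<in>I. (f i)\<^sup>\<star>)"
  by (rule minf_eqI) (simp add: star_sum)

lemma minf_star_scaleC: "(c *\<^sub>C x)\<^sup>\<star> = cnj c *\<^sub>C (x :: 'a::unital_cstar_algebra minf)\<^sup>\<star>"
  by (rule minf_eqI) (simp add: star_scaleC)

lemma minf_star_mult: "(x * y)\<^sup>\<star> = y\<^sup>\<star> * (x :: 'a::unital_cstar_algebra minf)\<^sup>\<star>"
proof -
  obtain N where N: "x \<in> Mn N" "y \<in> Mn N" by (rule in_Mn_obtain2)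
  show ?thesis
    by (rule minf_eqI)
      (simp add: entry_times_left[OF N(1)] entry_times_left[OF Mn_star[OF N(2)]] star_sum star_mult)
qed

lemma scaleC_sum_right: "c *\<^sub>C (\<Sum>i\<in>I. f i :: 'a::unital_cstar_algebra) = (\<Sum>i\<in>I. c *\<^sub>C f i)"
  by (induction I rule: infinite_finite_induct) (auto simp: scaleC_zero_right scaleC_add_right)

lemma minf_mult_scaleC_left: "(c *\<^sub>C x) * y = c *\<^sub>C (x * (y :: 'a::unital_cstar_algebra minf))"
proof -
  obtain N where N: "x \<in> Mn N" by (rule in_Mn_obtain)
  show ?thesis
    by (rule minf_eqI)
      (simp add: entry_times_left[OF N] entry_times_left[OF Mn_scaleC[OF N]] scaleC_sum_right mult_scaleC_left)
qed

lemma minf_mult_scaleC_right: "x * (c *\<^sub>C y) = c *\<^sub>C (x * (y :: 'a::unital_cstar_algebra minf))"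
proof -
  obtain N where N: "x \<in> Mn N" by (rule in_Mn_obtain)
  show ?thesis
    by (rule minf_eqI)
      (simp add: entry_times_left[OF N] scaleC_sum_right mult_scaleC_right)
qed

lemma minf_scaleC_add_right: "c *\<^sub>C (x + y) = c *\<^sub>C x + c *\<^sub>C (y :: 'a::unital_cstar_algebra minf)"
  by (rule minf_eqI) (simp add: scaleC_add_right)

lemma minf_scaleC_add_left: "(c + d) *\<^sub>C x = c *\<^sub>C x + d *\<^sub>C (x :: 'a::unital_cstar_algebra minf)"
  by (rule minf_eqI) (simp add: scaleC_add_left)

lemma minf_scaleC_diff_right: "c *\<^sub>C (x - y) = c *\<^sub>C x - c *\<^sub>C (y :: 'a::unital_cstar_algebra minf)"
  by (rule minf_eqI) (simp add: scaleC_diff_right)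

lemma minf_scaleC_scaleC: "c *\<^sub>C d *\<^sub>C x = (c * d) *\<^sub>C (x :: 'a::unital_cstar_algebra minf)"
  by (rule minf_eqI) (simp add: scaleC_scaleC)

lemma minf_scaleC_one: "1 *\<^sub>C x = (x :: 'a::unital_cstar_algebra minf)"
  by (rule minf_eqI) (simp add: scaleC_one)

section \<open>The operator norm\<close>

text \<open>The first column of a matrix is regarded as a vector of the Hilbert module, so that inner
  products become upper left entries of matrix products.\<close>

definition vec_norm :: "'a::unital_cstar_algebra minf \<Rightarrow> real" where
  "vec_norm x = sqrt (norm (entry (x\<^sup>\<star> * x) 0 0))"

lemma entry_star_times: "x \<in> Mn N \<Longrightarrow> entry (x\<^sup>\<star> * y) i j = (\<Sum>k<N. (entry x k i)\<^sup>\<star> * entry y k j)"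
  by (simp add: entry_times_left[OF Mn_star])

lemma vec_norm_nonneg: "0 \<le> vec_norm x"
  by (simp add: vec_norm_def)

lemma vec_norm_power2: "(vec_norm x)\<^sup>2 = norm (entry (x\<^sup>\<star> * x) 0 0)"
  by (simp add: vec_norm_def)

lemma nonneg_elem_inner: "nonneg_elem (entry (x\<^sup>\<star> * x) i i)"
proof -
  obtain N where N: "x \<in> Mn N" by (rule in_Mn_obtain)
  show ?thesis
    by (simp add: entry_star_times[OF N] nonneg_elem_sum nonneg_elem_star_mult_self)
qed

lemma vec_norm_cong:
  assumes "\<And>i. entry x i 0 = entry y i 0"
  shows "vec_norm x = vec_norm y"
proof -
  obtain N where N: "x \<in> Mn N" "y \<in> Mn N" by (rule in_Mn_obtain2)
  show ?thesis by (simp add: vec_norm_def entry_star_times[OF N(1)] entry_star_times[OF N(2)] assms)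
qed

lemma norm_entry_le_vec_norm: "norm (entry x i 0) \<le> vec_norm x"
proof -
  obtain N where N: "x \<in> Mn N" by (rule in_Mn_obtain)
  have "(norm (entry x i 0))\<^sup>2 \<le> (vec_norm x)\<^sup>2"
  proof (cases "i < N")
    case True
    have "(\<Sum>k<N. (entry x k 0)\<^sup>\<star> * entry x k 0) - (entry x i 0)\<^sup>\<star> * entry x i 0
        = (\<Sum>k\<in>{..<N}-{i}. (entry x k 0)\<^sup>\<star> * entry x k 0)"
      using True by (simp add: sum_diff1)
    then have "nonneg_elem (entry (x\<^sup>\<star> * x) 0 0 - (entry x i 0)\<^sup>\<star> * entry x i 0)"
      by (simp add: entry_star_times[OF N] nonneg_elem_sum nonneg_elem_star_mult_self)
    from nonneg_elem_norm_mono[OF nonneg_elem_star_mult_self this] show ?thesis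
      by (simp add: vec_norm_power2 norm_star_mult_self)
  qed (use MnD[OF N] in simp)
  then show ?thesis by (rule power2_le_imp_le) (rule vec_norm_nonneg)
qed

lemma vec_norm_le_sum: 
  assumes "x \<in> Mn N"
  shows "vec_norm x \<le> (\<Sum>i<N. norm (entry x i 0))"
proof (rule power2_le_imp_le)
  have "(vec_norm x)\<^sup>2 \<le> (\<Sum>i<N. (norm (entry x i 0))\<^sup>2)"
    unfolding vec_norm_power2 entry_star_times[OF assms]
    by (rule order_trans[OF norm_sum]) (simp add: norm_star_mult_self)
  also have "\<dots> \<le> (\<Sum>i<N. norm (entry x i 0) * (\<Sum>i<N. norm (entry x i 0)))"
    unfolding power2_eq_square
    by (intro sum_mono mult_left_mono member_le_sum) auto
  finally show "(vec_norm x)\<^sup>2 \<le> (\<Sum>i<N. norm (entry x i 0))\<^sup>2"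
    by (simp add: power2_eq_square sum_distrib_right)
qed (simp add: sum_nonneg)

lemma Mn_corner: "corner c \<in> Mn 1"
  by (auto simp: Mn_def corner.rep_eq)

lemma entry_mult_corner: "entry (x * corner c) i j = (if j = 0 then entry x i 0 * c else 0)"
  by (subst entry_times_right[OF Mn_corner]) (simp add: corner.rep_eq)

lemma entry_corner_mult: "entry (corner c * x) i j = (if i = 0 then c * entry x 0 j else 0)"
  by (subst entry_times_left[OF Mn_corner]) (simp add: corner.rep_eq)

lemma corner_star: "(corner c)\<^sup>\<star> = corner (c\<^sup>\<star>)"
  by (rule minf_eqI) (simp add: corner.rep_eq star_zero)

text \<open>The Cauchy--Schwarz inequality of the Hilbert module: expand
  \<open>\<langle>u, u\<rangle> \<ge> 0\<close> for \<open>u = t y - x \<langle>x, y\<rangle>\<close>, where \<open>t = \<parallel>\<langle>x, x\<rangle>\<parallel>\<close>.\<close>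

lemma inner_Cauchy_Schwarz: "norm (entry (x\<^sup>\<star> * y) 0 0) \<le> vec_norm x * vec_norm y"
proof (cases "vec_norm x = 0")
  case True
  obtain N where N: "x \<in> Mn N" by (rule in_Mn_obtain)
  have "entry x k 0 = 0" for k using norm_entry_le_vec_norm[of x k] True by simp
  then show ?thesis using True by (simp add: entry_star_times[OF N] star_zero)
next
  case False
  define t where "t = norm (entry (x\<^sup>\<star> * x) 0 0)"
  define c where "c = entry (x\<^sup>\<star> * y) 0 0"
  define X where "X = entry (x\<^sup>\<star> * x) 0 0"
  define Y where "Y = entry (y\<^sup>\<star> * y) 0 0"
  have t: "0 < t" using False by (simp add: t_def vec_norm_def)
  have cs: "entry (y\<^sup>\<star> * x) 0 0 = c\<^sup>\<star>"
    unfolding c_def by (metis minf_star_mult minf_star_star star_minf.rep_eq)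
  define u where "u = complex_of_real t *\<^sub>C y - x * corner c"
  have "u\<^sup>\<star> * u = (complex_of_real t * complex_of_real t) *\<^sub>C (y\<^sup>\<star> * y)
      - complex_of_real t *\<^sub>C (y\<^sup>\<star> * x * corner c) - complex_of_real t *\<^sub>C (corner (c\<^sup>\<star>) * (x\<^sup>\<star> * y))
      + corner (c\<^sup>\<star>) * (x\<^sup>\<star> * x * corner c)"
    by (simp add: u_def minf_star_diff minf_star_scaleC minf_star_mult corner_star left_diff_distrib
        right_diff_distrib minf_scaleC_diff_right minf_mult_scaleC_left minf_mult_scaleC_right minf_scaleC_scaleC mult.assoc)
  moreover have "entry (x\<^sup>\<star> * (x * corner c)) 0 0 = X * c" "entry (y\<^sup>\<star> * (x * corner c)) 0 0 = c\<^sup>\<star> * c"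
    using entry_mult_corner[of "x\<^sup>\<star> * x" c 0 0] entry_mult_corner[of "y\<^sup>\<star> * x" c 0 0]
    by (simp_all add: mult.assoc X_def cs)
  ultimately have "entry (u\<^sup>\<star> * u) 0 0 = (t * t) *\<^sub>R Y - t *\<^sub>R (c\<^sup>\<star> * c) - t *\<^sub>R (c\<^sup>\<star> * c) + c\<^sup>\<star> * X * c"
    by (simp add: entry_mult_corner entry_corner_mult cs scaleR_scaleC mult.assoc
        flip: X_def Y_def c_def)
  then have 1: "nonneg_elem ((t * t) *\<^sub>R Y - t *\<^sub>R (c\<^sup>\<star> * c) - t *\<^sub>R (c\<^sup>\<star> * c) + c\<^sup>\<star> * X * c)"
    using nonneg_elem_inner[of u 0] by simp
  have "nonneg_elem (c\<^sup>\<star> * (t *\<^sub>R 1 - X) * c)"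
    by (rule nonneg_elem_conjugate)
      (simp add: t_def X_def nonneg_elem_norm_minus nonneg_elem_inner nonneg_elem_selfadjoint)
  from nonneg_elem_add[OF 1 this]
  have "nonneg_elem (inverse t *\<^sub>R ((t * t) *\<^sub>R Y - t *\<^sub>R (c\<^sup>\<star> * c)))"
    using t by (intro nonneg_elem_scaleR) (auto simp: algebra_simps)
  then have "nonneg_elem (t *\<^sub>R Y - c\<^sup>\<star> * c)" using t by (simp add: scaleR_diff_right mult.assoc[symmetric])
  from nonneg_elem_norm_mono[OF nonneg_elem_star_mult_self this]
  have "(norm c)\<^sup>2 \<le> t * norm Y" using t by (simp add: norm_star_mult_self)
  also have "\<dots> = (vec_norm x * vec_norm y)\<^sup>2"
    by (simp add: power_mult_distrib vec_norm_power2 t_def Y_def)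
  finally have "(norm c)\<^sup>2 \<le> (vec_norm x * vec_norm y)\<^sup>2" .
  then have "norm c \<le> vec_norm x * vec_norm y"
    by (rule power2_le_imp_le) (simp add: vec_norm_nonneg)
  then show ?thesis by (simp add: c_def)
qed

lemma vec_norm_triangle: "vec_norm (x + y) \<le> vec_norm x + vec_norm y"
proof (rule power2_le_imp_le)
  have "(vec_norm (x + y))\<^sup>2 = norm (entry (x\<^sup>\<star> * x) 0 0 + entry (x\<^sup>\<star> * y) 0 0
      + (entry (y\<^sup>\<star> * x) 0 0 + entry (y\<^sup>\<star> * y) 0 0))"
    by (simp add: vec_norm_power2 minf_star_add algebra_simps)
  also have "\<dots> \<le> (norm (entry (x\<^sup>\<star> * x) 0 0) + norm (entry (x\<^sup>\<star> * y) 0 0))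
      + (norm (entry (y\<^sup>\<star> * x) 0 0) + norm (entry (y\<^sup>\<star> * y) 0 0))"
    by (intro order_trans[OF norm_triangle_ineq] add_mono norm_triangle_ineq)
  also have "\<dots> \<le> ((vec_norm x)\<^sup>2 + vec_norm x * vec_norm y) + (vec_norm y * vec_norm x + (vec_norm y)\<^sup>2)"
    by (intro add_mono inner_Cauchy_Schwarz) (simp_all add: vec_norm_power2)
  finally show "(vec_norm (x + y))\<^sup>2 \<le> (vec_norm x + vec_norm y)\<^sup>2"
    by (simp add: power2_eq_square algebra_simps)
qed (simp add: vec_norm_nonneg)

lemma vec_norm_scaleC: "vec_norm (c *\<^sub>C x) = cmod c * vec_norm x"
proof -
  have "(c *\<^sub>C x)\<^sup>\<star> * (c *\<^sub>C x) = (c * cnj c) *\<^sub>C (x\<^sup>\<star> * x)"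
    by (simp add: minf_star_scaleC minf_mult_scaleC_left minf_mult_scaleC_right minf_scaleC_scaleC)
  then show ?thesis
    by (simp add: vec_norm_def norm_scaleC norm_mult real_sqrt_mult)
qed

text \<open>This crude bound makes the supremum in \<open>minf_norm\<close> finite and later yields
  that norm convergence in M_N(A) is entrywise convergence.\<close>

lemma vec_norm_mult_le_sum:
  assumes x: "x \<in> Mn N"
  shows "vec_norm (x * v) \<le> (\<Sum>i<N. \<Sum>j<N. norm (entry x i j)) * vec_norm v"
proof -
  have "norm (entry (x * v) i 0) \<le> (\<Sum>j<N. norm (entry x i j)) * vec_norm v" for i
    unfolding entry_times_left[OF x] sum_distrib_right
    by (intro order_trans[OF norm_sum] sum_mono order_trans[OF norm_mult_ineq] mult_left_mono
        norm_entry_le_vec_norm norm_ge_zero)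
  then have le: "(\<Sum>i<N. norm (entry (x * v) i 0)) \<le> (\<Sum>i<N. \<Sum>j<N. norm (entry x i j)) * vec_norm v"
    unfolding sum_distrib_right[of _ _ "vec_norm v"] by (intro sum_mono) auto
  obtain M where M: "x * v \<in> Mn M" by (rule in_Mn_obtain)
  have "vec_norm (x * v) \<le> (\<Sum>i<max M N. norm (entry (x * v) i 0))"
    by (rule vec_norm_le_sum) (rule Mn_mono[OF M], simp)
  also have "\<dots> = (\<Sum>i<N. norm (entry (x * v) i 0))"
    by (rule sum.mono_neutral_right) (auto simp: entry_times_left[OF x] MnD[OF x])
  finally show ?thesis using le by linarith
qed

text \<open>An infinitely supported v is sent to 0, since it is not the column of any matrix here;
  only finitely supported v occur in \<open>minf_norm\<close>.\<close>

lift_definition column :: "(nat \<Rightarrow> 'a::unital_cstar_algebra) \<Rightarrow> 'a minf"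
  is "\<lambda>v i j. if finite {i. v i \<noteq> 0} \<and> j = 0 then v i else 0"
proof -
  fix v :: "nat \<Rightarrow> 'a"
  show "\<exists>n. \<forall>i j. n \<le> i \<or> n \<le> j \<longrightarrow> (if finite {i. v i \<noteq> 0} \<and> j = 0 then v i else 0) = 0"
  proof (cases "finite {i. v i \<noteq> 0}")
    case True
    then obtain m where "\<forall>i\<in>{i. v i \<noteq> 0}. i < m" using finite_nat_set_iff_bounded by blast
    then show ?thesis by (intro exI[of _ "Suc m"]) fastforce
  qed auto
qed

lemma column_norm_eq:
  assumes "finite {i. v i \<noteq> 0}"
  shows "column_norm v = vec_norm (column v)"
proof -
  obtain N where N: "column v \<in> Mn N" by (rule in_Mn_obtain)
  have e: "entry (column v) k 0 = v k" for k using assms by (simp add: column.rep_eq)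
  have "(\<Sum>i | v i \<noteq> 0. (v i)\<^sup>\<star> * v i) = (\<Sum>i<N. (v i)\<^sup>\<star> * v i)"
    using assms MnD[OF N, of _ 0] by (intro sum.mono_neutral_left) (auto simp: e, metis not_le)
  then show ?thesis by (simp add: column_norm_def vec_norm_def entry_star_times[OF N] e)
qed

lemma apply_column_eq:
  assumes "finite {i. v i \<noteq> 0}"
  shows "apply_column x v = (\<lambda>i. entry (x * column v) i 0)"
  using assms by (simp add: fun_eq_iff apply_column_def times_minf.rep_eq column.rep_eq)

lemma column_norm_entry: "column_norm (\<lambda>i. entry y i 0) = vec_norm y"
proof -
  obtain N where N: "y \<in> Mn N" by (rule in_Mn_obtain)
  have f: "finite {i. entry y i 0 \<noteq> 0}"
    by (rule finite_subset[of _ "{..<N}"]) (use MnD[OF N] in \<open>auto simp: not_le[symmetric]\<close>)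
  show ?thesis unfolding column_norm_eq[OF f]
    by (rule vec_norm_cong) (simp add: column.rep_eq f)
qed

section \<open>The supremum over columns as an operator norm\<close>

lemma minf_norm_eq:
  "minf_norm x = (SUP v \<in> {v. finite {i. v i \<noteq> 0} \<and> vec_norm (column v) \<le> 1}. vec_norm (x * column v))"
  unfolding minf_norm_def
  by (rule arg_cong[of _ _ Sup], rule image_cong)
    (auto simp: column_norm_eq apply_column_eq column_norm_entry)

lemma minf_norm_bdd:
  "bdd_above ((\<lambda>v. vec_norm (x * column v)) ` {v. finite {i. v i \<noteq> 0} \<and> vec_norm (column v) \<le> 1})"
proof -
  obtain N where N: "x \<in> Mn N" by (rule in_Mn_obtain)
  have "vec_norm (x * column v) \<le> (\<Sum>i<N. \<Sum>j<N. norm (entry x i j))" if "vec_norm (column v) \<le> 1" for v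
    using order_trans[OF vec_norm_mult_le_sum[OF N] mult_left_le[OF that]] by (simp add: sum_nonneg)
  then show ?thesis by (auto intro!: bdd_aboveI2)
qed

lemma minf_norm_leI:
  assumes "0 \<le> K" "\<And>v. vec_norm (x * v) \<le> K * vec_norm v"
  shows "minf_norm x \<le> K"
  unfolding minf_norm_eq
proof (rule cSUP_least)
  show "{v :: nat \<Rightarrow> 'a. finite {i. v i \<noteq> 0} \<and> vec_norm (column v) \<le> 1} \<noteq> {}"
    by (auto intro!: exI[of _ "\<lambda>_. 0"] simp: column_norm_eq[symmetric] column_norm_def)
  fix v :: "nat \<Rightarrow> 'a" assume "v \<in> {v. finite {i. v i \<noteq> 0} \<and> vec_norm (column v) \<le> 1}"
  then show "vec_norm (x * column v) \<le> K"
    using order_trans[OF assms(2) mult_left_le[of "vec_norm (column v)" K]] assms(1) by auto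
qed

lemma vec_norm_mult_le: "vec_norm (x * v) \<le> minf_norm x * vec_norm v"
proof (cases "vec_norm v = 0")
  case True
  \<comment> \<open>A vector of norm zero cannot be normalized; the crude bound covers it.\<close>
  obtain N where N: "x \<in> Mn N" by (rule in_Mn_obtain)
  show ?thesis using vec_norm_mult_le_sum[OF N, of v] True by simp
next
  case False
  define s where "s = vec_norm v"
  have s: "0 < s" using False vec_norm_nonneg[of v] by (simp add: s_def)
  define w where "w = complex_of_real (inverse s) *\<^sub>C v"
  define c where "c = (\<lambda>i. entry w i 0)"
  obtain N where N: "w \<in> Mn N" by (rule in_Mn_obtain)
  have f: "finite {i. c i \<noteq> 0}"
    by (rule finite_subset[of _ "{..<N}"]) (use MnD[OF N] in \<open>auto simp: c_def not_le[symmetric]\<close>)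
  have e: "entry (column c) i 0 = entry w i 0" for i
    using f by (simp add: column.rep_eq) (simp add: c_def)
  have "vec_norm (column c) = vec_norm w" by (rule vec_norm_cong) (rule e)
  also have "\<dots> = 1" using s by (simp add: w_def vec_norm_scaleC s_def[symmetric] norm_inverse)
  finally have "vec_norm (x * column c) \<le> minf_norm x"
    unfolding minf_norm_eq by (intro cSUP_upper minf_norm_bdd) (simp add: f)
  moreover have "vec_norm (x * column c) = vec_norm (x * w)"
    by (rule vec_norm_cong) (simp add: times_minf.rep_eq e)
  moreover have "vec_norm (x * w) = inverse s * vec_norm (x * v)"
    using s by (simp add: w_def minf_mult_scaleC_right vec_norm_scaleC norm_inverse)
  ultimately show ?thesis using s by (simp add: field_simps s_def[symmetric])
qed

lemma minf_norm_nonneg: "0 \<le> minf_norm x"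
proof -
  have "vec_norm (x * corner 1) \<le> minf_norm x * vec_norm (corner (1::'a))"
    by (rule vec_norm_mult_le)
  moreover have "vec_norm (corner (1::'a)) = 1"
    by (simp add: vec_norm_def entry_mult_corner corner.rep_eq)
  ultimately show ?thesis using vec_norm_nonneg[of "x * corner 1"] by simp
qed

lemma minf_norm_le_sum: "x \<in> Mn N \<Longrightarrow> minf_norm x \<le> (\<Sum>i<N. \<Sum>j<N. norm (entry x i j))"
  by (intro minf_norm_leI vec_norm_mult_le_sum) (auto simp: sum_nonneg)

lemma norm_entry_le_minf_norm: "norm (entry x i j) \<le> minf_norm x"
proof -
  define v :: "nat \<Rightarrow> 'a" where "v = (\<lambda>k. if k = j then 1 else 0)"
  have f: "finite {i. v i \<noteq> 0}" by (rule finite_subset[of _ "{j}"]) (auto simp: v_def)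
  have "{i. v i \<noteq> 0} = {j}" by (auto simp: v_def)
  then have "(\<Sum>i | v i \<noteq> 0. (v i)\<^sup>\<star> * v i) = 1"
    by (simp only:) (simp add: v_def)
  then have n: "vec_norm (column v) = 1"
    by (simp add: column_norm_eq[OF f, symmetric] column_norm_def)
  obtain N where N: "x \<in> Mn N" by (rule in_Mn_obtain)
  have "entry (x * column v) i 0 = (\<Sum>k<N. if k = j then entry x i j else 0)"
    unfolding entry_times_left[OF N] using f by (intro sum.cong) (auto simp: column.rep_eq v_def)
  also have "\<dots> = entry x i j" using MnD[OF N, of i j] by auto
  finally have "norm (entry x i j) \<le> vec_norm (x * column v)"
    using norm_entry_le_vec_norm[of "x * column v" i] by simp
  then show ?thesis using vec_norm_mult_le[of x "column v"] n by simp
qed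

lemma minf_norm_eq_0: "minf_norm x = 0 \<longleftrightarrow> x = 0"
proof
  assume "minf_norm x = 0"
  then show "x = 0" using norm_entry_le_minf_norm[of x] by (auto intro!: minf_eqI)
next
  assume "x = 0"
  then show "minf_norm x = 0"
    using minf_norm_le_sum[of x 0] minf_norm_nonneg[of x] by (simp add: Mn_zero)
qed

lemma minf_norm_zero: "minf_norm 0 = 0"
  by (simp add: minf_norm_eq_0)

lemma minf_norm_triangle: "minf_norm (x + y) \<le> minf_norm x + minf_norm y"
proof (rule minf_norm_leI)
  fix v
  have "vec_norm ((x + y) * v) \<le> vec_norm (x * v) + vec_norm (y * v)"
    by (simp add: distrib_right vec_norm_triangle)
  then show "vec_norm ((x + y) * v) \<le> (minf_norm x + minf_norm y) * vec_norm v"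
    using vec_norm_mult_le[of x v] vec_norm_mult_le[of y v] by (simp add: distrib_right)
qed (simp add: minf_norm_nonneg)

lemma minf_norm_mult: "minf_norm (x * y) \<le> minf_norm x * minf_norm y"
proof (rule minf_norm_leI)
  fix v
  have "vec_norm (x * (y * v)) \<le> minf_norm x * vec_norm (y * v)" by (rule vec_norm_mult_le)
  also have "\<dots> \<le> minf_norm x * (minf_norm y * vec_norm v)"
    by (intro mult_left_mono vec_norm_mult_le minf_norm_nonneg)
  finally show "vec_norm ((x * y) * v) \<le> minf_norm x * minf_norm y * vec_norm v" by (simp add: mult.assoc)
qed (simp add: minf_norm_nonneg)

lemma minf_norm_scaleC: "minf_norm (c *\<^sub>C x) = cmod c * minf_norm x"
proof -
  have le: "minf_norm (c *\<^sub>C x) \<le> cmod c * minf_norm x" for c and x :: "'a minf"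
  proof (rule minf_norm_leI)
    fix v
    show "vec_norm (c *\<^sub>C x * v) \<le> cmod c * minf_norm x * vec_norm v"
      using vec_norm_mult_le[of x v]
      by (simp add: minf_mult_scaleC_left vec_norm_scaleC mult.assoc mult_left_mono)
  qed (simp add: minf_norm_nonneg)
  show ?thesis
  proof (cases "c = 0")
    case False
    have "minf_norm (inverse c *\<^sub>C (c *\<^sub>C x)) \<le> cmod (inverse c) * minf_norm (c *\<^sub>C x)" by (rule le)
    then have "cmod c * minf_norm x \<le> minf_norm (c *\<^sub>C x)"
      using False by (simp add: minf_scaleC_scaleC minf_scaleC_one norm_inverse norm_divide field_simps)
    then show ?thesis using le[of c x] by simp
  qed (use le[of c x] minf_norm_nonneg[of "c *\<^sub>C x"] in simp)
qed

text \<open>Cauchy-Schwarz applied to <x v, x v> = <v, x^* x v> gives ||x||^2 <= ||x^* x||.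
  Submultiplicativity turns this into ||x|| <= ||x^*||, and by symmetry both claims follow.\<close>

lemma minf_norm_star_mult_self: "minf_norm (x\<^sup>\<star> * x) = (minf_norm x)\<^sup>2"
  and minf_norm_star: "minf_norm (x\<^sup>\<star>) = minf_norm x"
proof -
  have le: "(minf_norm x)\<^sup>2 \<le> minf_norm (x\<^sup>\<star> * x)" for x :: "'a minf"
  proof -
    have "minf_norm x \<le> sqrt (minf_norm (x\<^sup>\<star> * x))"
    proof (rule minf_norm_leI)
      fix v
      have "(vec_norm (x * v))\<^sup>2 = norm (entry (v\<^sup>\<star> * (x\<^sup>\<star> * x * v)) 0 0)"
        by (simp add: vec_norm_power2 minf_star_mult mult.assoc)
      also have "\<dots> \<le> vec_norm v * vec_norm (x\<^sup>\<star> * x * v)" by (rule inner_Cauchy_Schwarz)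
      also have "\<dots> \<le> vec_norm v * (minf_norm (x\<^sup>\<star> * x) * vec_norm v)"
        by (intro mult_left_mono vec_norm_mult_le vec_norm_nonneg)
      also have "\<dots> = (sqrt (minf_norm (x\<^sup>\<star> * x)) * vec_norm v)\<^sup>2"
        by (simp add: power_mult_distrib minf_norm_nonneg) (simp add: power2_eq_square)
      finally show "vec_norm (x * v) \<le> sqrt (minf_norm (x\<^sup>\<star> * x)) * vec_norm v"
        by (rule power2_le_imp_le) (simp add: vec_norm_nonneg minf_norm_nonneg)
    qed (simp add: minf_norm_nonneg)
    then have "(minf_norm x)\<^sup>2 \<le> (sqrt (minf_norm (x\<^sup>\<star> * x)))\<^sup>2"
      by (intro power_mono minf_norm_nonneg)
    then show ?thesis by (simp add: minf_norm_nonneg)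
  qed
  have "minf_norm y \<le> minf_norm (y\<^sup>\<star>)" for y :: "'a minf"
  proof (cases "minf_norm y = 0")
    case False
    have "(minf_norm y)\<^sup>2 \<le> minf_norm (y\<^sup>\<star>) * minf_norm y"
      by (rule order_trans[OF le minf_norm_mult])
    then show ?thesis using False minf_norm_nonneg[of y] by (simp add: power2_eq_square)
  qed (simp add: minf_norm_nonneg)
  from this[of x] this[of "x\<^sup>\<star>"] show s: "minf_norm (x\<^sup>\<star>) = minf_norm x"
    by (simp add: minf_star_star)
  show "minf_norm (x\<^sup>\<star> * x) = (minf_norm x)\<^sup>2"
    using le[of x] minf_norm_mult[of "x\<^sup>\<star>" x] by (simp add: s power2_eq_square)
qed

lemma minf_norm_mone:
  assumes "1 \<le> N"
  shows "minf_norm (mone N :: 'a::unital_cstar_algebra minf) = 1"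
proof -
  let ?p = "mone N :: 'a minf"
  have "(minf_norm ?p)\<^sup>2 = minf_norm ?p"
    using minf_norm_star_mult_self[of ?p] by (simp add: mone_star mone_mult_left Mn_mone)
  moreover have "1 \<le> minf_norm ?p"
    using norm_entry_le_minf_norm[of ?p 0 0] assms by (simp add: mone.rep_eq)
  ultimately show ?thesis by (simp add: power2_eq_square)
qed

section \<open>The product of all matrix algebras\<close>

text \<open>The bounded sequences \<open>(x\<^sub>N)\<close> with \<open>x\<^sub>N \<in> M\<^sub>N(A)\<close> form a unital C*-algebra. It serves to apply
  the results on positive elements, which concern C*-algebras that are types, to every \<open>M\<^sub>N(A)\<close>.\<close>

lemma minf_norm_minus_commute: "minf_norm (x - y) = minf_norm (y - x)"
proof -
  have "x - y = (-1) *\<^sub>C (y - x)"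
    by (intro minf_eqI) (simp add: scaleC_uminus_left scaleC_one)
  then show ?thesis by (simp add: minf_norm_scaleC)
qed

lemma minf_norm_mone_le: "minf_norm (mone N :: 'a::unital_cstar_algebra minf) \<le> 1"
proof (cases "N = 0")
  case True
  then have "mone N = (0 :: 'a minf)" by (intro minf_eqI) (simp add: mone.rep_eq)
  then show ?thesis by (simp add: minf_norm_zero)
qed (simp add: minf_norm_mone)

text \<open>The norm lies between the norm of any single entry and the sum of the norms of the N^2
  entries.\<close>

lemma minf_norm_tendsto_iff:
  assumes "\<And>n. u n \<in> Mn N" "x \<in> Mn N"
  shows "(\<lambda>n. minf_norm (u n - x)) \<longlonglongrightarrow> 0 \<longleftrightarrow> (\<forall>i j. (\<lambda>n. entry (u n) i j) \<longlonglongrightarrow> entry x i j)"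
proof safe
  fix i j assume "(\<lambda>n. minf_norm (u n - x)) \<longlonglongrightarrow> 0"
  then have "(\<lambda>n. entry (u n) i j - entry x i j) \<longlonglongrightarrow> 0"
    by (rule Lim_null_comparison[rotated])
      (use norm_entry_le_minf_norm[of "u n - x" i j for n] in auto)
  then show "(\<lambda>n. entry (u n) i j) \<longlonglongrightarrow> entry x i j" by (simp add: LIM_zero_iff)
next
  assume *: "\<forall>i j. (\<lambda>n. entry (u n) i j) \<longlonglongrightarrow> entry x i j"
  have "(\<lambda>n. \<Sum>i<N. \<Sum>j<N. norm (entry (u n) i j - entry x i j)) \<longlonglongrightarrow> (\<Sum>i<N. \<Sum>j<N. 0)"
    using * by (intro tendsto_sum tendsto_norm_zero) (simp add: LIM_zero_iff)
  then have lim: "(\<lambda>n. \<Sum>i<N. \<Sum>j<N. norm (entry (u n) i j - entry x i j)) \<longlonglongrightarrow> 0"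
    by simp
  have "norm (minf_norm (u n - x)) \<le> (\<Sum>i<N. \<Sum>j<N. norm (entry (u n) i j - entry x i j))" for n
    using minf_norm_le_sum[OF Mn_diff[OF assms(1)[of n] assms(2)]] by (simp add: minf_norm_nonneg)
  then show "(\<lambda>n. minf_norm (u n - x)) \<longlonglongrightarrow> 0"
    by (intro Lim_null_comparison[OF _ lim] always_eventually allI)
qed

lemma Mn_complete:
  fixes u :: "nat \<Rightarrow> 'a::unital_cstar_algebra minf"
  assumes u: "\<And>n. u n \<in> Mn N"
    and cauchy: "\<And>e. 0 < e \<Longrightarrow> \<exists>M. \<forall>m\<ge>M. \<forall>n\<ge>M. minf_norm (u m - u n) < e"
  obtains x where "x \<in> Mn N" "(\<lambda>n. minf_norm (u n - x)) \<longlonglongrightarrow> 0"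
proof -
  have "Cauchy (\<lambda>n. entry (u n) i j)" for i j
    unfolding Cauchy_iff
  proof (intro allI impI)
    fix e :: real assume "0 < e"
    then obtain M where "\<forall>m\<ge>M. \<forall>n\<ge>M. minf_norm (u m - u n) < e" using cauchy by blast
    then show "\<exists>M. \<forall>m\<ge>M. \<forall>n\<ge>M. norm (entry (u m) i j - entry (u n) i j) < e"
      using norm_entry_le_minf_norm[of "u m - u n" i j for m n] by (metis le_less_trans minus_minf.rep_eq)
  qed
  then have "\<forall>i j. \<exists>l. (\<lambda>n. entry (u n) i j) \<longlonglongrightarrow> l"
    using Cauchy_convergent convergent_def by blast
  then obtain l where l: "\<And>i j. (\<lambda>n. entry (u n) i j) \<longlonglongrightarrow> l i j" by metis
  have l0: "l i j = 0" if "N \<le> i \<or> N \<le> j" for i j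
    using LIMSEQ_unique[OF l[of i j]] MnD[OF u that] by simp
  define x where "x = Abs_minf l"
  have x: "entry x i j = l i j" for i j
    using l0 by (subst x_def, subst Abs_minf_inverse) auto
  have xN: "x \<in> Mn N" using l0 by (simp add: Mn_def x)
  show thesis
    by (rule that[OF xN]) (simp add: minf_norm_tendsto_iff[OF u xN] x l)
qed

section \<open>The C*-algebra of bounded sequences of matrices\<close>

typedef (overloaded) 'a mprod =
  "{X :: nat \<Rightarrow> 'a::unital_cstar_algebra minf. (\<forall>N. X N \<in> Mn N) \<and> (\<exists>K. \<forall>N. minf_norm (X N) \<le> K)}"
  morphisms coord Abs_mprod
  by (rule exI[of _ "\<lambda>_. 0"]) (auto simp: Mn_zero)

setup_lifting type_definition_mprod

lemma coord_Mn: "coord X N \<in> Mn N"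
  using coord[of X] by auto

lemma mprod_eqI: "(\<And>N. coord X N = coord Y N) \<Longrightarrow> X = Y"
  by (metis coord_inject ext)

instantiation mprod :: (unital_cstar_algebra) "{zero, one, plus, minus, uminus, times, scaleC, star, scaleR}"
begin

lift_definition zero_mprod :: "'a mprod" is "\<lambda>_. 0"
  by (auto simp: Mn_zero)

lift_definition one_mprod :: "'a mprod" is mone
  using minf_norm_mone_le by (auto simp: Mn_mone)

lift_definition plus_mprod :: "'a mprod \<Rightarrow> 'a mprod \<Rightarrow> 'a mprod" is "\<lambda>X Y N. X N + Y N"
  by (auto simp: Mn_add) (meson add_mono minf_norm_triangle order_trans)

lift_definition uminus_mprod :: "'a mprod \<Rightarrow> 'a mprod" is "\<lambda>X N. - X N"
  by (auto simp: Mn_uminus, metis diff_0 diff_zero minf_norm_minus_commute)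

lift_definition minus_mprod :: "'a mprod \<Rightarrow> 'a mprod \<Rightarrow> 'a mprod" is "\<lambda>X Y N. X N - Y N"
proof -
  fix X Y :: "nat \<Rightarrow> 'a minf"
  assume X: "(\<forall>N. X N \<in> Mn N) \<and> (\<exists>K. \<forall>N. minf_norm (X N) \<le> K)"
    and Y: "(\<forall>N. Y N \<in> Mn N) \<and> (\<exists>K. \<forall>N. minf_norm (Y N) \<le> K)"
  then obtain K L where KL: "\<And>N. minf_norm (X N) \<le> K" "\<And>N. minf_norm (Y N) \<le> L" by auto
  have "minf_norm (X N - Y N) \<le> K + L" for N
    using minf_norm_triangle[of "X N" "- Y N"] KL[of N] minf_norm_minus_commute[of 0 "Y N"] by simp
  then show "(\<forall>N. X N - Y N \<in> Mn N) \<and> (\<exists>K. \<forall>N. minf_norm (X N - Y N) \<le> K)"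
    using X Y by (auto simp: Mn_diff)
qed

lift_definition times_mprod :: "'a mprod \<Rightarrow> 'a mprod \<Rightarrow> 'a mprod" is "\<lambda>X Y N. X N * Y N"
  by (auto simp: Mn_mult) (meson minf_norm_mult minf_norm_nonneg mult_mono order_trans)

lift_definition scaleC_mprod :: "complex \<Rightarrow> 'a mprod \<Rightarrow> 'a mprod" is "\<lambda>c X N. c *\<^sub>C X N"
  by (auto simp: Mn_scaleC minf_norm_scaleC) (meson mult_left_mono norm_ge_zero)

lift_definition star_mprod :: "'a mprod \<Rightarrow> 'a mprod" is "\<lambda>X N. (X N)\<^sup>\<star>"
  by (auto simp: Mn_star minf_norm_star)

definition scaleR_mprod :: "real \<Rightarrow> 'a mprod \<Rightarrow> 'a mprod" where
  "scaleR_mprod r X = complex_of_real r *\<^sub>C X"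

instance ..

end

lemmas coord_simps [simp] =
  zero_mprod.rep_eq one_mprod.rep_eq plus_mprod.rep_eq uminus_mprod.rep_eq minus_mprod.rep_eq
  times_mprod.rep_eq scaleC_mprod.rep_eq star_mprod.rep_eq

lemma coord_scaleR [simp]: "coord (r *\<^sub>R X) N = complex_of_real r *\<^sub>C coord X N"
  by (simp add: scaleR_mprod_def)

definition sup_norm :: "'a::unital_cstar_algebra mprod \<Rightarrow> real" where
  "sup_norm X = (SUP N. minf_norm (coord X N))"

lemma minf_norm_coord_le_sup_norm: "minf_norm (coord X N) \<le> sup_norm X"
  unfolding sup_norm_def
  using coord[of X] by (intro cSUP_upper) (auto simp: bdd_above_def)

lemma sup_norm_leI: "(\<And>N. minf_norm (coord X N) \<le> K) \<Longrightarrow> sup_norm X \<le> K"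
  unfolding sup_norm_def by (intro cSUP_least) auto

lemma sup_norm_nonneg: "0 \<le> sup_norm X"
  using minf_norm_coord_le_sup_norm[of X 0] minf_norm_nonneg[of "coord X 0"] by linarith

instantiation mprod :: (unital_cstar_algebra) real_normed_algebra_1
begin

definition norm_mprod :: "'a mprod \<Rightarrow> real" where
  "norm_mprod = sup_norm"

definition dist_mprod :: "'a mprod \<Rightarrow> 'a mprod \<Rightarrow> real" where
  "dist_mprod X Y = norm (X - Y)"

definition sgn_mprod :: "'a mprod \<Rightarrow> 'a mprod" where
  "sgn_mprod X = inverse (norm X) *\<^sub>R X"

definition uniformity_mprod :: "('a mprod \<times> 'a mprod) filter" where
  "uniformity_mprod = (INF e\<in>{0<..}. principal {(X, Y). dist X Y < e})"

definition open_mprod :: "'a mprod set \<Rightarrow> bool" where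
  "open_mprod U \<longleftrightarrow> (\<forall>X\<in>U. \<forall>\<^sub>F (X', Y) in uniformity. X' = X \<longrightarrow> Y \<in> U)"

instance
proof
  fix X Y Z :: "'a mprod" and U :: "'a mprod set" and a b :: real
  show "X * Y * Z = X * (Y * Z)" "(X + Y) * Z = X * Z + Y * Z" "X * (Y + Z) = X * Y + X * Z"
    "X + Y + Z = X + (Y + Z)" "X + Y = Y + X" "0 + X = X" "- X + X = 0" "X - Y = X + - Y"
    "1 * X = X" "X * 1 = X"
    by (rule mprod_eqI; simp add: algebra_simps mone_mult_left mone_mult_right coord_Mn)+
  show "a *\<^sub>R (X + Y) = a *\<^sub>R X + a *\<^sub>R Y" "(a + b) *\<^sub>R X = a *\<^sub>R X + b *\<^sub>R X"
    "a *\<^sub>R b *\<^sub>R X = (a * b) *\<^sub>R X" "1 *\<^sub>R X = X"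
    "a *\<^sub>R X * Y = a *\<^sub>R (X * Y)" "X * a *\<^sub>R Y = a *\<^sub>R (X * Y)"
    by (rule mprod_eqI; simp add: minf_scaleC_add_right minf_scaleC_add_left minf_scaleC_scaleC
        minf_scaleC_one minf_mult_scaleC_left minf_mult_scaleC_right)+
  have minf_norm_coord_le: "minf_norm (coord X N) \<le> norm X" for X :: "'a mprod" and N
    unfolding norm_mprod_def by (rule minf_norm_coord_le_sup_norm)
  have norm_mprod_leI: "(\<And>N. minf_norm (coord X N) \<le> K) \<Longrightarrow> norm X \<le> K" for X :: "'a mprod" and K
    unfolding norm_mprod_def by (rule sup_norm_leI)
  have norm_mprod_nonneg: "0 \<le> norm X" for X :: "'a mprod"
    unfolding norm_mprod_def by (rule sup_norm_nonneg)
  \<comment> \<open>Coordinate 1 is evaluated because M_0(A) is the zero algebra, so coordinate 0 of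
    the unit vanishes.\<close>
  have one: "1 \<le> norm (1 :: 'a mprod)"
    using minf_norm_coord_le[of "1 :: 'a mprod" 1] minf_norm_mone[of 1, where ?'a = 'a] by simp
  show "norm (1 :: 'a mprod) = 1"
    using one by (intro antisym norm_mprod_leI) (auto simp: minf_norm_mone_le)
  show z: "norm X = 0 \<longleftrightarrow> X = 0" for X :: "'a mprod"
  proof
    assume "norm X = 0"
    then have "minf_norm (coord X N) = 0" for N
      using minf_norm_coord_le[of X N] minf_norm_nonneg[of "coord X N"] by simp
    then show "X = 0" by (intro mprod_eqI) (simp add: minf_norm_eq_0)
  next
    assume "X = 0"
    then have "norm X \<le> 0" by (intro norm_mprod_leI) (simp add: minf_norm_zero)
    then show "norm X = 0" using norm_mprod_nonneg[of X] by simp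
  qed
  show "(0 :: 'a mprod) \<noteq> 1" using one z[of 0] by auto
  show "dist X Y = norm (X - Y)" by (rule dist_mprod_def)
  show "sgn X = inverse (norm X) *\<^sub>R X" by (rule sgn_mprod_def)
  show "uniformity = (INF e\<in>{0<..}. principal {(X :: 'a mprod, Y). dist X Y < e})"
    by (rule uniformity_mprod_def)
  show "open U \<longleftrightarrow> (\<forall>X\<in>U. \<forall>\<^sub>F (X', Y) in uniformity. X' = X \<longrightarrow> Y \<in> U)" by (rule open_mprod_def)
  show "norm (X + Y) \<le> norm X + norm Y"
  proof (rule norm_mprod_leI)
    fix N
    show "minf_norm (coord (X + Y) N) \<le> norm X + norm Y"
      using minf_norm_triangle[of "coord X N" "coord Y N"] minf_norm_coord_le[of X N]
        minf_norm_coord_le[of Y N] by simp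
  qed
  show "norm (X * Y) \<le> norm X * norm Y"
  proof (rule norm_mprod_leI)
    fix N
    show "minf_norm (coord (X * Y) N) \<le> norm X * norm Y"
      using minf_norm_mult[of "coord X N" "coord Y N"]
        mult_mono[OF minf_norm_coord_le[of X N] minf_norm_coord_le[of Y N] norm_mprod_nonneg minf_norm_nonneg]
      by simp
  qed
  have le: "norm (a *\<^sub>R X) \<le> \<bar>a\<bar> * norm X" for a and X :: "'a mprod"
    by (rule norm_mprod_leI) (simp add: minf_norm_scaleC minf_norm_coord_le mult_left_mono)
  show "norm (a *\<^sub>R X) = \<bar>a\<bar> * norm X"
  proof (rule antisym[OF le])
    show "\<bar>a\<bar> * norm X \<le> norm (a *\<^sub>R X)"
    proof (cases "a = 0")
      case False
      have "inverse a *\<^sub>R a *\<^sub>R X = X"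
        using False by (intro mprod_eqI) (simp add: minf_scaleC_scaleC minf_scaleC_one)
      then have "norm X \<le> \<bar>inverse a\<bar> * norm (a *\<^sub>R X)" using le[of "inverse a" "a *\<^sub>R X"] by simp
      then show ?thesis using False by (simp add: field_simps)
    qed (simp add: norm_mprod_nonneg)
  qed
qed

end

lemmas minf_norm_coord_le = minf_norm_coord_le_sup_norm[folded norm_mprod_def]
  and norm_mprod_leI = sup_norm_leI[folded norm_mprod_def]

instance mprod :: (unital_cstar_algebra) banach
proof
  fix X :: "nat \<Rightarrow> 'a mprod"
  assume X: "Cauchy X"
  have c: "\<exists>M. \<forall>m\<ge>M. \<forall>n\<ge>M. \<forall>N. minf_norm (coord (X m) N - coord (X n) N) < e" if e: "0 < e" for e
  proof -
    obtain M where "\<forall>m\<ge>M. \<forall>n\<ge>M. norm (X m - X n) < e" using X e unfolding Cauchy_iff by blast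
    then show ?thesis
      using minf_norm_coord_le[of "X m - X n" for m n] by (metis le_less_trans minus_mprod.rep_eq)
  qed
  have "\<exists>x. x \<in> Mn N \<and> (\<lambda>n. minf_norm (coord (X n) N - x)) \<longlonglongrightarrow> 0" for N
  proof -
    have "\<exists>M. \<forall>m\<ge>M. \<forall>n\<ge>M. minf_norm (coord (X m) N - coord (X n) N) < e" if "0 < e" for e
      using c[OF that] by blast
    then obtain x where "x \<in> Mn N" "(\<lambda>n. minf_norm (coord (X n) N - x)) \<longlonglongrightarrow> 0"
      by (rule Mn_complete[of "\<lambda>n. coord (X n) N" N, OF coord_Mn]) auto
    then show ?thesis by blast
  qed
  then obtain x where xN: "\<And>N. x N \<in> Mn N" and x: "\<And>N. (\<lambda>n. minf_norm (coord (X n) N - x N)) \<longlonglongrightarrow> 0"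
    by metis
  \<comment> \<open>The Cauchy estimate holds for all N at once, and the limit in n keeps it, so the
    coordinatewise limits are approached uniformly. Uniformity also bounds the limit
    sequence.\<close>
  have unif: "\<exists>M. \<forall>m\<ge>M. \<forall>N. minf_norm (coord (X m) N - x N) \<le> e" if e: "0 < e" for e
  proof -
    obtain M where M: "\<And>m n N. M \<le> m \<Longrightarrow> M \<le> n \<Longrightarrow> minf_norm (coord (X m) N - coord (X n) N) < e"
      using c[OF e] by blast
    have "minf_norm (coord (X m) N - x N) \<le> e" if m: "M \<le> m" for m N
    proof (rule tendsto_lowerbound)
      show "(\<lambda>n. e + minf_norm (coord (X n) N - x N)) \<longlonglongrightarrow> e"
        using tendsto_add[OF tendsto_const x] by simp
      have "minf_norm (coord (X m) N - x N) \<le> e + minf_norm (coord (X n) N - x N)" if "M \<le> n" for n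
        using minf_norm_triangle[of "coord (X m) N - coord (X n) N" "coord (X n) N - x N"] M[OF m that, of N]
        by simp
      then show "\<forall>\<^sub>F n in sequentially. minf_norm (coord (X m) N - x N) \<le> e + minf_norm (coord (X n) N - x N)"
        by (auto simp: eventually_sequentially)
    qed simp
    then show ?thesis by blast
  qed
  obtain M where M: "\<And>N. minf_norm (coord (X M) N - x N) \<le> 1" using unif[of 1] by auto
  have "minf_norm (x N) \<le> norm (X M) + 1" for N
    using minf_norm_triangle[of "coord (X M) N" "x N - coord (X M) N"] M[of N]
      minf_norm_minus_commute[of "x N"] minf_norm_coord_le[of "X M" N] by simp
  then have Y: "coord (Abs_mprod x) = x" using xN by (intro Abs_mprod_inverse) auto
  have "X \<longlonglongrightarrow> Abs_mprod x"
    unfolding LIMSEQ_iff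
  proof (intro allI impI)
    fix e :: real assume e: "0 < e"
    then obtain M where M: "\<And>m N. M \<le> m \<Longrightarrow> minf_norm (coord (X m) N - x N) \<le> e / 2"
      using unif[of "e / 2"] by auto
    have "norm (X m - Abs_mprod x) < e" if "M \<le> m" for m
    proof -
      have "norm (X m - Abs_mprod x) \<le> e / 2"
        by (rule norm_mprod_leI) (use M[OF that] in \<open>simp add: Y\<close>)
      then show ?thesis using e by simp
    qed
    then show "\<exists>M. \<forall>m\<ge>M. norm (X m - Abs_mprod x) < e" by blast
  qed
  then show "convergent X" by (auto simp: convergent_def)
qed

instance mprod :: (unital_cstar_algebra) unital_cstar_algebra
proof
  fix X Y :: "'a mprod" and c d :: complex and r :: real
  show "c *\<^sub>C (X + Y) = c *\<^sub>C X + c *\<^sub>C Y" "(c + d) *\<^sub>C X = c *\<^sub>C X + d *\<^sub>C X"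
    "c *\<^sub>C d *\<^sub>C X = (c * d) *\<^sub>C X" "r *\<^sub>R X = complex_of_real r *\<^sub>C X"
    "(c *\<^sub>C X) * Y = c *\<^sub>C (X * Y)" "X * (c *\<^sub>C Y) = c *\<^sub>C (X * Y)"
    "X\<^sup>\<star>\<^sup>\<star> = X" "(X + Y)\<^sup>\<star> = X\<^sup>\<star> + Y\<^sup>\<star>" "(X * Y)\<^sup>\<star> = Y\<^sup>\<star> * X\<^sup>\<star>" "(c *\<^sub>C X)\<^sup>\<star> = cnj c *\<^sub>C X\<^sup>\<star>"
    by (rule mprod_eqI; simp add: minf_scaleC_add_right minf_scaleC_add_left minf_scaleC_scaleC
        minf_mult_scaleC_left minf_mult_scaleC_right minf_star_star minf_star_add minf_star_mult
        minf_star_scaleC)+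
  have le: "norm (c *\<^sub>C X) \<le> cmod c * norm X" for c and X :: "'a mprod"
    by (rule norm_mprod_leI) (simp add: minf_norm_scaleC minf_norm_coord_le mult_left_mono)
  show "norm (c *\<^sub>C X) = cmod c * norm X"
  proof (rule antisym[OF le])
    show "cmod c * norm X \<le> norm (c *\<^sub>C X)"
    proof (cases "c = 0")
      case False
      have "inverse c *\<^sub>C c *\<^sub>C X = X"
        using False by (intro mprod_eqI) (simp add: minf_scaleC_scaleC minf_scaleC_one)
      then have "norm X \<le> cmod (inverse c) * norm (c *\<^sub>C X)" using le[of "inverse c" "c *\<^sub>C X"] by simp
      then show ?thesis using False by (simp add: norm_inverse field_simps norm_divide)
    qed simp
  qed
  have "norm X \<le> sqrt (norm (X\<^sup>\<star> * X))"
  proof (rule norm_mprod_leI)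
    fix N
    have "(minf_norm (coord X N))\<^sup>2 \<le> norm (X\<^sup>\<star> * X)"
      using minf_norm_coord_le[of "X\<^sup>\<star> * X" N] by (simp add: minf_norm_star_mult_self)
    then show "minf_norm (coord X N) \<le> sqrt (norm (X\<^sup>\<star> * X))" by (rule real_le_rsqrt)
  qed
  then have "(norm X)\<^sup>2 \<le> norm (X\<^sup>\<star> * X)"
    by (metis norm_ge_zero power_mono real_sqrt_pow2)
  moreover have "norm (X\<^sup>\<star> * X) \<le> (norm X)\<^sup>2"
  proof (rule norm_mprod_leI)
    fix N
    show "minf_norm (coord (X\<^sup>\<star> * X) N) \<le> (norm X)\<^sup>2"
      using minf_norm_coord_le[of X N] by (simp add: minf_norm_star_mult_self power_mono minf_norm_nonneg)
  qed
  ultimately show "norm (X\<^sup>\<star> * X) = (norm X)\<^sup>2" by simp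
qed

section \<open>Roots of positive matrices\<close>

text \<open>The witness is kept inside M_N(A), so that a positive matrix becomes a positive element
  of the product; \<open>minf_positive\<close> leaves its size open.\<close>

definition Mn_positive :: "nat \<Rightarrow> 'a::unital_cstar_algebra minf set" where
  "Mn_positive N = {x\<^sup>\<star> * x | x. x \<in> Mn N}"

definition minf_power :: "nat \<Rightarrow> 'a::unital_cstar_algebra minf \<Rightarrow> 'a minf" where
  "minf_power k b = (((*) b) ^^ (k - 1)) b"

lemma minf_power_1: "minf_power (Suc 0) b = b"
  by (simp add: minf_power_def)

lemma minf_power_Suc: "1 \<le> k \<Longrightarrow> minf_power (Suc k) b = b * minf_power k b"
  by (cases k) (auto simp: minf_power_def)

lemma Mn_positiveI: "x \<in> Mn N \<Longrightarrow> x\<^sup>\<star> * x \<in> Mn_positive N"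
  by (auto simp: Mn_positive_def)

lemma Mn_positive_in_Mn: "a \<in> Mn_positive N \<Longrightarrow> a \<in> Mn N"
  by (auto simp: Mn_positive_def intro: Mn_mult Mn_star)

lemma Mn_positive_mono: "a \<in> Mn_positive M \<Longrightarrow> M \<le> N \<Longrightarrow> a \<in> Mn_positive N"
  by (auto simp: Mn_positive_def dest: Mn_mono)

lemma Mn_positive_minf_positive: "a \<in> Mn_positive N \<Longrightarrow> a \<in> minf_positive"
  by (auto simp: Mn_positive_def minf_positive_def)

lemma Mn_positive_star: "a \<in> Mn_positive N \<Longrightarrow> a\<^sup>\<star> = a"
  by (auto simp: Mn_positive_def minf_star_mult minf_star_star)

lemma minf_positive_obtain:
  assumes "a \<in> minf_positive"
  obtains N where "a \<in> Mn_positive N" "1 \<le> N"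
  using assms in_Mn_obtain unfolding Mn_positive_def minf_positive_def by blast

text \<open>The N-th factor of the product. On \<open>Mn N\<close> it preserves products and
  adjoints but not the unit: \<open>embed N (mone N)\<close> is a projection other than 1. Other
  matrices are sent to 0 only to make the function total.\<close>

lift_definition embed :: "nat \<Rightarrow> 'a::unital_cstar_algebra minf \<Rightarrow> 'a mprod"
  is "\<lambda>N x M. if M = N \<and> x \<in> Mn N then x else 0"
proof -
  fix N :: nat and x :: "'a minf"
  have "minf_norm (0 :: 'a minf) \<le> minf_norm x"
    using minf_norm_nonneg[of x] by (simp add: minf_norm_zero)
  then show "(\<forall>M. (if M = N \<and> x \<in> Mn N then x else 0) \<in> Mn M)
      \<and> (\<exists>K. \<forall>M. minf_norm (if M = N \<and> x \<in> Mn N then x else 0) \<le> K)"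
    by (auto simp: Mn_zero intro!: exI[of _ "minf_norm x"])
qed

lemma coord_embed: "x \<in> Mn N \<Longrightarrow> coord (embed N x) N = x"
  by (simp add: embed.rep_eq)

lemma embed_mult: "x \<in> Mn N \<Longrightarrow> y \<in> Mn N \<Longrightarrow> embed N (x * y) = embed N x * embed N y"
  by (rule mprod_eqI) (simp add: embed.rep_eq Mn_mult)

lemma embed_star: "x \<in> Mn N \<Longrightarrow> embed N (x\<^sup>\<star>) = (embed N x)\<^sup>\<star>"
  by (rule mprod_eqI) (simp add: embed.rep_eq Mn_star minf_star_zero)

lemma coord_power: "1 \<le> k \<Longrightarrow> coord (X ^ k) N = minf_power k (coord X N)"
proof (induction k rule: dec_induct)
  case base
  show ?case by (simp add: minf_power_1)
next
  case (step k)
  then show ?case by (simp add: minf_power_Suc)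
qed

lemma Mn_power: "x \<in> Mn N \<Longrightarrow> 1 \<le> k \<Longrightarrow> minf_power k x \<in> Mn N"
  by (metis coord_Mn coord_embed coord_power)

lemma embed_power: "1 \<le> k \<Longrightarrow> x \<in> Mn N \<Longrightarrow> embed N (minf_power k x) = embed N x ^ k"
proof (induction k rule: dec_induct)
  case base
  show ?case by (simp add: minf_power_1)
next
  case (step k)
  then show ?case by (simp add: minf_power_Suc embed_mult Mn_power)
qed

lemma nonneg_elem_embed: "a \<in> Mn_positive N \<Longrightarrow> nonneg_elem (embed N a)"
  by (auto simp: Mn_positive_def embed_mult embed_star Mn_star nonneg_elem_star_mult_self)

lemma Mn_positive_coord: "nonneg_elem X \<Longrightarrow> coord X N \<in> Mn_positive N"
  by (auto simp: nonneg_elem_iff intro!: Mn_positiveI coord_Mn)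

lemma minf_power_inject:
  assumes "b \<in> Mn_positive N" "c \<in> Mn_positive N" "1 \<le> k" "minf_power k b = minf_power k c"
  shows "b = c"
proof -
  have "embed N b = embed N c"
    by (rule nonneg_elem_root_unique[where k = k])
      (use assms in \<open>auto simp: nonneg_elem_embed Mn_positive_in_Mn simp flip: embed_power\<close>)
  then show ?thesis using assms by (metis Mn_positive_in_Mn coord_embed)
qed

text \<open>A competing root may live in larger matrices; both lie in a common M_N(A), where roots
  are unique. This is what gives the definite description its meaning.\<close>

lemma positive_root_eqI:
  assumes r: "r \<in> minf_positive" and k: "1 \<le> k" and a: "minf_power k r = a"
  shows "positive_root k a = r"
  unfolding positive_root_def minf_power_def[symmetric]
proof (rule the_equality)
  show "r \<in> minf_positive \<and> minf_power k r = a" using r a by simp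
  fix b assume b: "b \<in> minf_positive \<and> minf_power k b = a"
  obtain M where M: "b \<in> Mn_positive M" using b minf_positive_obtain by blast
  obtain N where N: "r \<in> Mn_positive N" using r minf_positive_obtain by blast
  show "b = r"
    by (rule minf_power_inject[of b "max M N" r k])
      (use b a k in \<open>auto intro: Mn_positive_mono[OF M] Mn_positive_mono[OF N]\<close>)
qed

text \<open>The root is taken in the product and read off at coordinate N; the last clause descends
  from the commutation clause of \<open>nonneg_elem_root\<close>.\<close>

lemma positive_root:
  assumes a: "a \<in> Mn_positive N" and k: "1 \<le> k"
  shows "positive_root k a \<in> Mn_positive N"
    and "minf_power k (positive_root k a) = a"
    and "y \<in> Mn N \<Longrightarrow> y * a = a * y \<Longrightarrow> y * positive_root k a = positive_root k a * y"
proof -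
  obtain R where R: "nonneg_elem R" "R ^ k = embed N a"
    and Rc: "\<And>Y. Y * embed N a = embed N a * Y \<Longrightarrow> Y * R = R * Y"
    by (rule nonneg_elem_root[OF nonneg_elem_embed[OF a] k]) blast
  have r: "coord R N \<in> Mn_positive N" by (rule Mn_positive_coord[OF R(1)])
  have rk: "minf_power k (coord R N) = a"
    using coord_power[OF k, of R N] R(2) coord_embed[OF Mn_positive_in_Mn[OF a]] by simp
  have eq: "positive_root k a = coord R N"
    by (rule positive_root_eqI[OF Mn_positive_minf_positive[OF r] k rk])
  show "positive_root k a \<in> Mn_positive N" "minf_power k (positive_root k a) = a"
    using r rk by (simp_all add: eq)
  assume y: "y \<in> Mn N" and "y * a = a * y"
  then have "embed N y * embed N a = embed N a * embed N y"
    using Mn_positive_in_Mn[OF a] by (simp flip: embed_mult)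
  then have "coord (embed N y * R) N = coord (R * embed N y) N" by (simp add: Rc)
  then show "y * positive_root k a = positive_root k a * y"
    using y by (simp add: eq coord_embed)
qed

lemma minf_power_scaleC: "1 \<le> k \<Longrightarrow> minf_power k (c *\<^sub>C x) = c ^ k *\<^sub>C minf_power k x"
proof (induction k rule: dec_induct)
  case base
  show ?case by (simp add: minf_power_1)
next
  case (step k)
  then show ?case
    by (simp add: minf_power_Suc minf_mult_scaleC_left minf_mult_scaleC_right minf_scaleC_scaleC mult.commute)
qed

lemma Mn_positive_scaleC:
  assumes "a \<in> Mn_positive N" "0 \<le> s"
  shows "complex_of_real s *\<^sub>C a \<in> Mn_positive N"
proof -
  obtain x where x: "x \<in> Mn N" "a = x\<^sup>\<star> * x" using assms(1) by (auto simp: Mn_positive_def)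
  have "complex_of_real s *\<^sub>C a = (complex_of_real (sqrt s) *\<^sub>C x)\<^sup>\<star> * (complex_of_real (sqrt s) *\<^sub>C x)"
    using assms(2)
    by (simp add: x minf_star_scaleC minf_mult_scaleC_left minf_mult_scaleC_right minf_scaleC_scaleC
        flip: of_real_mult)
  then show ?thesis using x by (simp add: Mn_positiveI Mn_scaleC)
qed

lemma positive_root_scaleC:
  assumes a: "a \<in> Mn_positive N" and s: "0 \<le> s" and k: "1 \<le> k"
  shows "positive_root k (complex_of_real s *\<^sub>C a) = complex_of_real (root k s) *\<^sub>C positive_root k a"
proof (rule positive_root_eqI[OF _ k])
  show "complex_of_real (root k s) *\<^sub>C positive_root k a \<in> minf_positive"
    using s k by (intro Mn_positive_minf_positive[OF Mn_positive_scaleC[OF positive_root(1)[OF a k]]]) simp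
  show "minf_power k (complex_of_real (root k s) *\<^sub>C positive_root k a) = complex_of_real s *\<^sub>C a"
    using s k by (simp add: minf_power_scaleC positive_root(2)[OF a] flip: of_real_power)
qed

text \<open>If \<open>b\<close> is the root of \<open>a\<close> of order \<open>k (k + 1)\<close>, then the two roots in question are \<open>b\<^sup>k\<close> and
  \<open>b\<^sup>k\<^sup>+\<^sup>1\<close>, with difference \<open>b\<^sup>k (1 - b)\<close>.\<close>

lemma positive_root_mono:
  assumes a: "a \<in> Mn_positive N" and le: "norm (embed N a) \<le> 1" and k: "1 \<le> k"
  shows "positive_root (Suc k) a - positive_root k a \<in> Mn_positive N"
    and "mone N - positive_root k a \<in> Mn_positive N"
proof -
  define m where "m = k * Suc k"
  have m: "1 \<le> m" using k by (simp add: m_def)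
  define b where "b = positive_root m a"
  define B where "B = embed N b"
  have b: "b \<in> Mn_positive N" "minf_power m b = a"
    using positive_root(1,2)[OF a m] by (simp_all add: b_def)
  have B: "nonneg_elem B" "B ^ m = embed N a"
    using nonneg_elem_embed[OF b(1)] embed_power[OF m Mn_positive_in_Mn[OF b(1)]] by (simp_all add: B_def b(2))
  have "norm B ^ m \<le> 1" using le norm_selfadjoint_power[OF nonneg_elem_selfadjoint[OF B(1)], of m] B(2) by simp
  then have nB: "norm B \<le> 1" using m by (metis norm_ge_zero not_le one_less_power less_le_trans zero_less_one)
  have root: "positive_root j a = coord (B ^ l) N" if "1 \<le> j" "1 \<le> l" "l * j = m" for j l
  proof (rule positive_root_eqI[OF _ that(1)])
    show "coord (B ^ l) N \<in> minf_positive"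
      using Mn_positive_coord[OF nonneg_elem_power[OF B(1)]] by (rule Mn_positive_minf_positive)
    have "minf_power j (coord (B ^ l) N) = coord (B ^ m) N"
      using that by (simp add: coord_power[symmetric] power_mult[symmetric])
    then show "minf_power j (coord (B ^ l) N) = a"
      using Mn_positive_in_Mn[OF a] by (simp add: B(2) coord_embed)
  qed
  have nn: "nonneg_elem (1 - c)" if "nonneg_elem c" "norm c \<le> 1" for c :: "'a mprod"
    using nonneg_elem_of_norm_le[OF that(1) _ that(2)] by simp
  have "nonneg_elem (B ^ k * (1 - B))"
    by (intro nonneg_elem_mult nonneg_elem_power B(1) nn nB) (simp add: algebra_simps power_commutes)
  then have "nonneg_elem (B ^ k - B ^ Suc k)" by (simp add: algebra_simps power_commutes)
  from Mn_positive_coord[OF this, of N]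
  show "positive_root (Suc k) a - positive_root k a \<in> Mn_positive N"
    using root[of "Suc k" k] root[of k "Suc k"] k by (simp add: m_def mult.commute)
  have "norm (B ^ Suc k) \<le> 1"
    using norm_power_ineq[of B "Suc k"] power_le_one[OF norm_ge_zero nB, of "Suc k"] by linarith
  from Mn_positive_coord[OF nn[OF nonneg_elem_power[OF B(1)] this], of N]
  show "mone N - positive_root k a \<in> Mn_positive N"
    using root[of k "Suc k"] k by (simp add: m_def mult.commute)
qed

section \<open>Quasitraces on commuting families\<close>

text \<open>The double commutant relative to M_N(A). For commuting selfadjoint Z it is a commutative
  C*-subalgebra, so quasitraces are linear on it, and it contains the roots of positive elements of
  Z directly by their commutation property, without polynomial approximation.\<close>

definition bicommutant :: "nat \<Rightarrow> 'a::unital_cstar_algebra minf set \<Rightarrow> 'a minf set" where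
  "bicommutant N Z = {x \<in> Mn N. \<forall>y\<in>Mn N. (\<forall>z\<in>Z. y * z = z * y) \<longrightarrow> y * x = x * y}"

lemma subset_bicommutant: "Z \<subseteq> Mn N \<Longrightarrow> z \<in> Z \<Longrightarrow> z \<in> bicommutant N Z"
  by (auto simp: bicommutant_def)

lemma mone_in_bicommutant: "mone N \<in> bicommutant N Z"
  by (simp add: bicommutant_def Mn_mone mone_mult_left mone_mult_right)

text \<open>Elements of Z commute with Z, hence with every x in the bicommutant; so x in turn
  commutes with Z, hence with every y in the bicommutant. Selfadjoint generators give closure under
  adjoints, and continuity of commutators gives norm closure.\<close>

lemma bicommutant_commutative_cstar_subalgebra:
  assumes Z: "Z \<subseteq> Mn N" and sa: "\<And>z. z \<in> Z \<Longrightarrow> z\<^sup>\<star> = z"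
    and comm: "\<And>z z'. z \<in> Z \<Longrightarrow> z' \<in> Z \<Longrightarrow> z * z' = z' * z"
  shows "commutative_cstar_subalgebra minf_norm (Mn N) (bicommutant N Z)"
  unfolding commutative_cstar_subalgebra_def
proof (intro conjI ballI allI impI)
  let ?B = "bicommutant N Z"
  have comD: "y * x = x * y" if "x \<in> ?B" "y \<in> Mn N" "\<And>z. z \<in> Z \<Longrightarrow> y * z = z * y" for x y
    using that by (auto simp: bicommutant_def)
  show "?B \<subseteq> Mn N" "0 \<in> ?B" by (auto simp: bicommutant_def Mn_zero)
  fix x assume x: "x \<in> ?B"
  then have xM: "x \<in> Mn N" by (simp add: bicommutant_def)
  show "c *\<^sub>C x \<in> ?B" for c
    using x by (auto simp: bicommutant_def Mn_scaleC minf_mult_scaleC_left minf_mult_scaleC_right)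
  show "x\<^sup>\<star> \<in> ?B"
    unfolding bicommutant_def
  proof (intro CollectI conjI ballI impI)
    fix y assume y: "y \<in> Mn N" "\<forall>z\<in>Z. y * z = z * y"
    have "y\<^sup>\<star> * z = z * y\<^sup>\<star>" if "z \<in> Z" for z
      using y(2) that sa[OF that] by (metis minf_star_mult)
    then have "y\<^sup>\<star> * x = x * y\<^sup>\<star>" by (rule comD[OF x Mn_star[OF y(1)]])
    then show "y * x\<^sup>\<star> = x\<^sup>\<star> * y" by (metis minf_star_mult minf_star_star)
  qed (rule Mn_star[OF xM])
  fix y assume y: "y \<in> ?B"
  then have yM: "y \<in> Mn N" by (simp add: bicommutant_def)
  show "x + y \<in> ?B" using x y by (auto simp: bicommutant_def Mn_add algebra_simps)
  show "x * y \<in> ?B"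
    unfolding bicommutant_def
  proof (intro CollectI conjI ballI impI)
    fix w assume w: "w \<in> Mn N" "\<forall>z\<in>Z. w * z = z * w"
    then have "w * x = x * w" "w * y = y * w" using comD x y by blast+
    then show "w * (x * y) = x * y * w" by (metis mult.assoc)
  qed (rule Mn_mult[OF xM yM])
  have "x * z = z * x" if "z \<in> Z" for z
    by (rule comD[symmetric, OF x]) (use that Z comm in auto)
  then show "x * y = y * x" by (rule comD[OF y xM])
next
  fix u x
  assume u: "(\<forall>n. u n \<in> bicommutant N Z) \<and> x \<in> Mn N \<and> (\<lambda>n. minf_norm (u n - x)) \<longlonglongrightarrow> 0"
  show "x \<in> bicommutant N Z"
    unfolding bicommutant_def
  proof (intro CollectI conjI ballI impI)
    fix y assume y: "y \<in> Mn N" "\<forall>z\<in>Z. y * z = z * y"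
    have "minf_norm (y * x - x * y) \<le> 2 * (minf_norm y * minf_norm (u n - x))" for n
    proof -
      have "y * u n = u n * y" using u y by (auto simp: bicommutant_def)
      then have "y * x - x * y = (u n - x) * y + y * (x - u n)" by (simp add: algebra_simps)
      then have "minf_norm (y * x - x * y) \<le> minf_norm ((u n - x) * y) + minf_norm (y * (x - u n))"
        by (simp only: minf_norm_triangle)
      also have "\<dots> \<le> minf_norm (u n - x) * minf_norm y + minf_norm y * minf_norm (x - u n)"
        by (intro add_mono minf_norm_mult)
      finally show ?thesis by (simp add: minf_norm_minus_commute[of x])
    qed
    moreover have "(\<lambda>n. 2 * (minf_norm y * minf_norm (u n - x))) \<longlonglongrightarrow> 2 * (minf_norm y * 0)"
      using u by (intro tendsto_intros) auto
    ultimately have "minf_norm (y * x - x * y) \<le> 2 * (minf_norm y * 0)"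
      by (meson LIMSEQ_le_const)
    then have "minf_norm (y * x - x * y) = 0"
      using minf_norm_nonneg[of "y * x - x * y"] by simp
    then show "y * x = x * y" by (simp add: minf_norm_eq_0)
  qed (use u in blast)
qed

section \<open>Quasitraces on positive and on commuting matrices\<close>

lemma quasitrace_star_mult_self:
  assumes "quasitrace_conditions minf_norm (Mn N) \<tau>" "x \<in> Mn N"
  shows "\<tau> (x\<^sup>\<star> * x) = \<tau> (x * x\<^sup>\<star>)"
  using assms by (auto simp: quasitrace_conditions_def)

lemma quasitrace_positive:
  assumes "quasitrace_conditions minf_norm (Mn N) \<tau>" "a \<in> Mn_positive N"
  shows "0 \<le> Re (\<tau> a)"
proof -
  obtain x where "x \<in> Mn N" "a = x\<^sup>\<star> * x" using assms(2) by (auto simp: Mn_positive_def)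
  then have "\<tau> a \<in> \<real>\<^sub>\<ge>\<^sub>0" using assms(1) unfolding quasitrace_conditions_def by blast
  then show ?thesis by (auto simp: nonneg_Reals_def)
qed

lemma quasitrace_linear:
  assumes "quasitrace_conditions minf_norm (Mn N) \<tau>"
    and "commutative_cstar_subalgebra minf_norm (Mn N) B"
  shows "x \<in> B \<Longrightarrow> y \<in> B \<Longrightarrow> \<tau> (x + y) = \<tau> x + \<tau> y" and "x \<in> B \<Longrightarrow> \<tau> (c *\<^sub>C x) = c * \<tau> x"
  using assms unfolding quasitrace_conditions_def by blast+

lemma quasitrace_sum:
  assumes q: "quasitrace_conditions minf_norm (Mn N) \<tau>"
    and B: "commutative_cstar_subalgebra minf_norm (Mn N) B"
    and f: "finite I" "\<And>i. i \<in> I \<Longrightarrow> f i \<in> B"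
  shows "\<tau> (\<Sum>i\<in>I. f i) = (\<Sum>i\<in>I. \<tau> (f i))"
proof -
  have 0: "0 \<in> B" and add: "\<And>x y. x \<in> B \<Longrightarrow> y \<in> B \<Longrightarrow> x + y \<in> B"
    using B by (auto simp: commutative_cstar_subalgebra_def)
  have "(\<Sum>i\<in>I. f i) \<in> B \<and> \<tau> (\<Sum>i\<in>I. f i) = (\<Sum>i\<in>I. \<tau> (f i))"
    using f
  proof (induction I rule: finite_induct)
    case empty
    then show ?case using 0 quasitrace_linear(1)[OF q B 0 0] by simp
  next
    case (insert i I)
    then show ?case using add quasitrace_linear(1)[OF q B] by simp
  qed
  then show ?thesis by simp
qed

lemma quasitrace_diff:
  assumes q: "quasitrace_conditions minf_norm (Mn N) \<tau>"
    and B: "commutative_cstar_subalgebra minf_norm (Mn N) B"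
    and "x \<in> B" "y \<in> B"
  shows "\<tau> (x - y) = \<tau> x - \<tau> y"
proof -
  have "x - y = x + (-1) *\<^sub>C y"
    by (rule minf_eqI) (simp add: scaleC_uminus_left scaleC_one)
  moreover have "(-1) *\<^sub>C y \<in> B" using B assms(4) by (auto simp: commutative_cstar_subalgebra_def)
  ultimately have "\<tau> (x - y) = \<tau> x + \<tau> ((-1) *\<^sub>C y)"
    using quasitrace_linear(1)[OF q B assms(3)] by (simp only:)
  then show ?thesis using quasitrace_linear(2)[OF q B assms(4), of "-1"] by simp
qed

text \<open>\<open>dim_fun\<close> is a \<open>lim\<close>, which is meaningful only for convergent
  sequences. Once a is scaled to a contraction its roots increase and stay below the unit, so their
  quasitraces converge; the factor s^(1/k) from the scaling tends to 1.\<close>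

lemma convergent_quasitrace_root:
  assumes q: "quasitrace_conditions minf_norm (Mn N) \<tau>" and a: "a \<in> Mn_positive N"
  shows "convergent (\<lambda>k. Re (\<tau> (positive_root k a)))"
proof -
  \<comment> \<open>Adding 1 keeps s positive when a = 0.\<close>
  define s where "s = norm (embed N a) + 1"
  have s: "0 < s" by (simp add: s_def add_nonneg_pos)
  define a' where "a' = complex_of_real (inverse s) *\<^sub>C a"
  have a': "a' \<in> Mn_positive N" unfolding a'_def using s by (intro Mn_positive_scaleC a) auto
  have "embed N a' = inverse s *\<^sub>R embed N a"
    using Mn_positive_in_Mn[OF a] s
    by (intro mprod_eqI) (auto simp: a'_def embed.rep_eq Mn_scaleC scaleC_zero_right intro!: minf_eqI)
  then have "norm (embed N a') = norm (embed N a) / s" using s by (simp add: field_simps)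
  also have "\<dots> \<le> 1" using s by (simp add: s_def)
  finally have le: "norm (embed N a') \<le> 1" .
  have aa': "a = complex_of_real s *\<^sub>C a'" using s by (simp add: a'_def minf_scaleC_scaleC minf_scaleC_one)
  define B where "B = bicommutant N {a'}"
  have B: "commutative_cstar_subalgebra minf_norm (Mn N) B"
    unfolding B_def
    by (rule bicommutant_commutative_cstar_subalgebra)
      (use Mn_positive_in_Mn[OF a'] Mn_positive_star[OF a'] in auto)
  define r where "r k = positive_root k a'" for k
  have rB: "r k \<in> B" if "1 \<le> k" for k
    using positive_root[OF a' that] Mn_positive_in_Mn by (auto simp: B_def bicommutant_def r_def)
  have oneB: "mone N \<in> B" unfolding B_def by (rule mone_in_bicommutant)
  \<comment> \<open>The index is shifted because the facts about roots start at order 1.\<close>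
  have "Re (\<tau> (r (Suc k))) \<le> Re (\<tau> (r (Suc (Suc k))))" for k
    using quasitrace_positive[OF q positive_root_mono(1)[OF a' le, of "Suc k"]]
      quasitrace_diff[OF q B rB[of "Suc (Suc k)"] rB[of "Suc k"]] by (simp add: r_def)
  moreover have "Re (\<tau> (r (Suc k))) \<le> Re (\<tau> (mone N))" for k
    using quasitrace_positive[OF q positive_root_mono(2)[OF a' le, of "Suc k"]]
      quasitrace_diff[OF q B oneB rB[of "Suc k"]] by (simp add: r_def)
  ultimately obtain L where "(\<lambda>k. Re (\<tau> (r (Suc k)))) \<longlonglongrightarrow> L"
    using incseq_convergent[of "\<lambda>k. Re (\<tau> (r (Suc k)))" "Re (\<tau> (mone N))"]
    unfolding incseq_Suc_iff by blast
  moreover have "(\<lambda>k. root (Suc k) s) \<longlonglongrightarrow> 1"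
    using LIMSEQ_root_const[OF s] by (rule LIMSEQ_Suc)
  ultimately have "(\<lambda>k. root (Suc k) s * Re (\<tau> (r (Suc k)))) \<longlonglongrightarrow> 1 * L"
    by (intro tendsto_mult)
  moreover have "\<tau> (positive_root (Suc k) a) = complex_of_real (root (Suc k) s) * \<tau> (r (Suc k))" for k
    unfolding aa' using s positive_root_scaleC[OF a', of s "Suc k"]
      quasitrace_linear(2)[OF q B rB[of "Suc k"]] by (simp add: r_def)
  ultimately have "(\<lambda>k. Re (\<tau> (positive_root (Suc k) a))) \<longlonglongrightarrow> L" by simp
  then show ?thesis unfolding convergent_def by (intro exI[of _ L]) (rule LIMSEQ_imp_Suc)
qed

section \<open>Block matrices\<close>

text \<open>The matrix e_pq \<otimes> x with blocks of size N: row i lies in block row i div N at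
  position i mod N. The guard \<open>0 < N\<close> rules out division by zero.\<close>

lift_definition block :: "nat \<Rightarrow> nat \<Rightarrow> nat \<Rightarrow> 'a::unital_cstar_algebra minf \<Rightarrow> 'a minf"
  is "\<lambda>N p q x i j. if 0 < N \<and> i div N = p \<and> j div N = q then x (i mod N) (j mod N) else 0"
proof -
  fix N p q :: nat and x :: "nat \<Rightarrow> nat \<Rightarrow> 'a"
  have "p < i div N" if "Suc p * N \<le> i" "0 < N" for p i
    using div_le_mono[OF that(1), of N] that(2) by simp
  then show "\<exists>n. \<forall>i j. n \<le> i \<or> n \<le> j \<longrightarrow>
      (if 0 < N \<and> i div N = p \<and> j div N = q then x (i mod N) (j mod N) else 0) = 0"
    by (intro exI[of _ "max (Suc p * N) (Suc q * N)"]) fastforce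
qed

lift_definition unblock :: "nat \<Rightarrow> nat \<Rightarrow> nat \<Rightarrow> 'a::unital_cstar_algebra minf \<Rightarrow> 'a minf"
  is "\<lambda>N p q x i j. if i < N \<and> j < N then x (p * N + i) (q * N + j) else 0"
  by (rename_tac N p q x, rule_tac x=N in exI) auto

lemma unblock_Mn: "unblock N p q x \<in> Mn N"
  by (auto simp: Mn_def unblock.rep_eq)

lemma block_Mn:
  assumes "p < n" "q < n"
  shows "block N p q x \<in> Mn (n * N)"
proof -
  have "n \<le> i div N" if "n * N \<le> i" "0 < N" for i
    using div_le_mono[OF that(1), of N] that(2) by simp
  then show ?thesis using assms by (fastforce simp: Mn_def block.rep_eq)
qed

lemma block_0_0: "x \<in> Mn N \<Longrightarrow> block N 0 0 x = x"
  by (rule minf_eqI) (use MnD[of x N] in \<open>auto simp: block.rep_eq div_eq_0_iff\<close>)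

lemma block_star: "(block N p q x)\<^sup>\<star> = block N q p (x\<^sup>\<star>)"
  by (rule minf_eqI) (auto simp: block.rep_eq star_zero)

text \<open>The rule for matrix units with coefficients: only the columns from q N to q N + N - 1 of
  the left factor can be nonzero, and they meet nonzero rows of the right factor only if q =
  q'.\<close>

lemma block_mult:
  assumes x: "x \<in> Mn N" and N: "1 \<le> N"
  shows "block N p q x * block N q' s y = (if q = q' then block N p s (x * y) else 0)"
proof (rule minf_eqI)
  fix i j
  define K where "K = Suc (max p q) * N"
  have b: "block N p q x \<in> Mn K" unfolding K_def by (rule block_Mn) auto
  have q: "Suc q * N \<le> K" by (simp add: K_def mult_le_mono1 max_def)
  have sub: "(\<lambda>l. q * N + l) ` {..<N} \<subseteq> {..<K}" using q by auto
  have zero: "entry (block N p q x) i k = 0" if "k \<notin> (\<lambda>l. q * N + l) ` {..<N}" for k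
  proof -
    have "k div N \<noteq> q"
    proof
      assume "k div N = q"
      then have "k = q * N + k mod N" by (metis div_mult_mod_eq)
      then show False using that N by (metis image_eqI lessThan_iff less_le_trans mod_less_divisor zero_less_one)
    qed
    then show ?thesis by (simp add: block.rep_eq)
  qed
  have "entry (block N p q x * block N q' s y) i j
      = (\<Sum>k<K. entry (block N p q x) i k * entry (block N q' s y) k j)"
    by (rule entry_times_left[OF b])
  also have "\<dots> = (\<Sum>k\<in>(\<lambda>l. q * N + l) ` {..<N}. entry (block N p q x) i k * entry (block N q' s y) k j)"
    using sub zero by (intro sum.mono_neutral_right) auto
  also have "\<dots> = (\<Sum>l<N. entry (block N p q x) i (q * N + l) * entry (block N q' s y) (q * N + l) j)"
    by (subst sum.reindex) (auto simp: inj_on_def)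
  also have "\<dots> = (\<Sum>l<N. if q = q' \<and> i div N = p \<and> j div N = s
      then entry x (i mod N) l * entry y l (j mod N) else 0)"
    using N by (intro sum.cong refl) (auto simp: block.rep_eq)
  also have "\<dots> = entry (if q = q' then block N p s (x * y) else 0) i j"
    using N by (auto simp: block.rep_eq entry_times_left[OF x])
  finally show "entry (block N p q x * block N q' s y) i j
      = entry (if q = q' then block N p s (x * y) else 0) i j" .
qed

lemma unblock_block:
  assumes x: "x \<in> Mn N"
  shows "unblock N p q (block N p' q' x) = (if p = p' \<and> q = q' then x else 0)"
  by (rule minf_eqI) (use MnD[OF x] in \<open>auto simp: unblock.rep_eq block.rep_eq not_less\<close>)

lemma unblock_diff: "unblock N p q (x - y) = unblock N p q x - unblock N p q y"
  by (rule minf_eqI) (simp add: unblock.rep_eq)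

lemma unblock_sum: "unblock N p q (\<Sum>i\<in>I. f i) = (\<Sum>i\<in>I. unblock N p q (f i))"
  by (rule minf_eqI) (auto simp: unblock.rep_eq intro!: sum.neutral[symmetric] sum.neutral)

lemma block_decomposition:
  assumes x: "x \<in> Mn (n * N)" and N: "1 \<le> N"
  shows "x = (\<Sum>p<n. \<Sum>q<n. block N p q (unblock N p q x))"
proof (rule minf_eqI)
  fix i j
  have "entry (\<Sum>p<n. \<Sum>q<n. block N p q (unblock N p q x)) i j
      = (\<Sum>p<n. \<Sum>q<n. if p = i div N \<and> q = j div N then entry x i j else 0)"
    unfolding entry_sum
    using N by (intro sum.cong refl) (auto simp: block.rep_eq unblock.rep_eq)
  also have "\<dots> = (\<Sum>p<n. if p = i div N then (\<Sum>q<n. if q = j div N then entry x i j else 0) else 0)"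
    by (intro sum.cong refl) auto
  also have "\<dots> = (if i div N < n \<and> j div N < n then entry x i j else 0)"
    by (auto simp: sum.delta)
  also have "\<dots> = entry x i j"
  proof -
    have "n * N \<le> i" if "\<not> i div N < n" for i
      using that N by (metis div_less_iff_less_mult less_le_trans not_le zero_less_one mult.commute)
    then show ?thesis using MnD[OF x, of i j] by auto
  qed
  finally show "entry x i j = entry (\<Sum>p<n. \<Sum>q<n. block N p q (unblock N p q x)) i j" by simp
qed

text \<open>The matrix \<open>x \<otimes> 1\<^sub>n\<close> for \<open>x \<in> M\<^sub>N(A)\<close>.\<close>

definition amplify :: "nat \<Rightarrow> nat \<Rightarrow> 'a::unital_cstar_algebra minf \<Rightarrow> 'a minf" where
  "amplify N n x = (\<Sum>p<n. block N p p x)"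

lemma amplify_mult:
  assumes x: "x \<in> Mn N" and N: "1 \<le> N"
  shows "amplify N n x * amplify N n y = amplify N n (x * y)"
proof -
  have "amplify N n x * amplify N n y = (\<Sum>p<n. \<Sum>q<n. if p = q then block N p q (x * y) else 0)"
    by (simp add: amplify_def sum_product block_mult[OF x N])
  then show ?thesis by (simp add: amplify_def sum.delta)
qed

lemma amplify_star: "(amplify N n x)\<^sup>\<star> = amplify N n (x\<^sup>\<star>)"
  by (simp add: amplify_def minf_star_sum block_star)

lemma amplify_Mn: "amplify N n x \<in> Mn (n * N)"
  unfolding amplify_def by (intro Mn_sum block_Mn) auto

lemma amplify_positive:
  assumes "a \<in> Mn_positive N" and N: "1 \<le> N"
  shows "amplify N n a \<in> minf_positive"
proof -
  obtain x where x: "x \<in> Mn N" "a = x\<^sup>\<star> * x" using assms(1) by (auto simp: Mn_positive_def)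
  then have "amplify N n a = (amplify N n x)\<^sup>\<star> * amplify N n x"
    by (simp add: amplify_star amplify_mult[OF Mn_star[OF x(1)] N])
  then show ?thesis by (auto simp: minf_positive_def)
qed

lemma amplify_power:
  assumes x: "x \<in> Mn N" and N: "1 \<le> N"
  shows "1 \<le> k \<Longrightarrow> minf_power k (amplify N n x) = amplify N n (minf_power k x)"
proof (induction k rule: dec_induct)
  case base
  show ?case by (simp add: minf_power_1)
next
  case (step k)
  then show ?case by (simp add: minf_power_Suc amplify_mult[OF x N])
qed

text \<open>The diagonal blocks commute, so the quasitrace is additive on them. Each has the value
  of r = h^* h: the matrix with h at block position (0, p) links the block at (p, p) to h h^* in the
  corner, and h itself links h h^* to r.\<close>

lemma quasitrace_amplify:
  assumes q: "\<And>n. quasitrace_conditions minf_norm (Mn n) \<tau>" and r: "r \<in> Mn_positive N" and N: "1 \<le> N"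
  shows "\<tau> (amplify N n r) = of_nat n * \<tau> r"
proof -
  obtain h where h: "h \<in> Mn N" "r = h\<^sup>\<star> * h" using r by (auto simp: Mn_positive_def)
  have rM: "r \<in> Mn N" by (rule Mn_positive_in_Mn[OF r])
  define Z where "Z = (\<lambda>p. block N p p r) ` {..<n}"
  have Z: "Z \<subseteq> Mn (n * N)" by (auto simp: Z_def intro: block_Mn)
  have B: "commutative_cstar_subalgebra minf_norm (Mn (n * N)) (bicommutant (n * N) Z)"
    by (rule bicommutant_commutative_cstar_subalgebra[OF Z])
      (auto simp: Z_def block_star Mn_positive_star[OF r] block_mult[OF rM N])
  have "\<tau> (block N p p r) = \<tau> r" if "p < n" for p
  proof -
    have hM: "block N 0 p h \<in> Mn (Suc p * N)" by (rule block_Mn) auto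
    have "\<tau> (block N p p r) = \<tau> ((block N 0 p h)\<^sup>\<star> * block N 0 p h)"
      by (simp add: block_star block_mult[OF Mn_star[OF h(1)] N] h(2))
    also have "\<dots> = \<tau> (block N 0 p h * (block N 0 p h)\<^sup>\<star>)"
      by (rule quasitrace_star_mult_self[OF q hM])
    also have "\<dots> = \<tau> (h * h\<^sup>\<star>)"
      by (simp add: block_star block_mult[OF h(1) N] Mn_star Mn_mult h(1) block_0_0)
    also have "\<dots> = \<tau> r"
      unfolding h(2) by (rule quasitrace_star_mult_self[OF q h(1), symmetric])
    finally show ?thesis .
  qed
  moreover have "\<tau> (amplify N n r) = (\<Sum>p<n. \<tau> (block N p p r))"
    unfolding amplify_def
    by (rule quasitrace_sum[OF q B]) (auto intro!: subset_bicommutant[OF Z], simp add: Z_def)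
  ultimately show ?thesis by simp
qed

text \<open>Amplification respects powers and positivity, so by uniqueness it commutes with taking
  roots. The factor n then passes through the limit, which exists by
  \<open>convergent_quasitrace_root\<close>.\<close>

lemma dim_fun_amplify:
  assumes q: "\<And>n. quasitrace_conditions minf_norm (Mn n) \<tau>" and a: "a \<in> Mn_positive N" and N: "1 \<le> N"
  shows "dim_fun \<tau> (amplify N n a) = real n * dim_fun \<tau> a"
proof -
  have "positive_root k (amplify N n a) = amplify N n (positive_root k a)" if k: "1 \<le> k" for k
  proof (rule positive_root_eqI[OF _ k])
    note r = positive_root(1,2)[OF a k]
    show "amplify N n (positive_root k a) \<in> minf_positive" by (rule amplify_positive[OF r(1) N])
    show "minf_power k (amplify N n (positive_root k a)) = amplify N n a"
      by (simp only: amplify_power[OF Mn_positive_in_Mn[OF r(1)] N k] r(2))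
  qed
  then have ev: "Re (\<tau> (positive_root k (amplify N n a))) = real n * Re (\<tau> (positive_root k a))"
    if "1 \<le> k" for k
    using that quasitrace_amplify[OF q positive_root(1)[OF a that] N, of n] by simp
  have "(\<lambda>k. Re (\<tau> (positive_root k a))) \<longlonglongrightarrow> dim_fun \<tau> a"
    unfolding dim_fun_def using convergent_quasitrace_root[OF q a] by (simp add: convergent_LIMSEQ_iff)
  then have "(\<lambda>k. real n * Re (\<tau> (positive_root k a))) \<longlonglongrightarrow> real n * dim_fun \<tau> a"
    by (intro tendsto_intros)
  then have "(\<lambda>k. Re (\<tau> (positive_root k (amplify N n a)))) \<longlonglongrightarrow> real n * dim_fun \<tau> a"
    by (rule Lim_transform_eventually)
      (use ev in \<open>auto simp: eventually_sequentially intro!: exI[of _ 1]\<close>)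
  then show ?thesis unfolding dim_fun_def[of _ "amplify N n a"] by (rule limI)
qed

section \<open>Approximately central matrix units\<close>

lemma norm_unitary: "u \<in> unitary_group \<Longrightarrow> norm u = 1"
  using norm_star_mult_self[of u] by (simp add: unitary_group_def power2_eq_1_iff)
    (smt (verit) norm_ge_zero)

lemma norm_projection_le: "is_projection p \<Longrightarrow> norm p \<le> 1"
  using norm_star_mult_self[of p] by (cases "p = 0") (auto simp: is_projection_def power2_eq_square)

lemma unitary_group_mult: "u \<in> unitary_group \<Longrightarrow> v \<in> unitary_group \<Longrightarrow> u * v \<in> unitary_group"
  unfolding unitary_group_def mem_Collect_eq star_mult
  by (metis mult.assoc mult.left_neutral)

lemma unitary_group_star: "u \<in> unitary_group \<Longrightarrow> u\<^sup>\<star> \<in> unitary_group"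
  by (simp add: unitary_group_def star_star)

lemma norm_mult_mult_le:
  fixes u v x :: "'a::real_normed_algebra"
  assumes "norm u \<le> 1" "norm v \<le> 1"
  shows "norm (u * x * v) \<le> norm x"
proof -
  have "norm (u * x * v) \<le> norm u * norm x * norm v"
    by (rule order_trans[OF norm_mult_ineq mult_right_mono[OF norm_mult_ineq]]) simp
  also have "\<dots> \<le> 1 * norm x * 1"
    using assms by (intro mult_mono) auto
  finally show ?thesis by simp
qed

text \<open>The unitaries \<open>z\<close> implement the action on \<open>F\<close>, the projections \<open>e\<close> almost commute with \<open>F\<close>
  and \<open>z\<close>, and the unitaries \<open>z'\<close> implement the action on \<open>F\<close> and \<open>e\<close>. Then \<open>w\<^sub>g = z'\<^sub>g z\<^sub>g\<^sup>\<star>\<close> almost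
  commutes with \<open>F\<close>, because the two implementations cancel, and conjugates \<open>e\<^sub>1\<close> almost to \<open>e\<^sub>g\<close>.\<close>

lemma approximately_central_columns:
  fixes \<alpha> :: "'g \<Rightarrow> 'a::unital_cstar_algebra \<Rightarrow> 'a" and G :: "('g, 'm) monoid_scheme" and F :: "'a set"
  assumes G: "group G" and fin: "finite (carrier G)"
    and act: "cstar_action G \<alpha>" and rok: "rokhlin_property G \<alpha>" and sai: "strictly_approximately_inner G \<alpha>"
    and F: "finite F" and \<epsilon>: "0 < \<epsilon>"
  obtains e v where "norm e \<le> 1" "e\<^sup>\<star> = e"
    and "\<And>g. g \<in> carrier G \<Longrightarrow> norm (v g) \<le> 1"
    and "\<And>g. g \<in> carrier G \<Longrightarrow> v g * e = v g"
    and "\<And>a. a \<in> F \<Longrightarrow> norm (e * a - a * e) \<le> \<epsilon>"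
    and "\<And>g a. g \<in> carrier G \<Longrightarrow> a \<in> F \<Longrightarrow> norm (v g * a - a * v g) \<le> \<epsilon>"
    and "\<And>g h. g \<in> carrier G \<Longrightarrow> h \<in> carrier G \<Longrightarrow>
           norm ((v g)\<^sup>\<star> * v h - (if g = h then e else 0)) \<le> \<epsilon>"
    and "norm ((\<Sum>g\<in>carrier G. v g * (v g)\<^sup>\<star>) - 1) \<le> \<epsilon>"
proof -
  interpret G: group G by (rule G)
  interpret act: group_action G UNIV \<alpha> using act by (simp add: cstar_action_def)
  define n where "n = card (carrier G)"
  \<comment> \<open>Orthogonality of the columns will cost \<open>6 * \<delta>\<close>, and the sum
    of their range projections 3 n \<delta>; this choice covers both.\<close>
  define \<delta> where "\<delta> = \<epsilon> / (6 * (real n + 1))"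
  have \<delta>: "0 < \<delta>" using \<epsilon> by (simp add: \<delta>_def)
  have "6 * (real n + 1) * \<delta> = \<epsilon>"
    unfolding \<delta>_def by (rule nonzero_mult_div_cancel_left[of "6 * (real n + 1)", folded times_divide_eq_right]) simp
  then have \<delta>\<epsilon>: "6 * \<delta> + 6 * real n * \<delta> = \<epsilon>" by (simp add: algebra_simps)
  have \<delta>6: "6 * \<delta> \<le> \<epsilon>" "real n * (3 * \<delta>) \<le> \<epsilon>"
    using \<delta> by (simp_all flip: \<delta>\<epsilon>)
  \<comment> \<open>All translates are included, because the implementations are applied to the
    preimage of a under \<alpha>_g and not to a itself.\<close>
  define F1 where "F1 = (\<lambda>(h, a). \<alpha> h a) ` (carrier G \<times> F)"
  have F1: "finite F1" using fin F by (simp add: F1_def)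
  obtain z where z: "\<And>g. g \<in> carrier G \<Longrightarrow> z g \<in> unitary_group"
    and z_impl: "\<And>g a. g \<in> carrier G \<Longrightarrow> a \<in> F1 \<Longrightarrow> norm (\<alpha> g a - z g * a * (z g)\<^sup>\<star>) < \<delta>"
    using sai[unfolded strictly_approximately_inner_def, rule_format, of F1 \<delta>] F1 \<delta> by blast
  \<comment> \<open>The projections must almost commute with z as well, so that conjugation by the
    adjoint of z_g almost fixes the projection at the identity.\<close>
  have F2: "finite (F \<union> z ` carrier G)" using F fin by simp
  obtain e where proj: "\<And>g. g \<in> carrier G \<Longrightarrow> is_projection (e g)"
    and orth: "\<And>g h. g \<in> carrier G \<Longrightarrow> h \<in> carrier G \<Longrightarrow> g \<noteq> h \<Longrightarrow> e g * e h = 0"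
    and shift: "\<And>g h. g \<in> carrier G \<Longrightarrow> h \<in> carrier G \<Longrightarrow> norm (\<alpha> g (e h) - e (g \<otimes>\<^bsub>G\<^esub> h)) < \<delta>"
    and e_comm: "\<And>g a. g \<in> carrier G \<Longrightarrow> a \<in> F \<union> z ` carrier G \<Longrightarrow> norm (e g * a - a * e g) < \<delta>"
    and sum: "(\<Sum>g \<in> carrier G. e g) = 1"
  proof -
    have "\<exists>e :: 'g \<Rightarrow> 'a. (\<forall>g \<in> carrier G. is_projection (e g)) \<and>
        (\<forall>g \<in> carrier G. \<forall>h \<in> carrier G. g \<noteq> h \<longrightarrow> e g * e h = 0) \<and>
        (\<forall>g \<in> carrier G. \<forall>h \<in> carrier G. norm (\<alpha> g (e h) - e (g \<otimes>\<^bsub>G\<^esub> h)) < \<delta>) \<and>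
        (\<forall>g \<in> carrier G. \<forall>a \<in> F \<union> z ` carrier G. norm (e g * a - a * e g) < \<delta>) \<and>
        (\<Sum>g \<in> carrier G. e g) = 1" (is "\<exists>e. ?P e")
      by (rule rok[unfolded rokhlin_property_def, rule_format]) (use F2 \<delta> in simp)
    then obtain e where "?P e" by (rule exE)
    then show thesis by (intro that[of e]) (simp_all add: less_imp_le)
  qed
  define p where "p = e \<one>\<^bsub>G\<^esub>"
  \<comment> \<open>Now p is included, so that z'_g carries it close to \<alpha>_g(p), which is
    close to e_g.\<close>
  have F3: "finite (insert p F1)" using F1 by simp
  obtain z' where z': "\<And>g. g \<in> carrier G \<Longrightarrow> z' g \<in> unitary_group"
    and z'_impl: "\<And>g a. g \<in> carrier G \<Longrightarrow> a \<in> insert p F1 \<Longrightarrow> norm (\<alpha> g a - z' g * a * (z' g)\<^sup>\<star>) < \<delta>"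
    using sai[unfolded strictly_approximately_inner_def, rule_format, of "insert p F1" \<delta>] F3 \<delta> by blast
  define w where "w g = z' g * (z g)\<^sup>\<star>" for g
  define v where "v g = w g * p" for g
  have p: "p\<^sup>\<star> = p" "p * p = p" "norm p \<le> 1"
    using proj[of "\<one>\<^bsub>G\<^esub>"] norm_projection_le by (auto simp: p_def is_projection_def)
  have w: "w g \<in> unitary_group" if "g \<in> carrier G" for g
    unfolding w_def using that by (intro unitary_group_mult unitary_group_star z z')
  have ww: "(w g)\<^sup>\<star> * w g = 1" "w g * (w g)\<^sup>\<star> = 1" "norm (w g) \<le> 1" "norm ((w g)\<^sup>\<star>) \<le> 1"
    if "g \<in> carrier G" for g
    using w[OF that] norm_unitary[OF w[OF that]] by (auto simp: unitary_group_def)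
  have zz: "(z g)\<^sup>\<star> * z g = 1" "norm (z g) \<le> 1" "norm (z' g) \<le> 1" if "g \<in> carrier G" for g
    using z[OF that] norm_unitary[OF z[OF that]] norm_unitary[OF z'[OF that]] by (auto simp: unitary_group_def)
  have w_comm: "norm (w g * a - a * w g) \<le> 2 * \<delta>" if g: "g \<in> carrier G" and a: "a \<in> F" for g a
  proof -
    \<comment> \<open>Since \<alpha>_g(x) = a, both z_g x z_g^* and z'_g x z'_g^* are close to a,
      and conjugation by w_g carries the first to the second exactly.\<close>
    define x where "x = \<alpha> (inv\<^bsub>G\<^esub> g) a"
    have x: "x \<in> F1" using g a by (auto simp: x_def F1_def)
    have "\<alpha> g x = \<alpha> (g \<otimes>\<^bsub>G\<^esub> inv\<^bsub>G\<^esub> g) a"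
      unfolding x_def using g by (intro act.composition_rule[symmetric]) auto
    also have "\<dots> = a" using g act.id_eq_one by (metis G.r_inv UNIV_I restrict_apply)
    finally have ax: "\<alpha> g x = a" .
    have 1: "norm (w g * (a - z g * x * (z g)\<^sup>\<star>) * (w g)\<^sup>\<star>) \<le> \<delta>"
      using norm_mult_mult_le[OF ww(3,4)[OF g]] z_impl[OF g x] ax by (meson less_imp_le order_trans)
    have 2: "norm (z' g * x * (z' g)\<^sup>\<star> - a) \<le> \<delta>"
      using z'_impl[OF g, of x] x ax by (simp add: norm_minus_commute)
    have eq: "w g * a * (w g)\<^sup>\<star> - a
        = w g * (a - z g * x * (z g)\<^sup>\<star>) * (w g)\<^sup>\<star> + (z' g * x * (z' g)\<^sup>\<star> - a)"
    proof -
      have "w g * (z g * x * (z g)\<^sup>\<star>) * (w g)\<^sup>\<star>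
          = z' g * ((z g)\<^sup>\<star> * z g) * x * ((z g)\<^sup>\<star> * z g) * (z' g)\<^sup>\<star>"
        by (simp add: w_def star_mult star_star mult.assoc)
      then show ?thesis by (simp add: zz(1)[OF g] algebra_simps)
    qed
    have "norm (w g * a * (w g)\<^sup>\<star> - a) \<le> 2 * \<delta>"
      unfolding eq by (rule order_trans[OF norm_triangle_ineq]) (use 1 2 in linarith)
    moreover have "w g * a - a * w g = 1 * (w g * a * (w g)\<^sup>\<star> - a) * w g"
      by (simp add: left_diff_distrib mult.assoc ww[OF g])
    ultimately show ?thesis
      using norm_mult_mult_le[of "1::'a" "w g" "w g * a * (w g)\<^sup>\<star> - a"] ww[OF g] by simp
  qed
  have w_shift: "norm (w g * p * (w g)\<^sup>\<star> - e g) \<le> 3 * \<delta>" if g: "g \<in> carrier G" for g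
  proof -
    have "norm (z' g * ((z g)\<^sup>\<star> * (p * z g - z g * p) * 1) * (z' g)\<^sup>\<star>) \<le> norm (p * z g - z g * p)"
      by (rule order_trans[OF norm_mult_mult_le norm_mult_mult_le]) (use zz[OF g] in auto)
    also have "\<dots> \<le> \<delta>" using e_comm[of "\<one>\<^bsub>G\<^esub>" "z g"] g by (simp add: p_def less_imp_le)
    finally have 1: "norm (z' g * ((z g)\<^sup>\<star> * (p * z g - z g * p) * 1) * (z' g)\<^sup>\<star>) \<le> \<delta>" .
    have 2: "norm (z' g * p * (z' g)\<^sup>\<star> - \<alpha> g p) \<le> \<delta>"
      using z'_impl[OF g, of p] by (simp add: norm_minus_commute)
    have 3: "norm (\<alpha> g p - e g) \<le> \<delta>"
      using shift[OF g G.one_closed] g by (simp add: p_def)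
    have eq: "w g * p * (w g)\<^sup>\<star> - e g = z' g * ((z g)\<^sup>\<star> * (p * z g - z g * p) * 1) * (z' g)\<^sup>\<star>
        + (z' g * p * (z' g)\<^sup>\<star> - \<alpha> g p) + (\<alpha> g p - e g)"
    proof -
      have "(z g)\<^sup>\<star> * (p * z g - z g * p) * 1 = (z g)\<^sup>\<star> * p * z g - ((z g)\<^sup>\<star> * z g) * p"
        by (simp add: right_diff_distrib mult.assoc)
      also have "\<dots> = (z g)\<^sup>\<star> * p * z g - p" by (simp add: zz[OF g])
      finally show ?thesis by (simp add: w_def star_mult star_star algebra_simps)
    qed
    have "norm (w g * p * (w g)\<^sup>\<star> - e g) \<le> \<delta> + \<delta> + \<delta>"
      unfolding eq by (intro order_trans[OF norm_triangle_ineq] add_mono 1 2 3)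
    then show ?thesis by simp
  qed
  show thesis
  proof (rule that[of p v])
    show "norm p \<le> 1" "p\<^sup>\<star> = p" by (fact p)+
    fix g assume g: "g \<in> carrier G"
    show "v g * p = v g" by (simp add: v_def mult.assoc p)
    show "norm (v g) \<le> 1"
      unfolding v_def using norm_mult_mult_le[of 1 p "w g"] p ww[OF g] by simp
  next
    fix a assume a: "a \<in> F"
    then show "norm (p * a - a * p) \<le> \<epsilon>"
      using e_comm[of "\<one>\<^bsub>G\<^esub>" a] \<delta> \<delta>6 by (simp add: p_def)
    fix g assume g: "g \<in> carrier G"
    have eq: "v g * a - a * v g = w g * (p * a - a * p) * 1 + 1 * (w g * a - a * w g) * p"
      by (simp add: v_def algebra_simps)
    have 1: "norm (w g * (p * a - a * p) * 1) \<le> \<delta>"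
      using norm_mult_mult_le[of "w g" 1 "p * a - a * p"] ww[OF g] e_comm[of "\<one>\<^bsub>G\<^esub>" a] a
      by (simp add: p_def)
    have 2: "norm (1 * (w g * a - a * w g) * p) \<le> 2 * \<delta>"
      using norm_mult_mult_le[of 1 p "w g * a - a * w g"] p(3) w_comm[OF g a] by simp
    have "norm (v g * a - a * v g) \<le> \<delta> + 2 * \<delta>"
      unfolding eq by (intro order_trans[OF norm_triangle_ineq] add_mono 1 2)
    then show "norm (v g * a - a * v g) \<le> \<epsilon>" using \<delta> \<delta>6 by simp
  next
    fix g h assume g: "g \<in> carrier G" and h: "h \<in> carrier G"
    show "norm ((v g)\<^sup>\<star> * v h - (if g = h then p else 0)) \<le> \<epsilon>"
    proof (cases "g = h")
      case True
      have "(v h)\<^sup>\<star> * v h = p * ((w h)\<^sup>\<star> * w h) * p" by (simp add: v_def star_mult p(1) mult.assoc)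
      also have "\<dots> = p" by (simp add: ww[OF h] p)
      finally show ?thesis using True \<epsilon> by simp
    next
      case False
      \<comment> \<open>These are the range projections, each within \<open>3 * \<delta>\<close> of
        a Rokhlin projection. Up to unitaries v_g^* v_h is \<open>?P g * ?P h\<close>, which is
        small because e_g e_h = 0.\<close>
      let ?P = "\<lambda>g. w g * p * (w g)\<^sup>\<star>"
      have "(v g)\<^sup>\<star> * v h = ((w g)\<^sup>\<star> * w g) * p * (w g)\<^sup>\<star> * w h * p * ((w h)\<^sup>\<star> * w h)"
        by (simp add: v_def star_mult p(1) mult.assoc ww(1)[OF g] ww(1)[OF h])
      also have "\<dots> = (w g)\<^sup>\<star> * (?P g * ?P h) * w h" by (simp add: mult.assoc)
      finally have "norm ((v g)\<^sup>\<star> * v h) \<le> norm (?P g * ?P h)"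
        using norm_mult_mult_le[of "(w g)\<^sup>\<star>" "w h" "?P g * ?P h"] ww[OF g] ww[OF h] by simp
      also have "?P g * ?P h = 1 * (?P g - e g) * ?P h + e g * (?P h - e h) * 1"
        using orth[OF g h False] by (simp add: algebra_simps)
      also have "norm \<dots> \<le> 3 * \<delta> + 3 * \<delta>"
      proof (rule order_trans[OF norm_triangle_ineq add_mono])
        have "norm (?P h) \<le> 1" using norm_mult_mult_le[of "w h" "(w h)\<^sup>\<star>" p] ww[OF h] p(3) by simp
        then show "norm (1 * (?P g - e g) * ?P h) \<le> 3 * \<delta>"
          using norm_mult_mult_le[of 1 "?P h" "?P g - e g"] w_shift[OF g] by simp
        show "norm (e g * (?P h - e h) * 1) \<le> 3 * \<delta>"
          using norm_mult_mult_le[of "e g" 1 "?P h - e h"] w_shift[OF h] norm_projection_le[OF proj[OF g]]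
          by simp
      qed
      finally show ?thesis using False \<delta>6 by simp
    qed
  next
    have "(\<Sum>g\<in>carrier G. v g * (v g)\<^sup>\<star>) - 1 = (\<Sum>g\<in>carrier G. w g * p * (w g)\<^sup>\<star> - e g)"
    proof -
      have "v g * (v g)\<^sup>\<star> = w g * (p * p) * (w g)\<^sup>\<star>" for g
        by (simp add: v_def star_mult p(1) mult.assoc)
      then show ?thesis by (simp add: p(2) sum_subtractf sum)
    qed
    also have "norm \<dots> \<le> (\<Sum>g\<in>carrier G. 3 * \<delta>)"
      by (rule sum_norm_le) (rule w_shift)
    also have "\<dots> \<le> \<epsilon>" using \<delta>6(2) by (simp add: n_def)
    finally show "norm ((\<Sum>g\<in>carrier G. v g * (v g)\<^sup>\<star>) - 1) \<le> \<epsilon>" .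
  qed
qed

section \<open>Asymptotically equal sequences\<close>

text \<open>For bounded sequences this is equality modulo null sequences. Used as a relation it
  avoids both the quotient algebra and explicit error terms; boundedness is supplied separately by
  \<open>Bseq\<close> where products occur.\<close>

definition asymp_eq :: "(nat \<Rightarrow> 'a::real_normed_vector) \<Rightarrow> (nat \<Rightarrow> 'a) \<Rightarrow> bool" where
  "asymp_eq x y \<longleftrightarrow> (\<lambda>m. x m - y m) \<longlonglongrightarrow> 0"

lemma asymp_eq_refl: "asymp_eq x x"
  by (simp add: asymp_eq_def)

lemma asymp_eq_sym: "asymp_eq x y \<Longrightarrow> asymp_eq y x"
  unfolding asymp_eq_def by (drule tendsto_minus) simp

lemma asymp_eq_trans [trans]: "asymp_eq x y \<Longrightarrow> asymp_eq y z \<Longrightarrow> asymp_eq x z"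
  unfolding asymp_eq_def by (drule (1) tendsto_add) simp

lemma asymp_eq_add: "asymp_eq x y \<Longrightarrow> asymp_eq x' y' \<Longrightarrow> asymp_eq (\<lambda>m. x m + x' m) (\<lambda>m. y m + y' m)"
  unfolding asymp_eq_def by (drule (1) tendsto_add) (simp add: algebra_simps)

lemma asymp_eq_sum:
  "(\<And>i. i \<in> I \<Longrightarrow> asymp_eq (x i) (y i)) \<Longrightarrow> asymp_eq (\<lambda>m. \<Sum>i\<in>I. x i m) (\<lambda>m. \<Sum>i\<in>I. y i m)"
  by (induction I rule: infinite_finite_induct) (auto simp: asymp_eq_refl intro: asymp_eq_add)

lemma Bseq_times:
  fixes x y :: "nat \<Rightarrow> 'a::real_normed_algebra"
  assumes "Bseq x" "Bseq y"
  shows "Bseq (\<lambda>m. x m * y m)"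
proof -
  obtain K L where "\<And>m. norm (x m) \<le> K" "0 < K" "\<And>m. norm (y m) \<le> L"
    using assms unfolding Bseq_def by blast
  then have "norm (x m * y m) \<le> K * L" for m
    by (intro order_trans[OF norm_mult_ineq] mult_mono) auto
  then show ?thesis by (rule BseqI')
qed

lemma asymp_eq_mult_mult:
  fixes x y z w :: "nat \<Rightarrow> 'a::real_normed_algebra"
  assumes xy: "asymp_eq x y" and z: "Bseq z" and w: "Bseq w"
  shows "asymp_eq (\<lambda>m. z m * x m * w m) (\<lambda>m. z m * y m * w m)"
proof -
  have "Zfun (\<lambda>m. x m - y m) sequentially"
    using xy by (simp add: asymp_eq_def tendsto_Zfun_iff)
  then have "Zfun (\<lambda>m. z m * (x m - y m)) sequentially"
    by (rule bounded_bilinear.Bfun_prod_Zfun[OF bounded_bilinear_mult z])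
  then have "Zfun (\<lambda>m. z m * (x m - y m) * w m) sequentially"
    by (rule bounded_bilinear.Zfun_prod_Bfun[OF bounded_bilinear_mult _ w])
  then show ?thesis by (simp add: asymp_eq_def tendsto_Zfun_iff algebra_simps)
qed

lemma Bseq_star: "Bseq x \<Longrightarrow> Bseq (\<lambda>m. (x m :: 'a::unital_cstar_algebra)\<^sup>\<star>)"
  by (simp add: Bseq_def)

lemma asymp_eq_star:
  fixes x y :: "nat \<Rightarrow> 'a::unital_cstar_algebra"
  shows "asymp_eq x y \<Longrightarrow> asymp_eq (\<lambda>m. (x m)\<^sup>\<star>) (\<lambda>m. (y m)\<^sup>\<star>)"
  unfolding asymp_eq_def by (drule tendsto_star) (simp add: star_diff star_zero)

text \<open>If \<open>v\<^sub>p\<close> is asymptotically the \<open>p\<close>-th column of a system of central matrix units, then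
  \<open>\<Sum> v\<^sub>p c\<^sub>p\<^sub>q v\<^sub>q\<^sup>\<star>\<close> behaves like the matrix \<open>(c\<^sub>p\<^sub>q)\<close>.\<close>

lemma asymp_eq_matrix_conjugation:
  fixes V :: "'i \<Rightarrow> nat \<Rightarrow> 'a::unital_cstar_algebra" and E :: "nat \<Rightarrow> 'a"
    and C :: "'i \<Rightarrow> 'i \<Rightarrow> 'a" and a b u :: 'a
  assumes I: "finite I"
    and bV: "\<And>p. p \<in> I \<Longrightarrow> Bseq (V p)" and bE: "Bseq E"
    and E: "\<And>m. (E m)\<^sup>\<star> = E m" and VE: "\<And>p m. p \<in> I \<Longrightarrow> V p m * E m = V p m"
    and EC: "\<And>p q. p \<in> I \<Longrightarrow> q \<in> I \<Longrightarrow> asymp_eq (\<lambda>m. E m * C p q) (\<lambda>m. C p q * E m)"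
    and Va: "\<And>p. p \<in> I \<Longrightarrow> asymp_eq (\<lambda>m. V p m * a) (\<lambda>m. a * V p m)"
    and Vb: "\<And>p. p \<in> I \<Longrightarrow> asymp_eq (\<lambda>m. V p m * b) (\<lambda>m. b * V p m)"
    and VV: "\<And>p q. p \<in> I \<Longrightarrow> q \<in> I \<Longrightarrow>
      asymp_eq (\<lambda>m. (V p m)\<^sup>\<star> * V q m) (\<lambda>m. if p = q then E m else 0)"
    and u: "asymp_eq (\<lambda>m. \<Sum>p\<in>I. V p m * (V p m)\<^sup>\<star>) (\<lambda>_. u)" and au: "a * u = a"
    and b: "b\<^sup>\<star> = b"
  defines "D \<equiv> \<lambda>m. \<Sum>x\<in>I \<times> I. V (fst x) m * C (fst x) (snd x) * (V (snd x) m)\<^sup>\<star>"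
    and "R \<equiv> \<lambda>p s. (\<Sum>q\<in>I. C p q * b * (C s q)\<^sup>\<star>) - (if p = s then a else 0)"
  shows "asymp_eq (\<lambda>m. D m * b * (D m)\<^sup>\<star>) (\<lambda>m. a + (\<Sum>p\<in>I. \<Sum>s\<in>I. V p m * R p s * (V s m)\<^sup>\<star>))"
proof -
  have bVs: "Bseq (\<lambda>m. (V p m)\<^sup>\<star>)" if "p \<in> I" for p by (rule Bseq_star[OF bV[OF that]])
  have Vsb: "asymp_eq (\<lambda>m. (V p m)\<^sup>\<star> * b) (\<lambda>m. b * (V p m)\<^sup>\<star>)" if "p \<in> I" for p
    using asymp_eq_star[OF Vb[OF that]]
    unfolding star_mult b by (rule asymp_eq_sym)
  have ECs: "asymp_eq (\<lambda>m. E m * (C p q)\<^sup>\<star>) (\<lambda>m. (C p q)\<^sup>\<star> * E m)" if "p \<in> I" "q \<in> I" for p q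
    using asymp_eq_star[OF EC[OF that]]
    unfolding star_mult E by (rule asymp_eq_sym)
  have EVs: "E m * (V p m)\<^sup>\<star> = (V p m)\<^sup>\<star>" if "p \<in> I" for p m
    using VE[OF that, of m] by (metis E star_mult)
  define h where "h p q s m = V p m * (C p q * b * (C s q)\<^sup>\<star>) * (V s m)\<^sup>\<star>" for p q s m
  define T where "T p q s t m = V p m * C p q * ((V q m)\<^sup>\<star> * b) * (V t m * (C s t)\<^sup>\<star> * (V s m)\<^sup>\<star>)" for p q s t m
  \<comment> \<open>V_q^* moves past b; then V_q^* V_t contracts to E or 0; E moves past the adjoint
    of C and is absorbed by V_s^*.\<close>
  have T: "asymp_eq (T p q s t) (\<lambda>m. if q = t then h p q s m else 0)"
    if p: "p \<in> I" and q: "q \<in> I" and s: "s \<in> I" and t: "t \<in> I" for p q s t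
  proof -
    note bd = Bseq_times Bfun_const bV bVs p q s t
    have "asymp_eq (T p q s t)
        (\<lambda>m. V p m * C p q * (b * (V q m)\<^sup>\<star>) * (V t m * (C s t)\<^sup>\<star> * (V s m)\<^sup>\<star>))"
      unfolding T_def by (rule asymp_eq_mult_mult[OF Vsb[OF q]]) (intro bd)+
    also have "\<dots> = (\<lambda>m. (V p m * C p q * b) * ((V q m)\<^sup>\<star> * V t m) * ((C s t)\<^sup>\<star> * (V s m)\<^sup>\<star>))"
      by (simp add: mult.assoc)
    also have "asymp_eq \<dots> (\<lambda>m. (V p m * C p q * b) * (if q = t then E m else 0) * ((C s t)\<^sup>\<star> * (V s m)\<^sup>\<star>))"
      by (rule asymp_eq_mult_mult[OF VV[OF q t]]) (intro bd)+
    also have "asymp_eq \<dots> (\<lambda>m. if q = t then h p q s m else 0)"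
    proof (cases "q = t")
      case True
      have "asymp_eq (\<lambda>m. (V p m * C p q * b) * (E m * (C s t)\<^sup>\<star>) * (V s m)\<^sup>\<star>)
          (\<lambda>m. (V p m * C p q * b) * ((C s t)\<^sup>\<star> * E m) * (V s m)\<^sup>\<star>)"
        by (rule asymp_eq_mult_mult[OF ECs[OF s t]]) (intro bd)+
      also have "\<dots> = h p q s"
        by (simp add: fun_eq_iff h_def mult.assoc EVs[OF s] True)
      finally show ?thesis using True by (simp add: mult.assoc)
    qed (simp add: asymp_eq_refl)
    finally show ?thesis .
  qed
  have expand: "D m * b * (D m)\<^sup>\<star> = (\<Sum>x\<in>I \<times> I. \<Sum>y\<in>I \<times> I. T (fst x) (snd x) (fst y) (snd y) m)" for m
  proof -
    have "D m * b = (\<Sum>x\<in>I \<times> I. V (fst x) m * C (fst x) (snd x) * (V (snd x) m)\<^sup>\<star> * b)"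
      unfolding D_def by (rule sum_distrib_right)
    moreover have "(D m)\<^sup>\<star> = (\<Sum>y\<in>I \<times> I. V (snd y) m * (C (fst y) (snd y))\<^sup>\<star> * (V (fst y) m)\<^sup>\<star>)"
      unfolding D_def star_sum by (simp add: star_mult star_star mult.assoc)
    ultimately show ?thesis
      unfolding T_def by (simp only: sum_product) (simp add: mult.assoc)
  qed
  have "asymp_eq (\<lambda>m. \<Sum>x\<in>I \<times> I. \<Sum>y\<in>I \<times> I. T (fst x) (snd x) (fst y) (snd y) m)
      (\<lambda>m. \<Sum>x\<in>I \<times> I. \<Sum>y\<in>I \<times> I. if snd x = snd y then h (fst x) (snd x) (fst y) m else 0)"
    by (intro asymp_eq_sum T) auto
  moreover have "(\<Sum>x\<in>I \<times> I. \<Sum>y\<in>I \<times> I. if snd x = snd y then h (fst x) (snd x) (fst y) m else 0)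
      = (\<Sum>p\<in>I. V p m * a * (V p m)\<^sup>\<star>) + (\<Sum>p\<in>I. \<Sum>s\<in>I. V p m * R p s * (V s m)\<^sup>\<star>)" for m
  proof -
    have "(\<Sum>x\<in>I \<times> I. \<Sum>y\<in>I \<times> I. if snd x = snd y then h (fst x) (snd x) (fst y) m else 0)
        = (\<Sum>p\<in>I. \<Sum>q\<in>I. \<Sum>s\<in>I. \<Sum>t\<in>I. if q = t then h p q s m else 0)"
    proof -
      have "(\<Sum>x\<in>I \<times> I. f x) = (\<Sum>p\<in>I. \<Sum>q\<in>I. f (p, q))" for f :: "'i \<times> 'i \<Rightarrow> 'a"
        by (simp add: sum.cartesian_product)
      then show ?thesis by (simp only: fst_conv snd_conv)
    qed
    also have "\<dots> = (\<Sum>p\<in>I. \<Sum>q\<in>I. \<Sum>s\<in>I. h p q s m)"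
      using I by (simp add: sum.delta)
    also have "\<dots> = (\<Sum>p\<in>I. \<Sum>s\<in>I. \<Sum>q\<in>I. h p q s m)"
      by (intro sum.cong refl sum.swap)
    \<comment> \<open>The sum over q is split into its intended value, a on the diagonal, and the
      residual R.\<close>
    also have "\<dots> = (\<Sum>p\<in>I. \<Sum>s\<in>I. (if p = s then V p m * a * (V s m)\<^sup>\<star> else 0) + V p m * R p s * (V s m)\<^sup>\<star>)"
    proof (intro sum.cong refl)
      fix p s
      have "(\<Sum>q\<in>I. h p q s m) = V p m * (\<Sum>q\<in>I. C p q * b * (C s q)\<^sup>\<star>) * (V s m)\<^sup>\<star>"
        by (simp only: h_def sum_distrib_left sum_distrib_right)
      also have "(\<Sum>q\<in>I. C p q * b * (C s q)\<^sup>\<star>) = (if p = s then a else 0) + R p s"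
        by (simp add: R_def)
      finally show "(\<Sum>q\<in>I. h p q s m)
          = (if p = s then V p m * a * (V s m)\<^sup>\<star> else 0) + V p m * R p s * (V s m)\<^sup>\<star>"
        by (simp add: distrib_left distrib_right)
    qed
    finally show ?thesis using I by (simp add: sum.distrib sum.delta)
  qed
  ultimately have "asymp_eq (\<lambda>m. D m * b * (D m)\<^sup>\<star>)
      (\<lambda>m. (\<Sum>p\<in>I. V p m * a * (V p m)\<^sup>\<star>) + (\<Sum>p\<in>I. \<Sum>s\<in>I. V p m * R p s * (V s m)\<^sup>\<star>))"
    by (simp only: expand)
  \<comment> \<open>After a is moved to the left, the remaining sum is close to u, which acts as a
    right unit on a.\<close>
  moreover have "asymp_eq (\<lambda>m. (\<Sum>p\<in>I. V p m * a * (V p m)\<^sup>\<star>)) (\<lambda>m. a)"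
  proof -
    have "asymp_eq (\<lambda>m. 1 * (V p m * a) * (V p m)\<^sup>\<star>) (\<lambda>m. 1 * (a * V p m) * (V p m)\<^sup>\<star>)" if p: "p \<in> I" for p
      by (rule asymp_eq_mult_mult[OF Va[OF p] Bfun_const bVs[OF p]])
    then have "asymp_eq (\<lambda>m. \<Sum>p\<in>I. V p m * a * (V p m)\<^sup>\<star>) (\<lambda>m. \<Sum>p\<in>I. a * V p m * (V p m)\<^sup>\<star>)"
      by (intro asymp_eq_sum) simp
    also have "\<dots> = (\<lambda>m. a * (\<Sum>p\<in>I. V p m * (V p m)\<^sup>\<star>) * 1)"
      by (simp add: sum_distrib_left mult.assoc)
    also have "asymp_eq \<dots> (\<lambda>m. a * u * 1)"
      by (rule asymp_eq_mult_mult[OF u]) auto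
    finally show ?thesis by (simp add: au)
  qed
  ultimately show ?thesis
    by (rule asymp_eq_trans[OF _ asymp_eq_add[OF _ asymp_eq_refl]])
qed

section \<open>Cancellation of amplifications\<close>

text \<open>It lifts elements of A to M_N(A): the commutator with a matrix in M_N(A) has the
  commutators with its entries as entries.\<close>

lift_definition diagonal :: "nat \<Rightarrow> 'a::unital_cstar_algebra \<Rightarrow> 'a minf"
  is "\<lambda>N x i j. if i = j \<and> i < N then x else 0"
  by (rename_tac N x, rule_tac x=N in exI) auto

lemma diagonal_Mn: "diagonal N x \<in> Mn N"
  by (auto simp: Mn_def diagonal.rep_eq)

lemma entry_diagonal_mult: "entry (diagonal N x * y) i j = (if i < N then x * entry y i j else 0)"
proof -
  have "entry (diagonal N x * y) i j = (\<Sum>k<N. if k = i then x * entry y k j else 0)"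
    unfolding entry_times_left[OF diagonal_Mn] by (intro sum.cong refl) (auto simp: diagonal.rep_eq)
  then show ?thesis by (simp add: sum.delta)
qed

lemma entry_mult_diagonal: "entry (y * diagonal N x) i j = (if j < N then entry y i j * x else 0)"
proof -
  have "entry (y * diagonal N x) i j = (\<Sum>k<N. if k = j then entry y i k * x else 0)"
    unfolding entry_times_right[OF diagonal_Mn] by (intro sum.cong refl) (auto simp: diagonal.rep_eq)
  then show ?thesis by (simp add: sum.delta)
qed

lemma diagonal_mult: "diagonal N x * diagonal N y = diagonal N (x * y)"
  by (rule minf_eqI) (auto simp: entry_diagonal_mult diagonal.rep_eq)

lemma diagonal_star: "(diagonal N x)\<^sup>\<star> = diagonal N (x\<^sup>\<star>)"
  by (rule minf_eqI) (auto simp: diagonal.rep_eq star_zero)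

lemma diagonal_diff: "diagonal N (x - y) = diagonal N x - diagonal N y"
  by (rule minf_eqI) (auto simp: diagonal.rep_eq)

lemma diagonal_sum: "diagonal N (\<Sum>i\<in>I. f i) = (\<Sum>i\<in>I. diagonal N (f i))"
  by (rule minf_eqI) (auto simp: diagonal.rep_eq intro!: sum.neutral[symmetric] sum.neutral)

lemma diagonal_one: "diagonal N 1 = mone N"
  by (rule minf_eqI) (simp add: diagonal.rep_eq mone.rep_eq)

lemma embed_diff: "x \<in> Mn N \<Longrightarrow> y \<in> Mn N \<Longrightarrow> embed N (x - y) = embed N x - embed N y"
  by (rule mprod_eqI) (simp add: embed.rep_eq Mn_diff)

lemma embed_zero: "embed N 0 = 0"
  by (rule mprod_eqI) (simp add: embed.rep_eq Mn_zero)

lemma embed_sum: "(\<And>i. i \<in> I \<Longrightarrow> f i \<in> Mn N) \<Longrightarrow> embed N (\<Sum>i\<in>I. f i) = (\<Sum>i\<in>I. embed N (f i))"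
proof (induction I rule: infinite_finite_induct)
  case (insert i I)
  have "embed N (x + y) = embed N x + embed N y" if "x \<in> Mn N" "y \<in> Mn N" for x y :: "'b minf"
    using that by (intro mprod_eqI) (simp add: embed.rep_eq Mn_add)
  then show ?case using insert by (simp add: Mn_sum)
qed (auto simp: embed_zero)

lemma norm_embed_le: "x \<in> Mn N \<Longrightarrow> norm (embed N x) \<le> (\<Sum>i<N. \<Sum>j<N. norm (entry x i j))"
  by (rule norm_mprod_leI) (auto simp: embed.rep_eq sum_nonneg minf_norm_zero minf_norm_le_sum)

text \<open>Positivity of ||x||^2 - x^* x, conjugated by the entries of w and added up, compares the
  two inner products. The bound without a factor N keeps the columns contractive, so that
  conjugation by them does not enlarge the residual.\<close>

lemma norm_embed_diagonal_le: "norm (embed N (diagonal N (x :: 'a::unital_cstar_algebra))) \<le> norm x"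
proof (rule norm_mprod_leI)
  fix M
  have "minf_norm (diagonal N x) \<le> norm x"
  proof (rule minf_norm_leI)
    fix w :: "'a minf"
    obtain L where L: "w \<in> Mn L" by (rule in_Mn_obtain)
    define L' where "L' = max L N"
    have w: "w \<in> Mn L'" "diagonal N x * w \<in> Mn L'"
      unfolding L'_def using L by (auto intro!: Mn_mult intro: Mn_mono diagonal_Mn[THEN Mn_mono])
    have "nonneg_elem ((norm x)\<^sup>2 *\<^sub>R entry (w\<^sup>\<star> * w) 0 0
        - entry ((diagonal N x * w)\<^sup>\<star> * (diagonal N x * w)) 0 0)"
    proof -
      have "nonneg_elem ((norm x)\<^sup>2 *\<^sub>R ((entry w k 0)\<^sup>\<star> * entry w k 0)
          - (entry (diagonal N x * w) k 0)\<^sup>\<star> * entry (diagonal N x * w) k 0)" for k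
      proof (cases "k < N")
        case True
        have "nonneg_elem ((entry w k 0)\<^sup>\<star> * ((norm x)\<^sup>2 *\<^sub>R 1 - x\<^sup>\<star> * x) * entry w k 0)"
          using nonneg_elem_norm_minus[of "x\<^sup>\<star> * x"]
          by (intro nonneg_elem_conjugate) (simp add: star_mult star_star norm_star_mult_self)
        then show ?thesis using True by (simp add: entry_diagonal_mult star_mult algebra_simps)
      qed (simp add: entry_diagonal_mult star_zero nonneg_elem_scaleR nonneg_elem_star_mult_self)
      then show ?thesis
        by (simp add: entry_star_times[OF w(1)] entry_star_times[OF w(2)] scaleR_sum_right
            sum_subtractf[symmetric] nonneg_elem_sum)
    qed
    from nonneg_elem_norm_mono[OF nonneg_elem_inner this]
    have "(vec_norm (diagonal N x * w))\<^sup>2 \<le> (norm x * vec_norm w)\<^sup>2"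
      by (simp add: vec_norm_power2 power_mult_distrib)
    then show "vec_norm (diagonal N x * w) \<le> norm x * vec_norm w"
      by (rule power2_le_imp_le) (simp add: vec_norm_nonneg)
  qed simp
  then show "minf_norm (coord (embed N (diagonal N x)) M) \<le> norm x"
    by (simp add: embed.rep_eq minf_norm_zero)
qed

lemma embed_tendsto_0:
  assumes x: "\<And>m. x m \<in> Mn N" and lim: "\<And>i j. i < N \<Longrightarrow> j < N \<Longrightarrow> (\<lambda>m. entry (x m) i j) \<longlonglongrightarrow> 0"
  shows "(\<lambda>m. embed N (x m)) \<longlonglongrightarrow> 0"
proof (rule Lim_null_comparison)
  show "\<forall>\<^sub>F m in sequentially. norm (embed N (x m)) \<le> (\<Sum>i<N. \<Sum>j<N. norm (entry (x m) i j))"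
    by (simp add: norm_embed_le[OF x])
  have "(\<lambda>m. \<Sum>i<N. \<Sum>j<N. norm (entry (x m) i j)) \<longlonglongrightarrow> (\<Sum>i<N. \<Sum>j<N. 0)"
    by (intro tendsto_sum tendsto_norm_zero lim) auto
  then show "(\<lambda>m. \<Sum>i<N. \<Sum>j<N. norm (entry (x m) i j)) \<longlonglongrightarrow> 0" by simp
qed

lemma Mn_compress: "x \<in> Mn N \<Longrightarrow> y \<in> Mn N \<Longrightarrow> x * c * y \<in> Mn N"
  unfolding Mn_def[of N] mem_Collect_eq
proof (intro allI impI)
  fix i j
  assume x: "\<forall>i j. N \<le> i \<or> N \<le> j \<longrightarrow> entry x i j = 0"
    and y: "\<forall>i j. N \<le> i \<or> N \<le> j \<longrightarrow> entry y i j = 0" and ij: "N \<le> i \<or> N \<le> j"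
  have "entry (x * (c * y)) i j = 0" if "N \<le> i"
    using x that by (simp add: entry_times_left[of x N] Mn_def)
  moreover have "entry (x * c * y) i j = 0" if "N \<le> j"
    using y that by (simp add: entry_times_right[of y N] Mn_def)
  ultimately show "entry (x * c * y) i j = 0" using ij by (auto simp: mult.assoc)
qed

text \<open>The entries of the finitely many matrices \<open>c\<^sub>p\<^sub>q\<close>, \<open>a\<close>, \<open>b\<close> are fixed first; only then are the
  approximately central columns chosen, so the size of \<open>c\<close> does not matter.\<close>

lemma cuntz_subequivalent_of_amplify:
  fixes \<alpha> :: "'g \<Rightarrow> 'a::unital_cstar_algebra \<Rightarrow> 'a" and G :: "('g, 'm) monoid_scheme" and a b :: "'a minf"
  assumes G: "group G" and fin: "finite (carrier G)"
    and act: "cstar_action G \<alpha>" and rok: "rokhlin_property G \<alpha>" and sai: "strictly_approximately_inner G \<alpha>"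
    and a: "a \<in> Mn N" and b: "b \<in> Mn N" "b\<^sup>\<star> = b" and N: "1 \<le> N"
    and sub: "amplify N (card (carrier G)) a \<precsim> amplify N (card (carrier G)) b"
  shows "a \<precsim> b"
proof -
  define n where "n = card (carrier G)"
  define A where "A = amplify N n a"
  define B where "B = amplify N n b"
  obtain c0 where c0: "(\<lambda>k. minf_norm (c0 k * B * (c0 k)\<^sup>\<star> - A)) \<longlonglongrightarrow> 0"
    using sub by (auto simp: cuntz_subequivalent_def A_def B_def n_def)
  obtain \<phi> where \<phi>: "bij_betw \<phi> {..<n} (carrier G)"
    using ex_bij_betw_nat_finite[OF fin] by (auto simp: n_def atLeast0LessThan)
  have \<phi>G: "\<phi> p \<in> carrier G" if "p < n" for p using bij_betwE[OF \<phi>] that by auto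
  have "\<exists>d. minf_norm (d * b * d\<^sup>\<star> - a) < \<epsilon>" if \<epsilon>: "0 < \<epsilon>" for \<epsilon>
  proof -
    \<comment> \<open>There will be n^2 residual terms, each of norm at most N^2 \<kappa>. The
      denominator K + 1 instead of K leaves a positive remainder for the asymptotic errors.\<close>
    define K where "K = real n * real n * (real N * real N)"
    define \<kappa> where "\<kappa> = \<epsilon> / (K + 1)"
    have K: "0 \<le> K" by (simp add: K_def)
    have \<kappa>: "0 < \<kappa>" using \<epsilon> K by (simp add: \<kappa>_def)
    have "(K + 1) * \<kappa> = \<epsilon>" using K by (simp add: \<kappa>_def)
    then have K\<kappa>: "K * \<kappa> < \<epsilon>" using \<kappa> by (simp add: distrib_right)
    obtain k where k: "minf_norm (c0 k * B * (c0 k)\<^sup>\<star> - A) < \<kappa>"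
      using LIMSEQ_D[OF c0 \<kappa>] by (auto simp: minf_norm_nonneg)
    \<comment> \<open>The matrix \<open>c0 k\<close> may have any size. Compression by P fixes A and
      B and does not enlarge the error.\<close>
    define P where "P = (mone (n * N) :: 'a minf)"
    define c where "c = P * c0 k * P"
    have P: "P \<in> Mn (n * N)" "P\<^sup>\<star> = P" "minf_norm P \<le> 1"
      by (simp_all add: P_def Mn_mone mone_star minf_norm_mone_le)
    have AB: "A \<in> Mn (n * N)" "B \<in> Mn (n * N)" by (simp_all add: A_def B_def amplify_Mn)
    have PAB: "P * A * P = A" "P * B * P = B"
      using AB by (simp_all add: P_def mone_mult_left mone_mult_right)
    have c: "c \<in> Mn (n * N)" unfolding c_def by (rule Mn_compress[OF P(1) P(1)])
    have "c * B * c\<^sup>\<star> = P * c0 k * (P * B * P) * (c0 k)\<^sup>\<star> * P"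
      by (simp add: c_def minf_star_mult P(2) mult.assoc)
    also have "\<dots> = P * (c0 k * B * (c0 k)\<^sup>\<star>) * P"
      unfolding PAB(2) by (simp only: mult.assoc)
    finally have "c * B * c\<^sup>\<star> - A = P * (c0 k * B * (c0 k)\<^sup>\<star>) * P - P * A * P"
      by (simp only: PAB(1))
    then have "c * B * c\<^sup>\<star> - A = P * (c0 k * B * (c0 k)\<^sup>\<star> - A) * P"
      by (simp only: left_diff_distrib right_diff_distrib)
    then have "minf_norm (c * B * c\<^sup>\<star> - A) \<le> minf_norm P * minf_norm (c0 k * B * (c0 k)\<^sup>\<star> - A) * minf_norm P"
      by (simp only:) (rule order_trans[OF minf_norm_mult mult_right_mono[OF minf_norm_mult minf_norm_nonneg]])
    also have "\<dots> \<le> 1 * minf_norm (c0 k * B * (c0 k)\<^sup>\<star> - A) * 1"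
      using P(3) by (intro mult_mono) (auto simp: minf_norm_nonneg)
    finally have cB: "minf_norm (c * B * c\<^sup>\<star> - A) \<le> \<kappa>" using k by simp
    define C where "C p q = unblock N p q c" for p q
    have CM: "C p q \<in> Mn N" for p q by (simp add: C_def unblock_Mn)
    \<comment> \<open>These residuals turn out to be the N x N blocks of c B c^* - A, so their
      entries are at most \<kappa> in norm.\<close>
    define r where "r p s = (\<Sum>q<n. C p q * b * (C s q)\<^sup>\<star>) - (if p = s then a else 0)" for p s
    have rM: "r p s \<in> Mn N" for p s
      unfolding r_def using a b CM by (auto intro!: Mn_diff Mn_sum Mn_mult Mn_star Mn_zero)
    have "r p s = unblock N p s (c * B * c\<^sup>\<star> - A)" if ps: "p < n" "s < n" for p s
    proof -
      have cd: "c = (\<Sum>p<n. \<Sum>q<n. block N p q (C p q))"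
        unfolding C_def by (rule block_decomposition[OF c N])
      have "c * B = (\<Sum>p<n. \<Sum>q<n. block N p q (C p q * b))"
      proof -
        have "block N p q (C p q) * B = block N p q (C p q * b)" if "q < n" for p q
          using that by (simp add: B_def amplify_def sum_distrib_left block_mult[OF CM N] sum.delta)
        then show ?thesis by (subst cd) (simp add: sum_distrib_right)
      qed
      moreover have "c\<^sup>\<star> = (\<Sum>s<n. \<Sum>t<n. block N t s ((C s t)\<^sup>\<star>))"
        by (subst cd) (simp add: minf_star_sum block_star)
      ultimately have "c * B * c\<^sup>\<star> = (\<Sum>p<n. \<Sum>s<n. \<Sum>q<n. \<Sum>t<n.
          block N p q (C p q * b) * block N t s ((C s t)\<^sup>\<star>))"
        by (simp add: sum_product)
      also have "\<dots> = (\<Sum>p<n. \<Sum>s<n. \<Sum>q<n. block N p s (C p q * b * (C s q)\<^sup>\<star>))"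
        by (simp add: block_mult[OF Mn_mult[OF CM b(1)] N] sum.delta)
      finally have "unblock N p s (c * B * c\<^sup>\<star>)
          = (\<Sum>p'<n. \<Sum>s'<n. \<Sum>q<n. if p = p' \<and> s = s' then C p' q * b * (C s' q)\<^sup>\<star> else 0)"
        by (simp add: unblock_sum unblock_block[OF Mn_mult[OF Mn_mult[OF CM b(1)] Mn_star[OF CM]]])
      also have "\<dots> = (\<Sum>p'<n. if p = p' then (\<Sum>s'<n. if s = s' then (\<Sum>q<n. C p' q * b * (C s' q)\<^sup>\<star>) else 0) else 0)"
      proof -
        have "(\<Sum>s'<n. \<Sum>q<n. if p = p' \<and> s = s' then C p' q * b * (C s' q)\<^sup>\<star> else 0)
            = (if p = p' then (\<Sum>s'<n. if s = s' then (\<Sum>q<n. C p' q * b * (C s' q)\<^sup>\<star>) else 0) else 0)" for p'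
        proof -
          have "(\<Sum>q<n. if p = p' \<and> s = s' then C p' q * b * (C s' q)\<^sup>\<star> else 0)
              = (if p = p' then (if s = s' then (\<Sum>q<n. C p' q * b * (C s' q)\<^sup>\<star>) else 0) else 0)" for s'
            by simp
          then show ?thesis by simp
        qed
        then show ?thesis by simp
      qed
      also have "\<dots> = (\<Sum>q<n. C p q * b * (C s q)\<^sup>\<star>)" using ps by (simp add: sum.delta')
      finally have 1: "unblock N p s (c * B * c\<^sup>\<star>) = (\<Sum>q<n. C p q * b * (C s q)\<^sup>\<star>)" .
      have "unblock N p s A = (\<Sum>t<n. if p = t then (if s = t then a else 0) else 0)"
        unfolding A_def amplify_def unblock_sum by (intro sum.cong refl) (simp add: unblock_block[OF a])
      also have "\<dots> = (if p = s then a else 0)" using ps by (simp add: sum.delta')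
      finally show ?thesis by (simp add: r_def unblock_diff 1)
    qed
    then have r_entry: "norm (entry (r p s) i j) \<le> \<kappa>" if "p < n" "s < n" for p s i j
      using norm_entry_le_minf_norm[of "c * B * c\<^sup>\<star> - A" "p * N + i" "s * N + j"] cB that \<kappa>
      by (auto simp: unblock.rep_eq)
    have r_norm: "norm (embed N (r p s)) \<le> real N * real N * \<kappa>" if "p < n" "s < n" for p s
    proof -
      have "norm (embed N (r p s)) \<le> (\<Sum>i<N. \<Sum>j<N. norm (entry (r p s) i j))"
        by (rule norm_embed_le[OF rM])
      also have "\<dots> \<le> (\<Sum>i<N. \<Sum>j<N. \<kappa>)" by (intro sum_mono r_entry that)
      finally show ?thesis by (simp add: mult.assoc)
    qed
    define F where "F = (\<lambda>(x, i, j). entry x i j) `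
      ((insert a (insert b ((\<lambda>(p, q). C p q) ` ({..<n} \<times> {..<n})))) \<times> {..<N} \<times> {..<N})"
    have F: "finite F" by (simp add: F_def)
    have FI: "entry x i j \<in> F"
      if "x = a \<or> x = b \<or> (\<exists>p<n. \<exists>q<n. x = C p q)" "i < N" "j < N" for x i j
      unfolding F_def by (rule image_eqI[of _ _ "(x, i, j)"]) (use that in auto)
    \<comment> \<open>All estimates are collected in one predicate with tolerance 1/(m + 1), so that
      the sequences e and v come from a single choice.\<close>
    define central where "central m e v \<longleftrightarrow> norm e \<le> 1 \<and> e\<^sup>\<star> = e \<and> (\<forall>g\<in>carrier G. norm (v g) \<le> 1 \<and> v g * e = v g) \<and>
        (\<forall>x\<in>F. norm (e * x - x * e) \<le> inverse (real (Suc m))) \<and>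
        (\<forall>g\<in>carrier G. \<forall>x\<in>F. norm (v g * x - x * v g) \<le> inverse (real (Suc m))) \<and>
        (\<forall>g\<in>carrier G. \<forall>h\<in>carrier G. norm ((v g)\<^sup>\<star> * v h - (if g = h then e else 0)) \<le> inverse (real (Suc m))) \<and>
        norm ((\<Sum>g\<in>carrier G. v g * (v g)\<^sup>\<star>) - 1) \<le> inverse (real (Suc m))"
      for m and e :: 'a and v :: "'g \<Rightarrow> 'a"
    have "\<exists>e v. central m e v" for m
      by (rule approximately_central_columns[OF G fin act rok sai F, of "inverse (real (Suc m))"])
        (simp, unfold central_def, blast)
    then obtain e v where ev: "\<And>m. central m (e m) (v m)" by metis
    then have e: "\<And>m. norm (e m) \<le> 1" "\<And>m. (e m)\<^sup>\<star> = e m"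
      and v: "\<And>m g. g \<in> carrier G \<Longrightarrow> norm (v m g) \<le> 1" "\<And>m g. g \<in> carrier G \<Longrightarrow> v m g * e m = v m g"
      and e_comm: "\<And>m x. x \<in> F \<Longrightarrow> norm (e m * x - x * e m) \<le> inverse (real (Suc m))"
      and v_comm: "\<And>m g x. g \<in> carrier G \<Longrightarrow> x \<in> F \<Longrightarrow> norm (v m g * x - x * v m g) \<le> inverse (real (Suc m))"
      and v_orth: "\<And>m g h. g \<in> carrier G \<Longrightarrow> h \<in> carrier G \<Longrightarrow>
        norm ((v m g)\<^sup>\<star> * v m h - (if g = h then e m else 0)) \<le> inverse (real (Suc m))"
      and v_sum: "\<And>m. norm ((\<Sum>g\<in>carrier G. v m g * (v m g)\<^sup>\<star>) - 1) \<le> inverse (real (Suc m))"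
      unfolding central_def by blast+
    have null: "f \<longlonglongrightarrow> 0" if "\<And>m. norm (f m) \<le> inverse (real (Suc m))" for f :: "nat \<Rightarrow> 'a"
      by (rule Lim_null_comparison[OF _ LIMSEQ_inverse_real_of_nat]) (use that in simp)
    define V where "V p m = embed N (diagonal N (v m (\<phi> p)))" for p m
    define E where "E m = embed N (diagonal N (e m))" for m
    have comm: "asymp_eq (\<lambda>m. embed N (diagonal N (f m)) * embed N x) (\<lambda>m. embed N x * embed N (diagonal N (f m)))"
      if x: "x \<in> Mn N" and f: "\<And>i j. i < N \<Longrightarrow> j < N \<Longrightarrow> (\<lambda>m. f m * entry x i j - entry x i j * f m) \<longlonglongrightarrow> 0"
      for x f
    proof -
      have "(\<lambda>m. embed N (diagonal N (f m) * x - x * diagonal N (f m))) \<longlonglongrightarrow> 0"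
        by (rule embed_tendsto_0)
          (use x f in \<open>auto simp: entry_diagonal_mult entry_mult_diagonal intro!: Mn_diff Mn_mult diagonal_Mn\<close>)
      then show ?thesis
        using x by (simp add: asymp_eq_def embed_diff embed_mult Mn_mult diagonal_Mn)
    qed
    have diag_null: "(\<lambda>m. embed N (diagonal N (f m))) \<longlonglongrightarrow> 0" if "f \<longlonglongrightarrow> 0" for f :: "nat \<Rightarrow> 'a"
      by (rule Lim_null_comparison[OF _ tendsto_norm_zero[OF that]]) (simp add: norm_embed_diagonal_le)
    define D where "D m = (\<Sum>x\<in>{..<n} \<times> {..<n}.
      V (fst x) m * embed N (C (fst x) (snd x)) * (V (snd x) m)\<^sup>\<star>)" for m
    define R where "R p s = (\<Sum>q<n. embed N (C p q) * embed N b * (embed N (C s q))\<^sup>\<star>)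
      - (if p = s then embed N a else 0)" for p s
    have R: "R p s = embed N (r p s)" for p s
      using a b CM by (auto simp: R_def r_def embed_diff embed_sum embed_mult embed_star Mn_sum Mn_mult Mn_star)
    have "asymp_eq (\<lambda>m. D m * embed N b * (D m)\<^sup>\<star>)
        (\<lambda>m. embed N a + (\<Sum>p<n. \<Sum>s<n. V p m * R p s * (V s m)\<^sup>\<star>))"
      unfolding D_def R_def
    \<comment> \<open>The range projections of the columns sum up to nearly the unit of the N-th
      factor, not of the product; hence this u.\<close>
    proof (rule asymp_eq_matrix_conjugation[where E = E and u = "embed N (mone N)"])
      show "Bseq (V p)" if "p \<in> {..<n}" for p
        using that by (intro BseqI'[of _ 1]) (simp add: V_def order_trans[OF norm_embed_diagonal_le v(1)[OF \<phi>G]])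
      show "Bseq E" by (intro BseqI'[of _ 1]) (simp add: E_def order_trans[OF norm_embed_diagonal_le e(1)])
      show "(E m)\<^sup>\<star> = E m" for m
        by (simp add: E_def embed_star[symmetric] diagonal_Mn diagonal_star e(2))
      show "V p m * E m = V p m" if "p \<in> {..<n}" for p m
        using that by (simp add: V_def E_def embed_mult[symmetric] diagonal_Mn diagonal_mult v(2)[OF \<phi>G])
      show "asymp_eq (\<lambda>m. E m * embed N (C p q)) (\<lambda>m. embed N (C p q) * E m)"
        if "p \<in> {..<n}" "q \<in> {..<n}" for p q
        unfolding E_def using that by (intro comm CM null e_comm FI) auto
      show "asymp_eq (\<lambda>m. V p m * embed N a) (\<lambda>m. embed N a * V p m)" if "p \<in> {..<n}" for p
        unfolding V_def using that by (intro comm a null v_comm FI \<phi>G) auto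
      show "asymp_eq (\<lambda>m. V p m * embed N b) (\<lambda>m. embed N b * V p m)" if "p \<in> {..<n}" for p
        unfolding V_def using that by (intro comm b null v_comm FI \<phi>G) auto
      show "asymp_eq (\<lambda>m. (V p m)\<^sup>\<star> * V q m) (\<lambda>m. if p = q then E m else 0)"
        if pq: "p \<in> {..<n}" "q \<in> {..<n}" for p q
      proof -
        have "(\<phi> p = \<phi> q) = (p = q)" using \<phi> pq by (meson bij_betw_imp_inj_on inj_on_eq_iff)
        then have "(\<lambda>m. (v m (\<phi> p))\<^sup>\<star> * v m (\<phi> q) - (if p = q then e m else 0)) \<longlonglongrightarrow> 0"
          using v_orth[OF \<phi>G \<phi>G, of p q] pq by (intro null) auto
        from diag_null[OF this] show ?thesis
          by (cases "p = q") (simp_all add: asymp_eq_def V_def E_def diagonal_diff embed_diff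
              diagonal_Mn embed_star[symmetric] embed_mult[symmetric] diagonal_star diagonal_mult Mn_star)
      qed
      have "(\<lambda>m. (\<Sum>p<n. v m (\<phi> p) * (v m (\<phi> p))\<^sup>\<star>) - 1) \<longlonglongrightarrow> 0"
        using v_sum sum.reindex_bij_betw[OF \<phi>, of "\<lambda>g. v m g * (v m g)\<^sup>\<star>" for m]
        by (intro null) simp
      from diag_null[OF this]
      show "asymp_eq (\<lambda>m. \<Sum>p<n. V p m * (V p m)\<^sup>\<star>) (\<lambda>_. embed N (mone N))"
        by (simp add: asymp_eq_def V_def diagonal_diff embed_diff diagonal_sum embed_sum diagonal_one Mn_mone
            Mn_sum diagonal_Mn embed_star[symmetric] embed_mult[symmetric] diagonal_star diagonal_mult)
      show "embed N a * embed N (mone N) = embed N a"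
        using a by (simp add: embed_mult[symmetric] Mn_mone mone_mult_right)
      show "(embed N b)\<^sup>\<star> = embed N b" using b by (simp add: embed_star[symmetric])
    qed simp
    then have lim: "(\<lambda>m. D m * embed N b * (D m)\<^sup>\<star>
        - (embed N a + (\<Sum>p<n. \<Sum>s<n. V p m * R p s * (V s m)\<^sup>\<star>))) \<longlonglongrightarrow> 0"
      by (simp add: asymp_eq_def)
    \<comment> \<open>The residual costs at most K \<kappa> for every m, so the asymptotic error has
      to fit into what remains of \<epsilon>.\<close>
    obtain m where m: "norm (D m * embed N b * (D m)\<^sup>\<star>
        - (embed N a + (\<Sum>p<n. \<Sum>s<n. V p m * R p s * (V s m)\<^sup>\<star>))) < \<epsilon> - K * \<kappa>"
      using LIMSEQ_D[OF lim, of "\<epsilon> - K * \<kappa>"] K\<kappa> by auto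
    have "norm (\<Sum>p<n. \<Sum>s<n. V p m * R p s * (V s m)\<^sup>\<star>) \<le> (\<Sum>p<n. \<Sum>s<n. real N * real N * \<kappa>)"
    proof (intro sum_norm_le)
      fix p s assume ps: "p \<in> {..<n}" "s \<in> {..<n}"
      have "norm (V p m) \<le> 1" "norm ((V s m)\<^sup>\<star>) \<le> 1"
        using ps by (simp_all add: V_def order_trans[OF norm_embed_diagonal_le v(1)[OF \<phi>G]])
      from norm_mult_mult_le[OF this, of "R p s"]
      show "norm (V p m * R p s * (V s m)\<^sup>\<star>) \<le> real N * real N * \<kappa>"
        using r_norm[of p s] ps by (simp add: R)
    qed
    also have "\<dots> = K * \<kappa>" by (simp add: K_def)
    finally have "norm (D m * embed N b * (D m)\<^sup>\<star> - embed N a) < \<epsilon>"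
      using m norm_triangle_sub[of "D m * embed N b * (D m)\<^sup>\<star> - embed N a"
          "\<Sum>p<n. \<Sum>s<n. V p m * R p s * (V s m)\<^sup>\<star>"] by (simp add: algebra_simps)
    \<comment> \<open>Coordinate N respects products and adjoints, so the coordinate of
      \<open>D m\<close> is the required d.\<close>
    then have "minf_norm (coord (D m * embed N b * (D m)\<^sup>\<star> - embed N a) N) < \<epsilon>"
      by (rule le_less_trans[OF minf_norm_coord_le])
    then show ?thesis
      using a b by (auto simp: coord_embed)
  qed
  then have "\<forall>m. \<exists>d. minf_norm (d * b * d\<^sup>\<star> - a) < inverse (real (Suc m))" by simp
  then obtain d where d: "\<And>m. minf_norm (d m * b * (d m)\<^sup>\<star> - a) < inverse (real (Suc m))" by metis
  have "(\<lambda>m. minf_norm (d m * b * (d m)\<^sup>\<star> - a)) \<longlonglongrightarrow> 0"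
    by (rule Lim_null_comparison[OF _ LIMSEQ_inverse_real_of_nat])
      (use d in \<open>simp add: minf_norm_nonneg less_imp_le\<close>)
  then show ?thesis by (auto simp: cuntz_subequivalent_def)
qed

section \<open>From r-comparison to r/n-comparison\<close>

lemma has_comparison_divide:
  fixes \<alpha> :: "'g \<Rightarrow> 'a::unital_cstar_algebra \<Rightarrow> 'a" and G :: "('g, 'm) monoid_scheme"
  assumes G: "group G" and fin: "finite (carrier G)"
    and act: "cstar_action G \<alpha>" and rok: "rokhlin_property G \<alpha>" and sai: "strictly_approximately_inner G \<alpha>"
    and cmp: "has_comparison TYPE('a) r"
  shows "has_comparison TYPE('a) (r / real (card (carrier G)))"
  unfolding has_comparison_def
proof (intro ballI impI)
  fix a b :: "'a minf"
  assume a: "a \<in> minf_positive" and b: "b \<in> minf_positive"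
    and less: "\<forall>\<rho>\<in>QT. \<forall>\<tau>. quasitrace_extension \<rho> \<tau> \<longrightarrow>
      dim_fun \<tau> a + r / real (card (carrier G)) < dim_fun \<tau> b"
  define n where "n = card (carrier G)"
  have n: "0 < n" using fin G group.is_monoid[OF G] monoid.one_closed by (force simp: n_def card_gt_0_iff)
  obtain M where M: "a \<in> Mn_positive M" using a minf_positive_obtain by blast
  obtain L where L: "b \<in> Mn_positive L" "1 \<le> L" using b minf_positive_obtain by blast
  \<comment> \<open>Both matrices need the same block size, since \<open>amplify\<close> depends on
    it.\<close>
  define N where "N = max M L"
  have N: "a \<in> Mn_positive N" "b \<in> Mn_positive N" "1 \<le> N"
    using Mn_positive_mono[OF M, of N] Mn_positive_mono[OF L(1), of N] L(2) by (auto simp: N_def)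
  have "amplify N n a \<precsim> amplify N n b"
  proof (rule cmp[unfolded has_comparison_def, rule_format])
    show "amplify N n a \<in> minf_positive" "amplify N n b \<in> minf_positive"
      by (rule amplify_positive[OF N(1,3)], rule amplify_positive[OF N(2,3)])
    fix \<rho> :: "'a \<Rightarrow> complex" and \<tau>
    assume \<rho>: "\<rho> \<in> QT" and \<tau>: "quasitrace_extension \<rho> \<tau>"
    then have "dim_fun \<tau> a + r / real n < dim_fun \<tau> b" using less by (simp add: n_def)
    then have "real n * dim_fun \<tau> a + r < real n * dim_fun \<tau> b" using n by (simp add: field_simps)
    moreover have q: "quasitrace_conditions minf_norm (Mn k) \<tau>" for k
      using \<tau> by (simp add: quasitrace_extension_def)
    ultimately show "dim_fun \<tau> (amplify N n a) + r < dim_fun \<tau> (amplify N n b)"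
      by (simp add: dim_fun_amplify[OF q N(1,3)] dim_fun_amplify[OF q N(2,3)])
  qed
  then show "a \<precsim> b"
    using cuntz_subequivalent_of_amplify[OF G fin act rok sai _ _ _ N(3)] N(1,2)
    by (auto simp: n_def Mn_positive_in_Mn Mn_positive_star)
qed

theorem proposition3p22:
  fixes G :: "('g, 'm) monoid_scheme"
  assumes "stably_finite TYPE('a::unital_cstar_algebra)"
    and "0 < rc TYPE('a)" and "rc TYPE('a) < \<infinity>"
    and "group G" and "finite (carrier G)" and "carrier G \<noteq> {\<one>\<^bsub>G\<^esub>}"
  shows "\<not> (\<exists>\<alpha> :: 'g \<Rightarrow> 'a \<Rightarrow> 'a.
    cstar_action G \<alpha> \<and> rokhlin_property G \<alpha> \<and> strictly_approximately_inner G \<alpha>)"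
proof safe
  fix \<alpha> :: "'g \<Rightarrow> 'a \<Rightarrow> 'a"
  assume \<alpha>: "cstar_action G \<alpha>" "rokhlin_property G \<alpha>" "strictly_approximately_inner G \<alpha>"
  define n where "n = card (carrier G)"
  define S where "S = {r. 0 \<le> r \<and> has_comparison TYPE('a) r}"
  have rc: "rc TYPE('a) = Inf (ereal ` S)" by (simp add: rc_def S_def)
  obtain R where R: "rc TYPE('a) = ereal R" "0 < R"
    using assms(2,3) by (cases "rc TYPE('a)") auto
  have "\<one>\<^bsub>G\<^esub> \<in> carrier G" using assms(4) by (simp add: group.is_monoid monoid.one_closed)
  then have "{\<one>\<^bsub>G\<^esub>} \<subset> carrier G" using assms(6) by blast
  from psubset_card_mono[OF assms(5) this] have n: "2 \<le> n" by (simp add: n_def)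
  \<comment> \<open>The infimum need not be attained, but some r in S lies below 2 R because R > 0;
    as n >= 2, r/n is then an element of S below R.\<close>
  have "rc TYPE('a) < ereal (2 * R)" using R by simp
  then obtain r where r: "r \<in> S" "r < 2 * R"
    unfolding rc Inf_less_iff by auto
  then have "r / real n \<in> S"
    using has_comparison_divide[OF assms(4,5) \<alpha>] by (auto simp: S_def n_def)
  then have "ereal R \<le> ereal (r / real n)"
    unfolding R(1)[symmetric] rc by (intro Inf_lower) simp
  then have "R * real n \<le> r" using n by (simp add: field_simps)
  moreover have "R * 2 \<le> R * real n" using n R(2) by (intro mult_left_mono) auto
  ultimately show False using r(2) by simp
qed

end
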